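(* Let $\mathcal{A}$ be an alternating $\mathsf{Val}$ automaton realizing a function, where either (i) $\mathcal{A}$ is on finite words and $\mathsf{Val}:\mathbb{Q}^*\to\mathbb{R}$ is an arbitrary value function, or (ii) $\mathcal{A}$ is on infinite words and $\mathsf{Val}$ is one of $\mathsf{Inf}$, $\mathsf{Sup}$, $\mathsf{LimInf}$, $\mathsf{LimSup}$, or $\mathsf{DSum}$ (for a discount factor $\lambda\in\mathbb{Q}\cap(0,1)$). Then $\mathcal{A}$ is good for games if and only if $\mathcal{A}$ is threshold history deterministic.
   Context: **Value functions** on $v=v_0v_1\ldots$: $\mathsf{Inf}(v)=\inf_n v_n$, $\mathsf{Sup}(v)=\sup_n v_n$, $\mathsf{LimInf}(v)=\lim_{n\to\infty}\inf\{v_i: i\ge n\}$, $\mathsf{LimSup}(v)=\lim_{n\to\infty}\sup\{v_i: i\ge n\}$, $\mathsf{DSum}(v)=\sum_{i\ge0}\lambda^iv_i$. **Games.** Let $\Sigma$ be a finite nonempty alphabet. An arena is $(V,E,V_E,V_A,L)$ with a (possibly infinite) set $V$ of positions partitioned into Eve's positions $V_E$ and Adam's positions $V_A$, an initial position, edges $E\subseteq V\times V$ and labels $L:E\to\Sigma\cup\{\varepsilon\}$. In infinite-duration games every position has an outgoing edge. A play is a maximal path from the initial position; its non-$\varepsilon$ labels form a word. An $f$ game is an arena with payoff function $f$ (with $f:\Sigma^*\to\mathbb{R}$ or $f:\Sigma^\omega\to\mathbb{R}$; plays are assumed to induce words in the domain of $f$); the payoff of a play is the $f$-value of its word. Strategies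 map partial plays ending in a position of the respective player to an outgoing edge. The value of an Eve strategy is the infimum of payoffs over plays agreeing with it, and the value of an Adam strategy is the supremum. The game is determined if (sup over Eve strategies of their values) $=$ (inf over Adam strategies of their values); this number is the value of the game. Standing assumption: all games considered (including product games) are determined. **Automata.** An alternating quantitative automaton is $\mathcal{A}=(\Sigma,Q,\iota,\delta)$ with finite nonempty state set $Q$, initial state $\iota\in Q$, and $\delta:Q\times\Sigma\to \mathsf{B}^+(\mathbb{Q}\times Q)$, where $\mathsf{B}^+(\mathbb{Q}\times Q)$ is the set of positive Boolean formulas over (rational weight, state) pairs; it is total (each $\delta(q,a)$ contains at least one pair). A $\mathsf{Val}$ automaton is one equipped with a value function $\mathsf{Val}:\mathbb{Q}^*\to\mathbb{R}$ (finite words) or $\mathsf{Val}$ defined on infinite weight sequences (infinite words). For a word $w$, the game $G(\mathcal{A},w)$ is played letter by letter from $\iota$: in state $q$ with next letter $a$, Eve resolves the disjunctions and Adam the conjunctions of $\delta(q,a)$ until a pair $(x,q')$ is reached; weight $x$ is output and the state becomes $q'$. The payoff is $\mathsf{Val}$ of the output weight sequence. The value $\mathcal{A}(w)$ is the value of this game; $\mathcal{A}$ realizes the function $w\mapsto\mathcal{A}(w)$ if this game is determined for all $w$. **Product.** For a $\Sigma$-labelled game $G$ and an automaton $\mathcal{A}$ over $\Sigma$, the product game $G\times\mathcal{A}$ starts in (initial position of $G$, $\iota$). From $(v,q)$ the owner of $v$ in $G$ picks an edge $(v,v')$; if it is labelled $\varepsilon$ the game moves to $(v',q)$; if it is labelled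 $a\in\Sigma$, then Eve resolves the disjunctions and Adam the conjunctions of $\delta(q,a)$ until a pair $(x,q')$ is reached, weight $x$ is output, and the game moves to $(v',q')$. The payoff is $\mathsf{Val}$ of the output weight sequence. **Good for games.** $\mathcal{A}$ realizing $f$ is good for games if for every determined game $G$ with a $\Sigma$-labelled arena and payoff function $f$, $G$ and $G\times\mathcal{A}$ have the same value. **Threshold history determinism.** Eve's letter game on $\mathcal{A}$: starting from $\iota$, repeatedly, in state $q$ Adam picks a letter $a\in\Sigma$, then Eve resolves the disjunctions and Adam the conjunctions of $\delta(q,a)$, yielding a transition with some weight and a new state. An infinite play yields an infinite word $w$ and an infinite sequence $\pi$ of transitions; $\mathsf{Val}(\pi)$ denotes $\mathsf{Val}$ of its weight sequence. In Eve's $t$-threshold letter game, for infinite words Eve wins the play if $\mathcal{A}(w)\ge t\implies\mathsf{Val}(\pi)\ge t$; for finite words she wins if for all $i$, $\mathcal{A}(w[0..i])\ge t\implies\mathsf{Val}(\pi[0..i])\ge t$. Adam's $t$-threshold letter game is the same except that Eve picks the letters, and Adam wins the play if $\mathcal{A}(w)<t\implies\mathsf{Val}(\pi)<t$ (for finite words: if this holds for all prefixes $w[0..i],\pi[0..i]$). A player wins a letter game if they have a strategy such that all plays agreeing with it are won by them. $\mathcal{A}$ is $t$-threshold history deterministic if Eve wins Eve's and Adam wins Adam's $t$-threshold letter game, and threshold history deterministic if this holds for all $t\in\mathbb{R}$. *)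

theory Defs
  imports Complex_Main "HOL-Library.Extended_Real" "HOL-Library.Infinite_Set"
begin

section \<open>Finite and infinite sequences\<close>

datatype 'l seq = FinSeq "'l list" | InfSeq "nat \<Rightarrow> 'l"

text \<open>
  A real-valued function whose domain is either the set of all finite sequences or the set of all
  infinite sequences. It serves both as payoff function (on words) and as value function
  (on weight sequences).
\<close>

datatype 'l seqfun = OnFin "'l list \<Rightarrow> real" | OnInf "(nat \<Rightarrow> 'l) \<Rightarrow> real"

fun seqdom :: "'l seqfun \<Rightarrow> 'l seq set" where
  "seqdom (OnFin g) = range FinSeq"
| "seqdom (OnInf g) = range InfSeq"

fun app :: "'l seqfun \<Rightarrow> 'l seq \<Rightarrow> real" where
  "app (OnFin g) (FinSeq u) = g u"
| "app (OnInf g) (InfSeq s) = g s"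
| "app _ _ = undefined"

text \<open>The subsequence of the labels other than \<open>None\<close>, where \<open>None\<close> is the empty label.\<close>

fun nonempty_labels :: "'l option seq \<Rightarrow> 'l seq" where
  "nonempty_labels (FinSeq u) = FinSeq (map the (filter (\<lambda>x. x \<noteq> None) u))"
| "nonempty_labels (InfSeq s) =
     (let I = {i. s i \<noteq> None} in
      if finite I then FinSeq (map (\<lambda>i. the (s i)) (sorted_list_of_set I))
      else InfSeq (\<lambda>n. the (s (enumerate I n))))"

section \<open>Games\<close>

datatype player = Eve | Adam

text \<open>Adam's positions are those in \<open>positions\<close> that are not in \<open>eve_positions\<close>.\<close>

record ('v, 'l) arena =
  positions :: "'v set"
  eve_positions :: "'v set"
  init_pos :: 'v
  edges :: "('v \<times> 'v) set"
  edge_label :: "'v \<times> 'v \<Rightarrow> 'l option"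

definition wf_arena :: "('v, 'l) arena \<Rightarrow> bool" where
  "wf_arena G \<longleftrightarrow> eve_positions G \<subseteq> positions G \<and> init_pos G \<in> positions G
     \<and> edges G \<subseteq> positions G \<times> positions G"

fun owned :: "('v, 'l) arena \<Rightarrow> player \<Rightarrow> 'v set" where
  "owned G Eve = eve_positions G"
| "owned G Adam = positions G - eve_positions G"

definition partial_play :: "('v, 'l) arena \<Rightarrow> 'v list \<Rightarrow> bool" where
  "partial_play G h \<longleftrightarrow> h \<noteq> [] \<and> hd h = init_pos G
     \<and> (\<forall>n. Suc n < length h \<longrightarrow> (h ! n, h ! Suc n) \<in> edges G)"

fun play :: "('v, 'l) arena \<Rightarrow> 'v seq \<Rightarrow> bool" where
  "play G (FinSeq h) \<longleftrightarrow> partial_play G h \<and> (\<nexists>v. (last h, v) \<in> edges G)"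
| "play G (InfSeq p) \<longleftrightarrow> p 0 = init_pos G \<and> (\<forall>n. (p n, p (Suc n)) \<in> edges G)"

fun edge_labels :: "('v, 'l) arena \<Rightarrow> 'v seq \<Rightarrow> 'l option seq" where
  "edge_labels G (FinSeq h) = FinSeq (map (edge_label G) (zip h (tl h)))"
| "edge_labels G (InfSeq p) = InfSeq (\<lambda>n. edge_label G (p n, p (Suc n)))"

definition out_word :: "('v, 'l) arena \<Rightarrow> 'v seq \<Rightarrow> 'l seq" where
  "out_word G p = nonempty_labels (edge_labels G p)"

text \<open>
  As edges are pairs of positions, a strategy may return the target of the chosen edge. Its value
  on partial plays that end in a dead end or in a position of the opponent is irrelevant.
\<close>

definition strategy :: "('v, 'l) arena \<Rightarrow> player \<Rightarrow> ('v list \<Rightarrow> 'v) \<Rightarrow> bool" where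
  "strategy G P \<sigma> \<longleftrightarrow>
     (\<forall>h. partial_play G h \<and> last h \<in> owned G P \<and> (\<exists>v. (last h, v) \<in> edges G)
        \<longrightarrow> (last h, \<sigma> h) \<in> edges G)"

fun agrees :: "('v, 'l) arena \<Rightarrow> player \<Rightarrow> ('v list \<Rightarrow> 'v) \<Rightarrow> 'v seq \<Rightarrow> bool" where
  "agrees G P \<sigma> (FinSeq h) \<longleftrightarrow>
     (\<forall>n. Suc n < length h \<and> h ! n \<in> owned G P \<longrightarrow> h ! Suc n = \<sigma> (take (Suc n) h))"
| "agrees G P \<sigma> (InfSeq p) \<longleftrightarrow>
     (\<forall>n. p n \<in> owned G P \<longrightarrow> p (Suc n) = \<sigma> (map p [0..<Suc n]))"

definition is_game :: "('v, 'l) arena \<Rightarrow> 'l seqfun \<Rightarrow> bool" where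
  "is_game G f \<longleftrightarrow> wf_arena G \<and> (\<forall>p. play G p \<longrightarrow> out_word G p \<in> seqdom f)
     \<and> ((\<exists>g. f = OnInf g) \<longrightarrow> (\<forall>v\<in>positions G. \<exists>v'. (v, v') \<in> edges G))"

definition payoff :: "('v, 'l) arena \<Rightarrow> 'l seqfun \<Rightarrow> 'v seq \<Rightarrow> ereal" where
  "payoff G f p = ereal (app f (out_word G p))"

text \<open>
  Values are extended reals since the payoffs of the plays of an infinite arena may be unbounded.
\<close>

definition eve_strategy_value :: "('v, 'l) arena \<Rightarrow> 'l seqfun \<Rightarrow> ('v list \<Rightarrow> 'v) \<Rightarrow> ereal" where
  "eve_strategy_value G f \<sigma> = (INF p\<in>{p. play G p \<and> agrees G Eve \<sigma> p}. payoff G f p)"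

definition adam_strategy_value :: "('v, 'l) arena \<Rightarrow> 'l seqfun \<Rightarrow> ('v list \<Rightarrow> 'v) \<Rightarrow> ereal" where
  "adam_strategy_value G f \<sigma> = (SUP p\<in>{p. play G p \<and> agrees G Adam \<sigma> p}. payoff G f p)"

definition eve_value :: "('v, 'l) arena \<Rightarrow> 'l seqfun \<Rightarrow> ereal" where
  "eve_value G f = (SUP \<sigma>\<in>{\<sigma>. strategy G Eve \<sigma>}. eve_strategy_value G f \<sigma>)"

definition adam_value :: "('v, 'l) arena \<Rightarrow> 'l seqfun \<Rightarrow> ereal" where
  "adam_value G f = (INF \<sigma>\<in>{\<sigma>. strategy G Adam \<sigma>}. adam_strategy_value G f \<sigma>)"

definition determined :: "('v, 'l) arena \<Rightarrow> 'l seqfun \<Rightarrow> bool" where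
  "determined G f \<longleftrightarrow> eve_value G f = adam_value G f"

definition has_value :: "('v, 'l) arena \<Rightarrow> 'l seqfun \<Rightarrow> ereal \<Rightarrow> bool" where
  "has_value G f x \<longleftrightarrow> eve_value G f = x \<and> adam_value G f = x"

section \<open>Alternating automata\<close>

text \<open>
  There are no constants for truth and falsity, so every formula contains an atom and every
  transition function is total.
\<close>

datatype 'p pbf = Atom 'p | Or "'p pbf" "'p pbf" | And "'p pbf" "'p pbf"

record ('a, 'q) automaton =
  start :: 'q
  delta :: "'q \<Rightarrow> 'a \<Rightarrow> (rat \<times> 'q) pbf"

text \<open>One step of resolving a formula: Eve moves at disjunctions and Adam at conjunctions.\<close>

inductive resolve :: "'p pbf \<Rightarrow> 'p pbf \<Rightarrow> bool" where
  "resolve (Or \<phi> \<psi>) \<phi>"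
| "resolve (Or \<phi> \<psi>) \<psi>"
| "resolve (And \<phi> \<psi>) \<phi>"
| "resolve (And \<phi> \<psi>) \<psi>"

text \<open>
  \<open>Choice v \<phi>\<close> is a position in which \<open>\<phi>\<close> is being resolved and \<open>v\<close> is the position
  reached after that.
\<close>

datatype ('v, 'q) pos = State 'v 'q | Choice 'v "(rat \<times> 'q) pbf"

fun weight_label :: "('v, 'q) pos \<times> ('v, 'q) pos \<Rightarrow> rat option" where
  "weight_label (Choice v (Atom (x, q)), State v' q') = Some x"
| "weight_label _ = None"

subsection \<open>Product games\<close>

inductive product_edge ::
    "('v, 'a) arena \<Rightarrow> ('a, 'q) automaton \<Rightarrow> ('v, 'q) pos \<Rightarrow> ('v, 'q) pos \<Rightarrow> bool"
  for G A where
  "(v, v') \<in> edges G \<Longrightarrow> edge_label G (v, v') = None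
     \<Longrightarrow> product_edge G A (State v q) (State v' q)"
| "(v, v') \<in> edges G \<Longrightarrow> edge_label G (v, v') = Some a
     \<Longrightarrow> product_edge G A (State v q) (Choice v' (delta A q a))"
| "v \<in> positions G \<Longrightarrow> resolve \<phi> \<psi> \<Longrightarrow> product_edge G A (Choice v \<phi>) (Choice v \<psi>)"
| "v \<in> positions G \<Longrightarrow> product_edge G A (Choice v (Atom (x, q))) (State v q)"

definition product ::
    "('v, 'a) arena \<Rightarrow> ('a, 'q) automaton \<Rightarrow> (('v, 'q) pos, rat) arena" where
  "product G A =
    \<lparr> positions = {State v q | v q. v \<in> positions G} \<union> {Choice v \<phi> | v \<phi>. v \<in> positions G},
      eve_positions = {State v q | v q. v \<in> eve_positions G}
        \<union> {Choice v (Or \<phi> \<psi>) | v \<phi> \<psi>. v \<in> positions G},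
      init_pos = State (init_pos G) (start A),
      edges = {(s, s'). product_edge G A s s'},
      edge_label = weight_label \<rparr>"

subsection \<open>The game of an automaton on a word\<close>

fun letter_at :: "'a seq \<Rightarrow> nat \<Rightarrow> 'a option" where
  "letter_at (FinSeq u) i = (if i < length u then Some (u ! i) else None)"
| "letter_at (InfSeq w) i = Some (w i)"

inductive word_edge ::
    "('a, 'q) automaton \<Rightarrow> 'a seq \<Rightarrow> (nat, 'q) pos \<Rightarrow> (nat, 'q) pos \<Rightarrow> bool"
  for A w where
  "letter_at w i = Some a \<Longrightarrow> word_edge A w (State i q) (Choice (Suc i) (delta A q a))"
| "resolve \<phi> \<psi> \<Longrightarrow> word_edge A w (Choice i \<phi>) (Choice i \<psi>)"
| "word_edge A w (Choice i (Atom (x, q))) (State i q)"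

definition word_game :: "('a, 'q) automaton \<Rightarrow> 'a seq \<Rightarrow> ((nat, 'q) pos, rat) arena" where
  "word_game A w =
    \<lparr> positions = UNIV,
      eve_positions = {Choice i (Or \<phi> \<psi>) | i \<phi> \<psi>. True},
      init_pos = State 0 (start A),
      edges = {(s, s'). word_edge A w s s'},
      edge_label = weight_label \<rparr>"

text \<open>Meaningful only if the game is determined.\<close>

definition aut_value :: "('a, 'q) automaton \<Rightarrow> rat seqfun \<Rightarrow> 'a seq \<Rightarrow> ereal" where
  "aut_value A Val w = eve_value (word_game A w) Val"

fun realizes :: "('a, 'q) automaton \<Rightarrow> rat seqfun \<Rightarrow> 'a seqfun \<Rightarrow> bool" where
  "realizes A (OnFin v) (OnFin f) \<longleftrightarrow>
     (\<forall>u. determined (word_game A (FinSeq u)) (OnFin v)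
        \<and> aut_value A (OnFin v) (FinSeq u) = ereal (f u))"
| "realizes A (OnInf v) (OnInf f) \<longleftrightarrow>
     (\<forall>w. determined (word_game A (InfSeq w)) (OnInf v)
        \<and> aut_value A (OnInf v) (InfSeq w) = ereal (f w))"
| "realizes A _ _ \<longleftrightarrow> False"

subsection \<open>Value functions\<close>

text \<open>
  The weights of an automaton with finitely many states and letters form a finite set, so these
  functions are only applied to bounded sequences, where all infima, suprema, limits and sums exist.
\<close>

definition inf_val :: "(nat \<Rightarrow> rat) \<Rightarrow> real" where
  "inf_val v = (INF n. of_rat (v n))"

definition sup_val :: "(nat \<Rightarrow> rat) \<Rightarrow> real" where
  "sup_val v = (SUP n. of_rat (v n))"

definition liminf_val :: "(nat \<Rightarrow> rat) \<Rightarrow> real" where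
  "liminf_val v = lim (\<lambda>n. INF i\<in>{n..}. of_rat (v i))"

definition limsup_val :: "(nat \<Rightarrow> rat) \<Rightarrow> real" where
  "limsup_val v = lim (\<lambda>n. SUP i\<in>{n..}. of_rat (v i))"

definition dsum_val :: "rat \<Rightarrow> (nat \<Rightarrow> rat) \<Rightarrow> real" where
  "dsum_val d v = (\<Sum>i. of_rat d ^ i * of_rat (v i))"

section \<open>Good for games\<close>

text \<open>
  A definition cannot quantify over all types of positions, so that type is a parameter. Taking it
  to be an arbitrary infinite type loses nothing, as arenas over a smaller type embed into it.
\<close>

definition good_for_games ::
    "'v itself \<Rightarrow> ('a, 'q) automaton \<Rightarrow> rat seqfun \<Rightarrow> 'a seqfun \<Rightarrow> bool" where
  "good_for_games _ A Val f \<longleftrightarrow>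
     (\<forall>G :: ('v, 'a) arena. is_game G f \<and> determined G f
        \<longrightarrow> (\<exists>x. has_value G f x \<and> has_value (product G A) Val x))"

section \<open>Threshold history determinism\<close>

text \<open>The letter is stored in \<open>LChoice\<close> so that it can be output along with the weight.\<close>

datatype ('a, 'q) lpos = LState 'q | LChoice 'a "(rat \<times> 'q) pbf"

inductive letter_edge ::
    "('a, 'q) automaton \<Rightarrow> ('a, 'q) lpos \<Rightarrow> ('a, 'q) lpos \<Rightarrow> bool"
  for A where
  "letter_edge A (LState q) (LChoice a (delta A q a))"
| "resolve \<phi> \<psi> \<Longrightarrow> letter_edge A (LChoice a \<phi>) (LChoice a \<psi>)"
| "letter_edge A (LChoice a (Atom (x, q))) (LState q)"

fun letter_label :: "('a, 'q) lpos \<times> ('a, 'q) lpos \<Rightarrow> ('a \<times> rat) option" where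
  "letter_label (LChoice a (Atom (x, q)), LState q') = Some (a, x)"
| "letter_label _ = None"

text \<open>The first argument is the player who picks the letters.\<close>

definition letter_game ::
    "player \<Rightarrow> ('a, 'q) automaton \<Rightarrow> (('a, 'q) lpos, 'a \<times> rat) arena" where
  "letter_game P A =
    \<lparr> positions = UNIV,
      eve_positions = (if P = Eve then range LState else {}) \<union> {LChoice a (Or \<phi> \<psi>) | a \<phi> \<psi>. True},
      init_pos = LState (start A),
      edges = {(s, s'). letter_edge A s s'},
      edge_label = letter_label \<rparr>"

definition wins ::
    "('v, 'l) arena \<Rightarrow> player \<Rightarrow> ('l seq \<Rightarrow> bool) \<Rightarrow> bool" where
  "wins G P W \<longleftrightarrow>
     (\<exists>\<sigma>. strategy G P \<sigma> \<and> (\<forall>p. play G p \<and> agrees G P \<sigma> p \<longrightarrow> W (out_word G p)))"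

text \<open>
  All plays of a letter game are infinite and visit \<open>LState\<close> positions infinitely often, so their
  outputs are of the form \<open>InfSeq s\<close>, where \<open>s\<close> is the sequence of pairs of a letter and the
  weight of the transition taken on it.
\<close>

fun eve_condition ::
    "('a, 'q) automaton \<Rightarrow> rat seqfun \<Rightarrow> real \<Rightarrow> ('a \<times> rat) seq \<Rightarrow> bool" where
  "eve_condition A (OnFin v) t (InfSeq s) \<longleftrightarrow>
     (\<forall>i. ereal t \<le> aut_value A (OnFin v) (FinSeq (map (\<lambda>j. fst (s j)) [0..<Suc i]))
        \<longrightarrow> t \<le> v (map (\<lambda>j. snd (s j)) [0..<Suc i]))"
| "eve_condition A (OnInf v) t (InfSeq s) \<longleftrightarrow>
     (ereal t \<le> aut_value A (OnInf v) (InfSeq (\<lambda>j. fst (s j))) \<longrightarrow> t \<le> v (\<lambda>j. snd (s j)))"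
| "eve_condition A Val t (FinSeq u) \<longleftrightarrow> False"

fun adam_condition ::
    "('a, 'q) automaton \<Rightarrow> rat seqfun \<Rightarrow> real \<Rightarrow> ('a \<times> rat) seq \<Rightarrow> bool" where
  "adam_condition A (OnFin v) t (InfSeq s) \<longleftrightarrow>
     (\<forall>i. aut_value A (OnFin v) (FinSeq (map (\<lambda>j. fst (s j)) [0..<Suc i])) < ereal t
        \<longrightarrow> v (map (\<lambda>j. snd (s j)) [0..<Suc i]) < t)"
| "adam_condition A (OnInf v) t (InfSeq s) \<longleftrightarrow>
     (aut_value A (OnInf v) (InfSeq (\<lambda>j. fst (s j))) < ereal t \<longrightarrow> v (\<lambda>j. snd (s j)) < t)"
| "adam_condition A Val t (FinSeq u) \<longleftrightarrow> False"

definition threshold_history_deterministic_at ::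
    "real \<Rightarrow> ('a, 'q) automaton \<Rightarrow> rat seqfun \<Rightarrow> bool" where
  "threshold_history_deterministic_at t A Val \<longleftrightarrow>
     wins (letter_game Adam A) Eve (eve_condition A Val t)
     \<and> wins (letter_game Eve A) Adam (adam_condition A Val t)"

definition threshold_history_deterministic :: "('a, 'q) automaton \<Rightarrow> rat seqfun \<Rightarrow> bool" where
  "threshold_history_deterministic A Val \<longleftrightarrow>
     (\<forall>t. threshold_history_deterministic_at t A Val)"

end

theory Submission
  imports Defs "HOL-Library.Sublist" "HOL-Library.Ramsey"
begin

text \<open>
  A partial play of a product game consists of one of the game and one of the letter game. Hence a strategy
  keeping the payoff \<open>f\<close> of the game on one side of a threshold, combined with a winning strategy in the letter
  game for that threshold, keeps the payoff of the product game on the same side.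

  Conversely, suppose that a player does not win their letter game for \<open>t\<close>. By Davis's theorem on the
  determinacy of games with a \<open>\<Sigma>\<^sub>3\<close> winning condition, the opponent then has a strategy that puts \<open>f\<close> of the
  word and the value of the weights on different sides of \<open>t\<close>. Let the opponent alone choose one of the words
  that this strategy can produce. By Koenig's lemma, each infinite word all of whose prefixes can be produced
  can itself be produced, so that \<open>f\<close> is on one side of \<open>t\<close> in every play of this game, while in the product game
  the strategy reaches the other side. The two values differ strictly, as only finitely many values are possible
  or, for discounted sums, by compactness.

  It remains to see that \<open>{w. t \<le> f w}\<close> and its complement are \<open>\<Sigma>\<^sub>3\<close>. For discounted sums, \<open>f\<close> is uniformly
  continuous, so these sets are closed and open. For the other value functions, it depends on the classes of
  the blocks of an arbitrary factorization of \<open>w\<close> whether \<open>t \<le> f w\<close>, where the class of a finite word is the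
  predicate transformer telling which sets of states a player can force while reading it. There are finitely
  many classes, and Ramsey's theorem yields a \<open>\<Sigma>\<^sub>3\<close> description.
\<close>

section \<open>Prefixes and limits of sequences\<close>

text \<open>Two obstacles shape the converse. Good for games only compares the values of determined
  games, while a letter game is won or lost play by play, under a condition on the word and the
  weights together. In the auxiliary game one player owns all positions, which makes it determined
  for trivial reasons. As this player also picks the letters of the letter game, they can follow
  their letter strategy inside the product, where they see how earlier letters have been resolved.
  The auxiliary game itself shows nothing of this and only restricts the words that may be chosen;
  hence the side on which \<open>f\<close> lies must be controlled for every word allowed there,
  including limits. The winning set of the opponent intersects a condition on the word with one on
  the weights, and the letter games of both players have to be treated. So the threshold sets of the
  value function, like those of \<open>f\<close>, are needed in Sigma3 form together with their
  complements. For the four value functions other than discounted sums, a one-bit monitor of the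
  weights that has to be true infinitely often serves both purposes.\<close>

fun pref :: "'l seq \<Rightarrow> nat \<Rightarrow> 'l list" where
  "pref (FinSeq u) n = take n u"
| "pref (InfSeq s) n = map s [0..<n]"

text \<open>Pointwise convergence. As \<open>pref\<close> saturates on finite sequences, testing
  some \<open>k\<close> beyond \<open>length u\<close> forces \<open>c\<close> to be eventually
  equal to \<open>u\<close>, so finite and infinite limits need no separate notions.\<close>

definition tends_to :: "(nat \<Rightarrow> 'l list) \<Rightarrow> 'l seq \<Rightarrow> bool" where
  "tends_to c s \<longleftrightarrow> (\<forall>k. \<exists>N. \<forall>n\<ge>N. take k (c n) = pref s k)"

lemma take_map_upt: "take k (map s [0..<n]) = map s [0..<min k n]"
  by (simp add: take_map min_def)

lemma take_pref: "k \<le> n \<Longrightarrow> take k (pref s n) = pref s k"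
  by (cases s) (auto simp: take_map min_def)

lemma length_pref_InfSeq [simp]: "length (pref (InfSeq s) n) = n"
  by simp

lemma map_upt_inj: "map s [0..<Suc n] = map s' [0..<Suc n] \<Longrightarrow> s n = s' n"
  by simp

lemma pref_inj:
  assumes "\<And>k. pref s k = pref s' k"
  shows "s = s'"
proof -
  have *: False if "\<And>k. pref (FinSeq u) k = pref (InfSeq p) k" for u :: "'a list" and p
  proof -
    have "length (pref (FinSeq u) (Suc (length u))) = length (pref (InfSeq p) (Suc (length u)))"
      using that by metis
    then show False by simp
  qed
  show ?thesis
  proof (cases s; cases s')
    fix u u' assume "s = FinSeq u" "s' = FinSeq u'"
    then show ?thesis using assms[of "max (length u) (length u')"] by simp
  next
    fix p p' assume "s = InfSeq p" "s' = InfSeq p'"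
    then show ?thesis using assms by (metis ext map_upt_inj pref.simps(2))
  next
    fix u p assume "s = FinSeq u" "s' = InfSeq p"
    then show ?thesis using assms * by blast
  next
    fix u p assume "s' = FinSeq u" "s = InfSeq p"
    then show ?thesis using assms * by metis
  qed
qed

lemma tends_to_unique:
  assumes "tends_to c s" "tends_to c s'"
  shows "s = s'"
proof (rule pref_inj)
  fix k
  obtain N N' where "\<forall>n\<ge>N. take k (c n) = pref s k" "\<forall>n\<ge>N'. take k (c n) = pref s' k"
    using assms unfolding tends_to_def by metis
  then show "pref s k = pref s' k" by (metis max.cobounded1 max.cobounded2)
qed

lemma chain_prefix:
  assumes "\<And>n. prefix (c n) (c (Suc n))" "m \<le> n"
  shows "prefix (c m) (c n)"
  using assms(2)
proof (induction n rule: dec_induct)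
  case (step n)
  then show ?case using assms(1) prefix_order.trans by blast
qed simp

lemma prefix_take: "prefix u v \<Longrightarrow> k \<le> length u \<Longrightarrow> take k v = take k u"
  by (auto simp: prefix_def)

lemma tends_to_FinSeq: "tends_to c (FinSeq u) \<Longrightarrow> \<exists>N. \<forall>n\<ge>N. c n = u"
proof -
  assume "tends_to c (FinSeq u)"
  then obtain N where N: "\<forall>n\<ge>N. take (Suc (length u)) (c n) = u"
    unfolding tends_to_def by (metis le_SucI order_refl pref.simps(1) take_all)
  have "c n = u" if "n \<ge> N" for n
  proof -
    have "take (Suc (length u)) (c n) = u" using N that by blast
    moreover from this have "length (c n) \<le> length u"
      by (metis Suc_n_not_le_n length_take min.absorb2 nat_le_linear not_less_eq_eq)
    ultimately show ?thesis by simp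
  qed
  then show ?thesis by blast
qed

lemma tends_to_FinSeqI: "(\<And>n. n \<ge> N \<Longrightarrow> c n = u) \<Longrightarrow> tends_to c (FinSeq u)"
  unfolding tends_to_def by (metis pref.simps(1))

lemma tends_to_InfSeq: "tends_to c (InfSeq s) \<Longrightarrow> \<exists>N. \<forall>n\<ge>N. k \<le> length (c n)"
  unfolding tends_to_def by (metis length_pref_InfSeq length_take min.cobounded1)

lemma tends_to_InfSeqI:
  assumes "\<And>n. c n = map s [0..<length (c n)]" "\<And>k. \<exists>N. \<forall>n\<ge>N. k \<le> length (c n)"
  shows "tends_to c (InfSeq s)"
  unfolding tends_to_def
proof
  fix k
  obtain N where N: "\<forall>n\<ge>N. k \<le> length (c n)" using assms(2) by blast
  have "take k (c n) = pref (InfSeq s) k" if "n \<ge> N" for n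
  proof -
    have "take k (c n) = take k (map s [0..<length (c n)])" using assms(1) by metis
    then show ?thesis using N that by (simp add: take_map_upt min_def)
  qed
  then show "\<exists>N. \<forall>n\<ge>N. take k (c n) = pref (InfSeq s) k" by blast
qed

lemma chain_eq_pref:
  assumes "\<And>n. prefix (c n) (c (Suc n))" "tends_to c s"
  shows "c n = pref s (length (c n))"
proof -
  obtain N where "\<forall>m\<ge>N. take (length (c n)) (c m) = pref s (length (c n))"
    using assms(2) unfolding tends_to_def by blast
  moreover have "prefix (c n) (c (max n N))" using chain_prefix[of c] assms(1) by simp
  ultimately show ?thesis by (metis max.cobounded2 order_refl prefix_take take_all)
qed

text \<open>Unbounded lengths determine every entry of an infinite limit. Bounded lengths attain
  their maximum, after which the chain is constant.\<close>

lemma chain_limit: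
  assumes "\<And>n. prefix (c n) (c (Suc n))"
  shows "\<exists>s. tends_to c s"
proof (cases "\<forall>k. \<exists>n. k \<le> length (c n)")
  case True
  then have "\<forall>k. \<exists>n. Suc k \<le> length (c n)" by blast
  then obtain \<nu> where \<nu>: "\<And>k. Suc k \<le> length (c (\<nu> k))" by metis
  define s where "s i = c (\<nu> i) ! i" for i
  have eq: "c n ! i = s i" if "i < length (c n)" for n i
  proof -
    have "prefix (c n) (c (max n (\<nu> i)))" "prefix (c (\<nu> i)) (c (max n (\<nu> i)))"
      using chain_prefix[of c] assms by simp_all
    then show ?thesis unfolding s_def using that \<nu>[of i]
      by (metis Suc_le_eq nth_append prefixE)
  qed
  have "tends_to c (InfSeq s)"
  proof (rule tends_to_InfSeqI)
    fix n show "c n = map s [0..<length (c n)]"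
      by (rule nth_equalityI) (auto simp: eq)
  next
    fix k
    have "k \<le> length (c n)" if "n \<ge> \<nu> k" for n
      using chain_prefix[of c, OF assms that] \<nu>[of k]
      by (meson Suc_leD le_trans prefix_length_le)
    then show "\<exists>N. \<forall>n\<ge>N. k \<le> length (c n)" by blast
  qed
  then show ?thesis by blast
next
  case False
  then obtain k where k: "\<And>n. length (c n) < k" by (meson not_le)
  define m where "m = Max (range (\<lambda>n. length (c n)))"
  have fin: "finite (range (\<lambda>n. length (c n)))"
    using k by (meson finite_nat_iff_bounded image_subset_iff lessThan_iff)
  then obtain N where N: "length (c N) = m"
    unfolding m_def by (metis (mono_tags, lifting) Max_in UNIV_not_empty image_iff image_is_empty)
  have "c n = c N" if "n \<ge> N" for n
  proof -
    have "prefix (c N) (c n)" using chain_prefix[of c, OF assms that] .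
    moreover have "length (c n) \<le> m" unfolding m_def using fin by simp
    ultimately show ?thesis using N
      by (metis not_equal_is_parallel parallel_def prefix_length_le prefix_length_prefix prefix_order.antisym prefix_order.refl)
  qed
  then show ?thesis using tends_to_FinSeqI by blast
qed

lemma tends_to_map:
  assumes "tends_to c s"
  shows "tends_to (\<lambda>n. map f (c n)) (map_seq f s)"
proof -
  have "pref (map_seq f s) k = map f (pref s k)" for k
    by (cases s) (auto simp: take_map)
  then show ?thesis using assms unfolding tends_to_def by (metis take_map)
qed

lemma prefix_pref: "prefix (pref s n) (pref s (Suc n))"
proof -
  have "pref s n = take n (pref s (Suc n))" by (simp add: take_pref)
  then show ?thesis by (metis take_is_prefix)
qed

lemma prefix_pref_le: "m \<le> n \<Longrightarrow> prefix (pref s m) (pref s n)"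
  using chain_prefix[of "pref s", OF prefix_pref] .

section \<open>Output words\<close>

text \<open>Depends on the arena only through \<open>edge_label\<close>, so outputs can be compared
  across arenas that share it.\<close>

definition labs :: "('v, 'l) arena \<Rightarrow> 'v list \<Rightarrow> 'l list" where
  "labs G h = map the (filter (\<lambda>x. x \<noteq> None) (map (edge_label G) (zip h (tl h))))"

lemma zip_tl_snoc: "h \<noteq> [] \<Longrightarrow> zip (h @ [v]) (tl (h @ [v])) = zip h (tl h) @ [(last h, v)]"
proof (induction h rule: list_nonempty_induct)
  case (cons x xs)
  then show ?case by (cases xs) auto
qed simp

lemma labs_singleton [simp]: "labs G [v] = []"
  by (simp add: labs_def)

lemma labs_snoc:
  "h \<noteq> [] \<Longrightarrow> labs G (h @ [v])
     = labs G h @ (case edge_label G (last h, v) of None \<Rightarrow> [] | Some a \<Rightarrow> [a])"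
  unfolding labs_def zip_tl_snoc by (auto split: option.split)

lemma labs_prefix: "prefix h h' \<Longrightarrow> prefix (labs G h) (labs G h')"
proof -
  assume "prefix h h'"
  then obtain z where "h' = h @ z" by (auto simp: prefix_def)
  moreover have "prefix (labs G h) (labs G (h @ z))"
  proof (induction z rule: rev_induct)
    case (snoc v z)
    show ?case
    proof (cases "h @ z = []")
      case False
      then have "prefix (labs G (h @ z)) (labs G ((h @ z) @ [v]))" 
        using labs_snoc[OF False, of G v] by (metis prefixI)
      then show ?thesis using snoc prefix_order.trans by fastforce
    qed (simp add: labs_def)
  qed simp
  ultimately show ?thesis by simp
qed

text \<open>Relates the description of output words through \<open>enumerate\<close> to the
  filtering of finite prefixes.\<close>

lemma filter_upt_enumerate:
  assumes "infinite I"
  shows "filter (\<lambda>i. i \<in> I) [0..<n] = map (enumerate I) [0..<card (I \<inter> {..<n})]"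
proof (induction n)
  case (Suc n)
  show ?case
  proof (cases "n \<in> I")
    case True
    have *: "card (I \<inter> {..<Suc n}) = Suc (card (I \<inter> {..<n}))"
      using True by (simp add: lessThan_Suc)
    obtain k where k: "enumerate I k = n" using enumerate_Ex[OF assms True] by blast
    have "I \<inter> {..<n} = enumerate I ` {..<k}"
    proof (intro equalityI subsetI)
      fix j assume j: "j \<in> I \<inter> {..<n}"
      then obtain l where "enumerate I l = j" using enumerate_Ex[OF assms] by blast
      then show "j \<in> enumerate I ` {..<k}" using j k assms by auto
    qed (use assms k enumerate_in_set in auto)
    then have "card (I \<inter> {..<n}) = k"
      using card_image[OF inj_on_subset[OF inj_enumerate[OF assms] subset_UNIV]] by simp
    then show ?thesis using Suc True k * by simp
  next
    case False
    then show ?thesis using Suc by (simp add: lessThan_Suc)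
  qed
qed simp

lemma labs_InfSeq:
  "labs G (map p [0..<Suc n]) = map (\<lambda>i. the (edge_label G (p i, p (Suc i))))
      (filter (\<lambda>i. i \<in> {i. edge_label G (p i, p (Suc i)) \<noteq> None}) [0..<n])"
proof (induction n)
  case (Suc n)
  have "labs G (map p [0..<Suc (Suc n)]) = labs G (map p [0..<Suc n] @ [p (Suc n)])" by simp
  also have "\<dots> = labs G (map p [0..<Suc n])
      @ (case edge_label G (p n, p (Suc n)) of None \<Rightarrow> [] | Some a \<Rightarrow> [a])"
    by (subst labs_snoc) auto
  finally show ?case using Suc by (auto split: option.split)
qed simp

text \<open>Replaces the case distinction in \<open>nonempty_labels\<close> by a limit of outputs of
  partial plays, which can be computed by induction on these.\<close>

lemma tends_to_out_word: "tends_to (\<lambda>n. labs G (pref p (Suc n))) (out_word G p)"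
proof (cases p)
  case (FinSeq h)
  have "labs G (pref p (Suc n)) = map the (filter (\<lambda>x. x \<noteq> None) (map (edge_label G) (zip h (tl h))))"
    if "n \<ge> length h" for n
    using FinSeq that by (simp add: labs_def)
  moreover have "out_word G p = FinSeq (map the (filter (\<lambda>x. x \<noteq> None) (map (edge_label G) (zip h (tl h)))))"
    by (simp add: out_word_def FinSeq)
  ultimately show ?thesis by (metis (no_types, lifting) tends_to_FinSeqI)
next
  case (InfSeq q)
  define s where "s i = edge_label G (q i, q (Suc i))" for i
  define I where "I = {i. s i \<noteq> None}"
  define F where "F n = filter (\<lambda>i. i \<in> I) [0..<n]" for n
  have labs: "labs G (pref p (Suc n)) = map (\<lambda>i. the (s i)) (F n)" for n
    using labs_InfSeq[of G q n] InfSeq unfolding F_def I_def s_def by simp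
  have ow: "out_word G p = (if finite I then FinSeq (map (\<lambda>i. the (s i)) (sorted_list_of_set I))
      else InfSeq (\<lambda>n. the (s (enumerate I n))))"
    by (simp add: out_word_def InfSeq s_def[symmetric] I_def Let_def)
  show ?thesis
  proof (cases "finite I")
    case True
    then obtain N where N: "I \<subseteq> {..<N}" using finite_nat_bounded by blast
    have "F n = sorted_list_of_set I" if "n \<ge> N" for n
    proof (rule sorted_distinct_set_unique)
      show "set (F n) = set (sorted_list_of_set I)"
        using N that True unfolding F_def by (auto intro: less_le_trans)
    qed (auto simp: F_def sorted_wrt_filter)
    then show ?thesis unfolding labs using ow True by (auto intro!: tends_to_FinSeqI[of N])
  next
    case False
    have F: "F n = map (enumerate I) [0..<card (I \<inter> {..<n})]" for n
      unfolding F_def by (rule filter_upt_enumerate[OF False])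
    have *: "labs G (pref p (Suc n)) = map (\<lambda>k. the (s (enumerate I k))) [0..<card (I \<inter> {..<n})]" for n
      unfolding labs F by simp
    have "tends_to (\<lambda>n. labs G (pref p (Suc n))) (InfSeq (\<lambda>k. the (s (enumerate I k))))"
    proof (rule tends_to_InfSeqI)
      fix n show "labs G (pref p (Suc n)) =
         map (\<lambda>k. the (s (enumerate I k))) [0..<length (labs G (pref p (Suc n)))]"
        unfolding * by simp
    next
      fix k
      have "k \<le> card (I \<inter> {..<n})" if "n \<ge> enumerate I k" for n
      proof -
        have "enumerate I ` {..<k} \<subseteq> I \<inter> {..<n}"
          using that False enumerate_in_set enumerate_mono by (fastforce intro: less_le_trans)
        then have "card (enumerate I ` {..<k}) \<le> card (I \<inter> {..<n})"
          by (intro card_mono) auto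
        then show ?thesis
          using card_image[OF inj_on_subset[OF inj_enumerate[OF False] subset_UNIV]] by simp
      qed
      then show "\<exists>N. \<forall>n\<ge>N. k \<le> length (labs G (pref p (Suc n)))"
        unfolding * by (metis length_map length_upt minus_nat.diff_0)
    qed
    then show ?thesis using ow False by simp
  qed
qed

text \<open>The chain may stand still, as the projections of a product play do while only the other
  component moves.\<close>

lemma tends_to_labs:
  assumes "\<And>n. prefix (c n) (c (Suc n))" "tends_to c p" "\<And>n. c n \<noteq> []"
  shows "tends_to (\<lambda>n. labs G (c n)) (out_word G p)"
  unfolding tends_to_def
proof
  fix k
  obtain N where N: "\<And>n. n \<ge> N \<Longrightarrow> take k (labs G (pref p (Suc n))) = pref (out_word G p) k"
    using tends_to_out_word[of G p] unfolding tends_to_def by blast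
  obtain M where M: "\<And>n. n \<ge> M \<Longrightarrow> take (Suc N) (c n) = pref p (Suc N)"
    using assms(2) unfolding tends_to_def by blast
  have "take k (labs G (c n)) = pref (out_word G p) k" if "n \<ge> M" for n
  proof -
    obtain m where m: "m \<ge> N" "c n = pref p (Suc m)"
    proof (cases "length (c n) \<ge> Suc N")
      case True
      then show ?thesis using that[of "length (c n) - 1"] chain_eq_pref[of c, OF assms(1,2)]
        by (metis Suc_leD Suc_le_D Suc_le_mono diff_Suc_1)
    next
      \<comment> \<open>A chain element shorter than \<open>Suc N\<close> is not changed by
        \<open>take\<close>, hence is already \<open>pref p (Suc N)\<close>.\<close>
      case False
      then have "c n = pref p (Suc N)" using M[OF \<open>n \<ge> M\<close>] by simp
      then show ?thesis using that[of N] by simp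
    qed
    then show ?thesis using N by simp
  qed
  then show "\<exists>N. \<forall>n\<ge>N. take k (labs G (c n)) = pref (out_word G p) k" by blast
qed

section \<open>Strategy trees\<close>

fun opponent :: "player \<Rightarrow> player" where
  "opponent Eve = Adam"
| "opponent Adam = Eve"

lemma opponent_opponent [simp]: "opponent (opponent P) = P"
  by (cases P) auto

text \<open>A strategy is represented by the set of partial plays agreeing with it; unlike strategies, such sets can
  be combined by set operations.\<close>

definition tree :: "('v, 'l) arena \<Rightarrow> player \<Rightarrow> 'v list set \<Rightarrow> bool" where
  "tree G P S \<longleftrightarrow> [init_pos G] \<in> S \<and> (\<forall>h\<in>S. partial_play G h \<and>
     (if last h \<in> owned G P
      then (\<exists>v. (last h, v) \<in> edges G) \<longrightarrow> (\<exists>v. (last h, v) \<in> edges G \<and> h @ [v] \<in> S)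
      else (\<forall>v. (last h, v) \<in> edges G \<longrightarrow> h @ [v] \<in> S)))"

definition follows :: "'v list set \<Rightarrow> 'v seq \<Rightarrow> bool" where
  "follows S p \<longleftrightarrow> (\<forall>n. pref p (Suc n) \<in> S)"

text \<open>A \<open>tree\<close> may contain partial plays whose initial segments it lacks and
  which no play reaches through it. Closure is therefore a separate condition, restored by
  \<open>tree_core\<close>. The empty list is exempt as it is no partial play.\<close>

definition prefix_closed :: "'v list set \<Rightarrow> bool" where
  "prefix_closed S \<longleftrightarrow> (\<forall>h v. h @ [v] \<in> S \<longrightarrow> h \<noteq> [] \<longrightarrow> h \<in> S)"

lemma partial_play_singleton [simp]: "partial_play G [v] \<longleftrightarrow> v = init_pos G"
  by (simp add: partial_play_def)

lemma partial_play_nonempty: "partial_play G h \<Longrightarrow> h \<noteq> []"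
  by (simp add: partial_play_def)

lemma partial_play_snoc:
  assumes "h \<noteq> []"
  shows "partial_play G (h @ [v]) \<longleftrightarrow> partial_play G h \<and> (last h, v) \<in> edges G"
proof -
  have *: "last h = h ! (length h - 1)" using assms by (rule last_conv_nth)
  have "(\<forall>n. Suc n < length (h @ [v]) \<longrightarrow> ((h @ [v]) ! n, (h @ [v]) ! Suc n) \<in> edges G) \<longleftrightarrow>
      (\<forall>n. Suc n < length h \<longrightarrow> (h ! n, h ! Suc n) \<in> edges G) \<and> (last h, v) \<in> edges G" (is "?L \<longleftrightarrow> ?R")
  proof
    assume L: ?L
    have "(h ! n, h ! Suc n) \<in> edges G" if "Suc n < length h" for n
      using L[rule_format, of n] that by (simp add: nth_append)
    moreover have "(last h, v) \<in> edges G"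
      using L[rule_format, of "length h - 1"] assms * by (simp add: nth_append)
    ultimately show ?R by blast
  next
    assume R: ?R
    show ?L
    proof (intro allI impI)
      fix n assume "Suc n < length (h @ [v])"
      then consider "Suc n < length h" | "n = length h - 1" "Suc n = length h" by fastforce
      then show "((h @ [v]) ! n, (h @ [v]) ! Suc n) \<in> edges G"
        by cases (use R * in \<open>simp_all add: nth_append\<close>)
    qed
  qed
  then show ?thesis using assms by (auto simp: partial_play_def)
qed

lemma partial_play_take: "partial_play G h \<Longrightarrow> partial_play G (take (Suc k) h)"
  by (auto simp: partial_play_def)

lemma play_InfSeq_iff: "play G (InfSeq p) \<longleftrightarrow> (\<forall>n. partial_play G (map p [0..<Suc n]))"
proof
  assume L: "play G (InfSeq p)"
  show "\<forall>n. partial_play G (map p [0..<Suc n])"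
  proof
    fix n show "partial_play G (map p [0..<Suc n])"
    proof (induction n)
      case (Suc n)
      have "last (map p [0..<Suc n]) = p n" by simp
      then have "partial_play G (map p [0..<Suc n] @ [p (Suc n)])"
        using Suc L partial_play_snoc[of "map p [0..<Suc n]" G "p (Suc n)"] by (simp del: upt_Suc)
      then show ?case by simp
    qed (use L in simp)
  qed
next
  assume R: "\<forall>n. partial_play G (map p [0..<Suc n])"
  have "(p n, p (Suc n)) \<in> edges G" for n
  proof -
    have "map p [0..<Suc (Suc n)] = map p [0..<Suc n] @ [p (Suc n)]" by simp
    then show ?thesis using R[rule_format, of "Suc n"] partial_play_snoc[of "map p [0..<Suc n]" G "p (Suc n)"]
      by simp
  qed
  moreover have "p 0 = init_pos G" using R[rule_format, of 0] by simp
  ultimately show "play G (InfSeq p)" by simp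
qed

lemma play_pref: "play G p \<Longrightarrow> partial_play G (pref p (Suc n))"
proof (cases p)
  case (FinSeq h)
  then show "play G p \<Longrightarrow> ?thesis" using partial_play_take by auto
next
  case (InfSeq q)
  then show "play G p \<Longrightarrow> ?thesis" using play_InfSeq_iff by auto
qed

lemma play_pref_Suc:
  assumes "play G p"
  shows "pref p (Suc (Suc n)) = pref p (Suc n)
     \<or> (\<exists>v. pref p (Suc (Suc n)) = pref p (Suc n) @ [v] \<and> (last (pref p (Suc n)), v) \<in> edges G)"
proof -
  obtain z where z: "pref p (Suc (Suc n)) = pref p (Suc n) @ z" using prefix_pref prefixE by metis
  have "length (pref p (Suc (Suc n))) \<le> Suc (length (pref p (Suc n)))" by (cases p) auto
  then have "length z \<le> 1" using z by simp
  moreover have "(last (pref p (Suc n)), v) \<in> edges G" if "z = [v]" for v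
    using play_pref[OF assms, of "Suc n"] z that partial_play_snoc partial_play_nonempty
      play_pref[OF assms, of n] by metis
  ultimately show ?thesis using z by (cases z) auto
qed

text \<open>Appending positions inside \<open>X\<close> as long as possible gives a chain whose
  limit is a play: if the chain stops, \<open>ext\<close> shows that its last position is a dead
  end.\<close>

lemma play_exists:
  assumes "h \<in> X" "\<And>g. g \<in> X \<Longrightarrow> partial_play G g"
    and ext: "\<And>g v. g \<in> X \<Longrightarrow> (last g, v) \<in> edges G \<Longrightarrow> \<exists>v. g @ [v] \<in> X"
  shows "\<exists>p. play G p \<and> pref p (length h) = h \<and> (\<forall>n\<ge>length h. pref p n \<in> X)"
proof -
  define nx where "nx g = (if \<exists>v. g @ [v] \<in> X then g @ [SOME v. g @ [v] \<in> X] else g)" for g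
  define c where "c n = (nx ^^ n) h" for n
  have c0: "c 0 = h" and cS: "c (Suc n) = nx (c n)" for n by (simp_all add: c_def)
  have nx: "nx g \<in> X" if "g \<in> X" for g unfolding nx_def using that by (auto intro: someI)
  have cX: "c n \<in> X" for n by (induction n) (use assms(1) c0 cS nx in auto)
  have chain: "prefix (c n) (c (Suc n))" for n unfolding cS nx_def by simp
  obtain p where p: "tends_to c p" using chain_limit[of c, OF chain] by blast
  \<comment> \<open>Each step appends at most one position, so no prefix beyond \<open>h\<close> is
    skipped and all of them lie in \<open>X\<close>.\<close>
  have tk: "\<exists>m'. take n (c m) = c m'" if "n \<ge> length h" for n m
  proof (induction m)
    case 0
    then show ?case using that c0 by (metis take_all)
  next
    case (Suc m)
    show ?case
    proof (cases "length (c (Suc m)) \<le> n")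
      case False
      then have "take n (c (Suc m)) = take n (c m)" unfolding cS nx_def by (auto split: if_splits)
      then show ?thesis using Suc by simp
    qed (metis take_all)
  qed
  have inX: "pref p n \<in> X" if "n \<ge> length h" for n
    using p tk[OF that] cX unfolding tends_to_def by (metis order_refl)
  have len: "h \<noteq> []" using assms(1,2) partial_play_nonempty by blast
  have "play G p"
  proof (cases p)
    case (FinSeq u)
    then obtain N where "\<forall>n\<ge>N. c n = u" using p tends_to_FinSeq by blast
    then have N: "c N = u" "c (Suc N) = u" by simp_all
    then have "\<nexists>v. u @ [v] \<in> X" using cS[of N] unfolding nx_def
      by (metis append_self_conv not_Cons_self2)
    moreover have u: "u \<in> X" using N cX by metis
    ultimately have "\<nexists>v. (last u, v) \<in> edges G" using ext by blast
    then show ?thesis using FinSeq assms(2)[OF u] by simp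
  next
    case (InfSeq q)
    have "partial_play G (map q [0..<Suc n])" for n
    proof -
      have "partial_play G (pref p (max (length h) (Suc n)))" using inX assms(2) by simp
      then have "partial_play G (take (Suc n) (pref p (max (length h) (Suc n))))"
        by (rule partial_play_take)
      then have "partial_play G (pref p (Suc n))" using take_pref by (metis max.cobounded2)
      then show ?thesis using InfSeq by simp
    qed
    then show ?thesis using play_InfSeq_iff InfSeq by blast
  qed
  moreover have "pref p (length h) = h" using chain_eq_pref[of c, OF chain p, of 0] c0 by simp
  ultimately show ?thesis using inX by blast
qed

lemma tree_partial_play: "tree G P S \<Longrightarrow> h \<in> S \<Longrightarrow> partial_play G h"
  by (simp add: tree_def)

lemma tree_init: "tree G P S \<Longrightarrow> [init_pos G] \<in> S"
  by (simp add: tree_def)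

lemma tree_own:
  "tree G P S \<Longrightarrow> h \<in> S \<Longrightarrow> last h \<in> owned G P \<Longrightarrow> (last h, v) \<in> edges G
     \<Longrightarrow> \<exists>v. (last h, v) \<in> edges G \<and> h @ [v] \<in> S"
  unfolding tree_def by meson

lemma tree_other:
  "tree G P S \<Longrightarrow> h \<in> S \<Longrightarrow> last h \<notin> owned G P \<Longrightarrow> (last h, v) \<in> edges G \<Longrightarrow> h @ [v] \<in> S"
  unfolding tree_def by meson

lemma tree_choice:
  assumes "tree G P S" "h \<in> S" "last h \<in> owned G P \<longleftrightarrow> P = Q"
    and "\<And>v. (last h, v) \<in> edges G \<longleftrightarrow> v = x \<or> v = y"
  shows "if P = Q then h @ [x] \<in> S \<or> h @ [y] \<in> S else h @ [x] \<in> S \<and> h @ [y] \<in> S"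
  using tree_own[OF assms(1,2), of x] tree_other[OF assms(1,2)] assms(3,4) by auto

lemma tree_ext:
  "tree G P S \<Longrightarrow> h \<in> S \<Longrightarrow> (last h, v) \<in> edges G \<Longrightarrow> \<exists>v. h @ [v] \<in> S"
  using tree_own tree_other by metis

lemma tree_play_exists:
  assumes "tree G P S" "h \<in> S"
  shows "\<exists>p. play G p \<and> pref p (length h) = h \<and> (\<forall>n\<ge>length h. pref p n \<in> S)"
  using play_exists[of h S G] assms tree_partial_play tree_ext by metis

lemma prefix_closed_take:
  assumes "prefix_closed S" "h \<in> S"
  shows "k < length h \<Longrightarrow> take (Suc k) h \<in> S"
proof (induction "length h - Suc k" arbitrary: k)
  case 0
  then show ?case using assms(2) by simp
next
  case (Suc d)
  then have *: "take (Suc (Suc k)) h \<in> S" by simp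
  have "take (Suc (Suc k)) h = take (Suc k) h @ [h ! Suc k]"
    using Suc by (intro take_Suc_conv_app_nth) simp
  moreover have "take (Suc k) h \<noteq> []" using Suc by (cases h) auto
  ultimately show ?case using * assms(1) unfolding prefix_closed_def by metis
qed

lemma prefix_closed_prefix:
  "prefix_closed S \<Longrightarrow> h \<in> S \<Longrightarrow> prefix g h \<Longrightarrow> g \<noteq> [] \<Longrightarrow> g \<in> S"
  using prefix_closed_take[of S h "length g - 1"]
  by (metis One_nat_def Suc_pred append_eq_conv_conj diff_less le_less_trans length_greater_0_conv
      less_eq_Suc_le nat_less_le prefixE prefix_length_le zero_less_one)

lemma prefix_closed_follows:
  assumes "prefix_closed S" "\<And>n. n \<ge> k \<Longrightarrow> pref p n \<in> S" "pref p (Suc 0) \<noteq> []"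
  shows "follows S p"
  unfolding follows_def
proof
  fix n
  have "prefix (pref p (Suc n)) (pref p (max k (Suc n)))" by (simp add: prefix_pref_le)
  moreover have "pref p (Suc n) \<noteq> []"
    using assms(3) prefix_pref_le[of "Suc 0" "Suc n" p] by (metis Suc_le_mono le0 prefix_Nil)
  ultimately show "pref p (Suc n) \<in> S" using assms(1,2) prefix_closed_prefix by (metis max.cobounded1)
qed

lemma tree_prefix_closed_play_exists:
  assumes "tree G P S" "prefix_closed S" "h \<in> S"
  shows "\<exists>p. play G p \<and> pref p (length h) = h \<and> follows S p"
proof -
  obtain p where p: "play G p" "pref p (length h) = h" "\<forall>n\<ge>length h. pref p n \<in> S"
    using tree_play_exists[OF assms(1,3)] by blast
  moreover have "pref p (Suc 0) \<noteq> []" using play_pref[OF p(1)] partial_play_nonempty by blast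
  ultimately show ?thesis using prefix_closed_follows[OF assms(2)] by blast
qed

section \<open>Passing from strategies to trees and back\<close>

lemma agrees_snoc:
  assumes "h \<noteq> []"
  shows "agrees G P \<sigma> (FinSeq (h @ [v])) \<longleftrightarrow>
     agrees G P \<sigma> (FinSeq h) \<and> (last h \<in> owned G P \<longrightarrow> v = \<sigma> h)" (is "?L \<longleftrightarrow> ?R")
proof -
  have *: "last h = h ! (length h - 1)" using assms by (rule last_conv_nth)
  show ?thesis
  proof
    assume L: ?L
    have "h ! Suc n = \<sigma> (take (Suc n) h)" if "Suc n < length h" "h ! n \<in> owned G P" for n
      using L that by (auto simp: nth_append dest!: spec[of _ n])
    moreover have "v = \<sigma> h" if "last h \<in> owned G P"
      using L that assms * by (auto simp: nth_append dest!: spec[of _ "length h - 1"])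
    ultimately show ?R by simp
  next
    assume R: ?R
    have "(h @ [v]) ! Suc n = \<sigma> (take (Suc n) (h @ [v]))"
      if "Suc n < length (h @ [v])" "(h @ [v]) ! n \<in> owned G P" for n
    proof -
      have "Suc n < length h \<or> n = length h - 1 \<and> Suc n = length h" using that(1) by fastforce
      then show ?thesis using R that(2) * by (auto simp: nth_append)
    qed
    then show ?L by simp
  qed
qed

lemma strategy_tree:
  assumes "strategy G P \<sigma>"
  shows "\<exists>S. tree G P S \<and> prefix_closed S \<and> (\<forall>p. play G p \<and> follows S p \<longrightarrow> agrees G P \<sigma> p)"
proof -
  define S where "S = {h. partial_play G h \<and> agrees G P \<sigma> (FinSeq h)}"
  have "tree G P S"
    unfolding tree_def
  proof (intro conjI ballI)
    fix h assume h: "h \<in> S"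
    then have ne: "h \<noteq> []" and pp: "partial_play G h" using partial_play_nonempty S_def by auto
    show "if last h \<in> owned G P
          then (\<exists>v. (last h, v) \<in> edges G) \<longrightarrow> (\<exists>v. (last h, v) \<in> edges G \<and> h @ [v] \<in> S)
          else \<forall>v. (last h, v) \<in> edges G \<longrightarrow> h @ [v] \<in> S"
      using h agrees_snoc[OF ne, of G P \<sigma>] partial_play_snoc[OF ne, of G] assms
      unfolding S_def strategy_def by (auto simp del: agrees.simps)
  qed (auto simp: S_def)
  moreover have "prefix_closed S"
    by (auto simp: prefix_closed_def S_def agrees_snoc partial_play_snoc simp del: agrees.simps)
  moreover have "agrees G P \<sigma> p" if "follows S p" for p
  proof (cases p)
    case (FinSeq h)
    then have "pref p (Suc (length h)) \<in> S" using that follows_def by blast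
    then show ?thesis using FinSeq S_def by simp
  next
    case (InfSeq q)
    have "q (Suc n) = \<sigma> (map q [0..<Suc n])" if "q n \<in> owned G P" for n
    proof -
      have "map q [0..<Suc n] @ [q (Suc n)] \<in> S"
        using \<open>follows S p\<close> InfSeq unfolding follows_def by (auto dest: spec[of _ "Suc n"])
      then have "agrees G P \<sigma> (FinSeq (map q [0..<Suc n] @ [q (Suc n)]))" unfolding S_def by blast
      then show ?thesis using agrees_snoc[of "map q [0..<Suc n]" G P \<sigma> "q (Suc n)"] that by simp
    qed
    then show ?thesis using InfSeq by simp
  qed
  ultimately show ?thesis by blast
qed

lemma tree_strategy:
  assumes "tree G P S"
  shows "\<exists>\<sigma>. strategy G P \<sigma> \<and> (\<forall>p. play G p \<and> agrees G P \<sigma> p \<longrightarrow> follows S p)"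
proof -
  \<comment> \<open>Outside \<open>S\<close> an arbitrary legal move is chosen, since a strategy has
    to be legal at all partial plays.\<close>
  define \<sigma> where "\<sigma> h = (SOME v. (last h, v) \<in> edges G \<and> (h \<in> S \<longrightarrow> h @ [v] \<in> S))" for h
  have \<sigma>: "(last h, \<sigma> h) \<in> edges G \<and> (h \<in> S \<longrightarrow> h @ [\<sigma> h] \<in> S)"
    if "last h \<in> owned G P" "(last h, v) \<in> edges G" for h v
  proof -
    have "\<exists>v. (last h, v) \<in> edges G \<and> (h \<in> S \<longrightarrow> h @ [v] \<in> S)"
      using that tree_own[OF assms] by blast
    then show ?thesis unfolding \<sigma>_def by (rule someI_ex)
  qed
  have "follows S p" if p: "play G p" "agrees G P \<sigma> p" for p
    unfolding follows_def
  proof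
    fix n show "pref p (Suc n) \<in> S"
    proof (induction n)
      case 0
      have "pref p (Suc 0) = [init_pos G]"
        using p(1) by (cases p) (auto simp: partial_play_def take_Suc)
      then show ?case using tree_init[OF assms] by simp
    next
      case (Suc n)
      let ?h = "pref p (Suc n)"
      from play_pref_Suc[OF p(1), of n] show ?case
      proof (elim disjE exE conjE)
        fix v assume v: "pref p (Suc (Suc n)) = ?h @ [v]" "(last ?h, v) \<in> edges G"
        have "agrees G P \<sigma> (FinSeq (pref p (Suc (Suc n))))"
        proof (cases p)
          case (FinSeq h)
          then show ?thesis using p(2) by (auto simp: min_def)
        next
          case (InfSeq q)
          have "map q [0..<Suc (Suc n)] ! Suc k = \<sigma> (take (Suc k) (map q [0..<Suc (Suc n)]))"
            if len: "Suc k < length (map q [0..<Suc (Suc n)])"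
              and own: "map q [0..<Suc (Suc n)] ! k \<in> owned G P" for k
          proof -
            have that: "Suc k < Suc (Suc n)" using len by simp
            have 1: "map q [0..<Suc (Suc n)] ! k = q k" "map q [0..<Suc (Suc n)] ! Suc k = q (Suc k)"
              using that by (simp_all add: nth_append del: upt_Suc)
            have 2: "take (Suc k) (map q [0..<Suc (Suc n)]) = map q [0..<Suc k]"
              using that by (simp add: take_map_upt min_def del: upt_Suc)
            show ?thesis unfolding 1 2 using own p(2) InfSeq 1(1) by simp
          qed
          then have "agrees G P \<sigma> (FinSeq (map q [0..<Suc (Suc n)]))"
            unfolding agrees.simps by blast
          then show ?thesis using InfSeq by (simp only: pref.simps)
        qed
        then have "last ?h \<in> owned G P \<longrightarrow> v = \<sigma> ?h"
          using v(1) agrees_snoc[of ?h] partial_play_nonempty[OF play_pref[OF p(1)]] by metis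
        then show ?thesis using v Suc \<sigma> tree_other[OF assms Suc] by metis
      qed (use Suc in simp)
    qed
  qed
  moreover have "strategy G P \<sigma>" unfolding strategy_def using \<sigma> by blast
  ultimately show ?thesis by blast
qed

lemma wins_tree:
  "wins G P W \<longleftrightarrow>
     (\<exists>S. tree G P S \<and> prefix_closed S \<and> (\<forall>p. play G p \<and> follows S p \<longrightarrow> W (out_word G p)))"
  unfolding wins_def using strategy_tree tree_strategy by metis

section \<open>Values of games in terms of trees\<close>

lemma partial_play_positions: "wf_arena G \<Longrightarrow> partial_play G h \<Longrightarrow> last h \<in> positions G"
proof (induction h rule: rev_induct)
  case (snoc v h)
  then show ?case
    by (cases "h = []") (auto simp: partial_play_snoc wf_arena_def)
qed (simp add: partial_play_def)

lemma owned_opponent: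
  "wf_arena G \<Longrightarrow> v \<in> positions G \<Longrightarrow> v \<in> owned G (opponent P) \<longleftrightarrow> v \<notin> owned G P"
  by (cases P) (auto simp: wf_arena_def)

text \<open>At each element of the intersection, the owner's tree supplies a move and the other tree
  admits every move, so the intersection can be continued to a play.\<close>

lemma trees_meet:
  assumes "wf_arena G" "tree G P S" "tree G (opponent P) S'" "prefix_closed S" "prefix_closed S'"
  shows "\<exists>p. play G p \<and> follows S p \<and> follows S' p"
proof -
  have "\<exists>p. play G p \<and> pref p (length [init_pos G]) = [init_pos G]
      \<and> (\<forall>n\<ge>length [init_pos G]. pref p n \<in> S \<inter> S')"
  proof (rule play_exists)
    fix g v assume g: "g \<in> S \<inter> S'" "(last g, v) \<in> edges G"
    then have "last g \<in> positions G"
      using assms(1,2) partial_play_positions tree_partial_play by blast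
    then show "\<exists>v. g @ [v] \<in> S \<inter> S'"
      using g owned_opponent[OF assms(1)] tree_own[OF assms(2)] tree_own[OF assms(3)]
        tree_other[OF assms(2)] tree_other[OF assms(3)] by (metis IntD1 IntD2 IntI)
  qed (use assms tree_init tree_partial_play in auto)
  then show ?thesis by (auto simp: follows_def)
qed

text \<open>Non-strict for Eve and strict for Adam, as in the threshold letter games; this makes the
  goals of the two players complementary.\<close>

fun secures :: "player \<Rightarrow> real \<Rightarrow> ereal \<Rightarrow> bool" where
  "secures Eve t x \<longleftrightarrow> ereal t \<le> x"
| "secures Adam t x \<longleftrightarrow> x < ereal t"

lemma secures_opponent: "secures (opponent P) t x \<longleftrightarrow> \<not> secures P t x"
  by (cases P) auto

definition ensures :: "('v, 'l) arena \<Rightarrow> player \<Rightarrow> 'l seqfun \<Rightarrow> real \<Rightarrow> bool" where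
  "ensures G P f t \<longleftrightarrow> (\<exists>S. tree G P S \<and> prefix_closed S
     \<and> (\<forall>p. play G p \<and> follows S p \<longrightarrow> secures P t (payoff G f p)))"

lemma ensures_Eve_value:
  assumes "tree G Eve S" "\<And>p. play G p \<Longrightarrow> follows S p \<Longrightarrow> ereal t \<le> payoff G f p"
  shows "ereal t \<le> eve_value G f"
proof -
  obtain \<sigma> where \<sigma>: "strategy G Eve \<sigma>" "\<forall>p. play G p \<and> agrees G Eve \<sigma> p \<longrightarrow> follows S p"
    using tree_strategy assms(1) by blast
  have "ereal t \<le> eve_strategy_value G f \<sigma>"
    unfolding eve_strategy_value_def using \<sigma> assms by (auto intro!: INF_greatest)
  also have "\<dots> \<le> eve_value G f" unfolding eve_value_def using \<sigma> by (auto intro: SUP_upper)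
  finally show ?thesis .
qed

lemma ensures_Adam_value:
  assumes "tree G Adam S" "\<And>p. play G p \<Longrightarrow> follows S p \<Longrightarrow> payoff G f p \<le> ereal t"
  shows "adam_value G f \<le> ereal t"
proof -
  obtain \<sigma> where \<sigma>: "strategy G Adam \<sigma>" "\<forall>p. play G p \<and> agrees G Adam \<sigma> p \<longrightarrow> follows S p"
    using tree_strategy assms(1) by blast
  have "adam_value G f \<le> adam_strategy_value G f \<sigma>"
    unfolding adam_value_def using \<sigma> by (auto intro: INF_lower)
  also have "\<dots> \<le> ereal t"
    unfolding adam_strategy_value_def using \<sigma> assms by (auto intro!: SUP_least)
  finally show ?thesis .
qed

text \<open>The inequality is strict because the supremum over strategies need not be attained. For
  word games with finitely many values, \<open>word_value_attained\<close> closes this gap.\<close>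

lemma eve_value_ensures:
  assumes "ereal t < eve_value G f"
  shows "ensures G Eve f t"
proof -
  obtain \<sigma> where \<sigma>: "strategy G Eve \<sigma>" "ereal t < eve_strategy_value G f \<sigma>"
    using assms unfolding eve_value_def less_SUP_iff by blast
  have *: "ereal t \<le> payoff G f p" if "play G p" "agrees G Eve \<sigma> p" for p
  proof -
    have "eve_strategy_value G f \<sigma> \<le> payoff G f p"
      unfolding eve_strategy_value_def using that by (auto intro: INF_lower)
    then show ?thesis using \<sigma>(2) by simp
  qed
  then show ?thesis unfolding ensures_def secures.simps using strategy_tree[OF \<sigma>(1)] by metis
qed

lemma adam_value_ensures:
  assumes "adam_value G f < ereal t"
  shows "ensures G Adam f t"
proof -
  obtain \<sigma> where \<sigma>: "strategy G Adam \<sigma>" "adam_strategy_value G f \<sigma> < ereal t"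
    using assms unfolding adam_value_def INF_less_iff by blast
  have *: "payoff G f p < ereal t" if "play G p" "agrees G Adam \<sigma> p" for p
  proof -
    have "payoff G f p \<le> adam_strategy_value G f \<sigma>"
      unfolding adam_strategy_value_def using that by (auto intro: SUP_upper)
    then show ?thesis using \<sigma>(2) by simp
  qed
  then show ?thesis unfolding ensures_def secures.simps using strategy_tree[OF \<sigma>(1)] by metis
qed

lemma eve_value_le_adam_value:
  assumes "wf_arena G"
  shows "eve_value G f \<le> adam_value G f"
proof (rule ccontr)
  assume "\<not> ?thesis"
  then obtain t where t: "adam_value G f < ereal t" "ereal t < eve_value G f"
    using ereal_dense2 not_le by metis
  obtain S where S: "tree G Eve S" "prefix_closed S"
      "\<forall>p. play G p \<and> follows S p \<longrightarrow> secures Eve t (payoff G f p)"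
    using eve_value_ensures[OF t(2)] unfolding ensures_def by blast
  obtain S' where S': "tree G Adam S'" "prefix_closed S'"
      "\<forall>p. play G p \<and> follows S' p \<longrightarrow> secures Adam t (payoff G f p)"
    using adam_value_ensures[OF t(1)] unfolding ensures_def by blast
  show False
    using trees_meet[OF assms S(1) _ S(2) S'(2)] S(3) S'(1,3) by force
qed

section \<open>Games whose winning condition is a countable union of G-delta sets\<close>

definition pre :: "(nat \<Rightarrow> 'v) \<Rightarrow> nat \<Rightarrow> 'v list" where
  "pre p n = map p [0..<n]"

lemma pre_0 [simp]: "pre p 0 = []"
  and pre_Suc [simp]: "pre p (Suc n) = pre p n @ [p n]"
  and length_pre [simp]: "length (pre p n) = n"
  by (simp_all add: pre_def)

lemma take_pre: "take k (pre p n) = pre p (min k n)"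
  by (simp add: pre_def take_map min_def)

lemma nth_pre [simp]: "i < n \<Longrightarrow> pre p n ! i = p i"
  by (simp add: pre_def)

lemma prefix_pre: "m \<le> n \<Longrightarrow> prefix (pre p m) (pre p n)"
  using take_pre[of m p n] by (metis min.absorb1 take_is_prefix)

text \<open>Only prefixes from \<open>h\<close> on are tested, so that \<open>S\<close> can describe
  the game after \<open>h\<close>.\<close>

definition branches :: "'v list set \<Rightarrow> 'v list \<Rightarrow> (nat \<Rightarrow> 'v) set" where
  "branches S h = {p. pre p (length h) = h \<and> (\<forall>n\<ge>length h. pre p n \<in> S)}"

text \<open>A strategy that may leave several moves open. It is again a game tree, so a
  quasi-strategy of the opponent can serve as the \<open>T\<close> of a smaller game; the proof of
  Davis's theorem does this repeatedly.\<close>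

definition quasi_strategy ::
    "'v list set \<Rightarrow> ('v list \<Rightarrow> bool) \<Rightarrow> 'v list \<Rightarrow> 'v list set \<Rightarrow> bool" where
  "quasi_strategy T own h S \<longleftrightarrow> S \<subseteq> T \<and> h \<in> S
     \<and> (\<forall>g\<in>S. if own g then \<exists>v. g @ [v] \<in> S else \<forall>v. g @ [v] \<in> T \<longrightarrow> g @ [v] \<in> S)"

definition wins_from ::
    "'v list set \<Rightarrow> ('v list \<Rightarrow> bool) \<Rightarrow> 'v list \<Rightarrow> (nat \<Rightarrow> 'v) set \<Rightarrow> bool" where
  "wins_from T own h A \<longleftrightarrow> (\<exists>S. quasi_strategy T own h S \<and> branches S h \<subseteq> A)"

lemma quasi_strategyD:
  assumes "quasi_strategy T own h S"
  shows "S \<subseteq> T" "h \<in> S" "\<And>g. g \<in> S \<Longrightarrow> own g \<Longrightarrow> \<exists>v. g @ [v] \<in> S"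
    "\<And>g v. g \<in> S \<Longrightarrow> \<not> own g \<Longrightarrow> g @ [v] \<in> T \<Longrightarrow> g @ [v] \<in> S"
  using assms unfolding quasi_strategy_def by (auto split: if_splits)

lemma quasi_strategyI:
  assumes "S \<subseteq> T" "h \<in> S" "\<And>g. g \<in> S \<Longrightarrow> own g \<Longrightarrow> \<exists>v. g @ [v] \<in> S"
    "\<And>g v. g \<in> S \<Longrightarrow> \<not> own g \<Longrightarrow> g @ [v] \<in> T \<Longrightarrow> g @ [v] \<in> S"
  shows "quasi_strategy T own h S"
  using assms unfolding quasi_strategy_def by auto

lemma quasi_strategy_trans:
  assumes "quasi_strategy T own g T'" "quasi_strategy T' own h T''"
  shows "quasi_strategy T own h T''"
  using quasi_strategyD[OF assms(1)] quasi_strategyD[OF assms(2)]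
  by (intro quasi_strategyI) blast+

section \<open>Switching to another strategy when a set of positions is entered\<close>

definition extension_closed :: "('v list \<Rightarrow> bool) \<Rightarrow> bool" where
  "extension_closed H \<longleftrightarrow> (\<forall>g v. H g \<longrightarrow> H (g @ [v]))"

lemma extension_closed_append: "extension_closed H \<Longrightarrow> H g \<Longrightarrow> H (g @ z)"
  by (induction z rule: rev_induct) (auto simp: extension_closed_def simp flip: append_assoc)

lemma extension_closed_prefix: "extension_closed H \<Longrightarrow> H g \<Longrightarrow> prefix g g' \<Longrightarrow> H g'"
  using extension_closed_append by (auto simp: prefix_def)

definition entry :: "('v list \<Rightarrow> bool) \<Rightarrow> 'v list \<Rightarrow> 'v list" where
  "entry H g = take (LEAST k. H (take k g)) g"

lemma entry_snoc:
  assumes "H g"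
  shows "entry H (g @ [v]) = entry H g"
proof -
  let ?k = "LEAST k. H (take k g)"
  have k: "H (take ?k g)" "?k \<le> length g"
    using assms LeastI[of "\<lambda>k. H (take k g)" "length g"] Least_le[of "\<lambda>k. H (take k g)" "length g"]
    by simp_all
  have "(LEAST k. H (take k (g @ [v]))) = ?k"
  proof (rule Least_equality)
    fix y assume y: "H (take y (g @ [v]))"
    show "?k \<le> y"
    proof (cases "y \<le> length g")
      case True
      then show ?thesis using y by (simp add: Least_le)
    qed (use k in simp)
  qed (use k in simp)
  then show ?thesis using k by (simp add: entry_def)
qed

lemma entry_new:
  assumes "extension_closed H" "\<not> H g" "H (g @ [v])"
  shows "entry H (g @ [v]) = g @ [v]"
proof -
  have "(LEAST k. H (take k (g @ [v]))) = Suc (length g)"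
  proof (rule Least_equality)
    fix y assume y: "H (take y (g @ [v]))"
    show "Suc (length g) \<le> y"
    proof (rule ccontr)
      assume "\<not> ?thesis"
      then have "H (take y g)" using y by simp
      then show False using extension_closed_prefix[OF assms(1)] take_is_prefix assms(2) by blast
    qed
  qed (use assms in simp)
  then show ?thesis by (simp add: entry_def)
qed

text \<open>The pattern behind the compositions of strategies below. The tree followed inside
  \<open>H\<close> is chosen at the point of entry and kept from then on, by
  \<open>entry_snoc\<close>.\<close>

definition glue ::
    "('v list \<Rightarrow> bool) \<Rightarrow> 'v list set \<Rightarrow> ('v list \<Rightarrow> 'v list set) \<Rightarrow> 'v list set" where
  "glue H S W = {g. if H g then g \<in> W (entry H g) else g \<in> S}"

text \<open>An empty \<open>W e\<close> stands for the absence of a tree; \<open>own\<close> and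
  \<open>other\<close> make sure that a tree is there at those entries that the quasi-strategy
  needs.\<close>

lemma glue_quasi_strategy:
  assumes H: "extension_closed H" "\<not> H h" and h: "h \<in> S"
    and S: "\<And>g. g \<in> S \<Longrightarrow> \<not> H g \<Longrightarrow> g \<in> T"
    and own: "\<And>g. g \<in> S \<Longrightarrow> \<not> H g \<Longrightarrow> own g \<Longrightarrow>
        \<exists>v. g @ [v] \<in> (if H (g @ [v]) then W (g @ [v]) else S)"
    and other: "\<And>g v. g \<in> S \<Longrightarrow> \<not> H g \<Longrightarrow> \<not> own g \<Longrightarrow> g @ [v] \<in> T \<Longrightarrow>
        g @ [v] \<in> (if H (g @ [v]) then W (g @ [v]) else S)"
    and W: "\<And>e. W e = {} \<or> quasi_strategy T own e (W e)"
  shows "quasi_strategy T own h (glue H S W)"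
proof -
  have W': "quasi_strategy T own e (W e)" if "g \<in> W e" for g e using W that by blast
  have new: "g @ [v] \<in> glue H S W" if "\<not> H g" "g @ [v] \<in> (if H (g @ [v]) then W (g @ [v]) else S)" for g v
    using that entry_new[OF H(1)] by (auto simp: glue_def split: if_splits)
  have old: "g @ [v] \<in> glue H S W" if "H g" "g @ [v] \<in> W (entry H g)" for g v
    using that H(1) by (simp add: glue_def extension_closed_def entry_snoc[of H])
  show ?thesis
  proof (rule quasi_strategyI)
    show "glue H S W \<subseteq> T"
    proof
      fix g assume "g \<in> glue H S W"
      then show "g \<in> T" using S quasi_strategyD(1)[OF W'[of g "entry H g"]] unfolding glue_def
        by (auto split: if_splits)
    qed
    show "h \<in> glue H S W" using H h by (simp add: glue_def)
  next
    fix g assume g: "g \<in> glue H S W" "own g"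
    show "\<exists>v. g @ [v] \<in> glue H S W"
    proof (cases "H g")
      case True
      then have "g \<in> W (entry H g)" using g by (simp add: glue_def)
      then show ?thesis using quasi_strategyD(3)[OF W'] g(2) old[OF True] by metis
    next
      case False
      then have "g \<in> S" using g(1) by (simp add: glue_def)
      then show ?thesis using own[OF _ False g(2)] new[OF False] by blast
    qed
  next
    fix g v assume g: "g \<in> glue H S W" "\<not> own g" "g @ [v] \<in> T"
    show "g @ [v] \<in> glue H S W"
    proof (cases "H g")
      case True
      then have "g \<in> W (entry H g)" using g by (simp add: glue_def)
      then show ?thesis using quasi_strategyD(4)[OF W'] g(2,3) old[OF True] by metis
    next
      case False
      then have "g \<in> S" using g(1) by (simp add: glue_def)
      then show ?thesis using other[OF _ False g(2,3)] new[OF False] by blast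
    qed
  qed
qed

lemma glue_branches:
  assumes "extension_closed H" "\<not> H h" "p \<in> branches (glue H S W) h"
  shows "(\<forall>n\<ge>length h. pre p n \<in> S \<and> \<not> H (pre p n))
    \<or> (\<exists>k\<ge>length h. H (pre p k) \<and> p \<in> branches (W (pre p k)) (pre p k))"
proof (cases "\<exists>n. H (pre p n)")
  case True
  define k where "k = (LEAST n. H (pre p n))"
  have k: "H (pre p k)" unfolding k_def using True LeastI_ex by metis
  have less: "\<not> H (pre p m)" if "m < k" for m using that not_less_Least unfolding k_def by blast
  have len: "length h < k"
  proof (rule ccontr)
    assume "\<not> ?thesis"
    then have "prefix (pre p k) (pre p (length h))" by (intro prefix_pre) simp
    then show False
      using extension_closed_prefix[OF assms(1) k] assms(2,3) by (simp add: branches_def)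
  qed
  then obtain k' where k': "k = Suc k'" by (cases k) auto
  have *: "H (pre p m) \<and> entry H (pre p m) = pre p k" if "m \<ge> k" for m
    using that
  proof (induction m rule: dec_induct)
    case base
    show ?case using k entry_new[OF assms(1) less[of k']] k' by simp
  next
    case (step m)
    then show ?case using assms(1) by (simp add: extension_closed_def entry_snoc[of H])
  qed
  have "pre p m \<in> W (pre p k)" if "m \<ge> k" for m
  proof -
    have "pre p m \<in> glue H S W" using assms(3) that len by (simp add: branches_def)
    then show ?thesis using *[OF that] by (simp add: glue_def)
  qed
  then have "p \<in> branches (W (pre p k)) (pre p k)" by (simp add: branches_def)
  then show ?thesis using k len by (intro disjI2 exI[of _ k]) simp
next
  case False
  then show ?thesis using assms(3) by (auto simp: branches_def glue_def)
qed

lemma wins_from_step: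
  assumes "g \<in> T" and step: "if own g then \<exists>v. g @ [v] \<in> T \<and> wins_from T own (g @ [v]) A
      else \<forall>v. g @ [v] \<in> T \<longrightarrow> wins_from T own (g @ [v]) A"
  shows "wins_from T own g A"
proof -
  define W where "W e = (if wins_from T own e A
      then SOME S. quasi_strategy T own e S \<and> branches S e \<subseteq> A else {})" for e
  have W: "quasi_strategy T own e (W e) \<and> branches (W e) e \<subseteq> A" if "wins_from T own e A" for e
    using someI_ex[OF that[unfolded wins_from_def]] that unfolding W_def by simp
  \<comment> \<open>\<open>H\<close> holds strictly below \<open>g\<close>, so the switch takes
    place after one move.\<close>
  define H where "H = strict_prefix g"
  have H: "extension_closed H" "\<not> H g" "\<And>v. H (g @ [v])"
    by (auto simp: H_def extension_closed_def strict_prefix_def)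
  have mem: "g @ [v] \<in> W (g @ [v])" if "wins_from T own (g @ [v]) A" for v
    using W[OF that] quasi_strategyD(2) by blast
  have "quasi_strategy T own g (glue H {g} W)"
  proof (rule glue_quasi_strategy[OF H(1,2)])
    show "W e = {} \<or> quasi_strategy T own e (W e)" for e using W by (auto simp: W_def)
  qed (use assms(1) step H(3) mem in \<open>auto split: if_splits\<close>)
  moreover have "branches (glue H {g} W) g \<subseteq> A"
  proof
    fix p assume "p \<in> branches (glue H {g} W) g"
    from glue_branches[OF H(1,2) this] show "p \<in> A"
    proof
      assume "\<forall>n\<ge>length g. pre p n \<in> {g} \<and> \<not> H (pre p n)"
      then have "pre p (Suc (length g)) = g" by (metis le_SucI order_refl singletonD)
      then have "length (pre p (Suc (length g))) = length g" by metis
      then show ?thesis by (simp only: length_pre)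
    next
      assume "\<exists>k\<ge>length g. H (pre p k) \<and> p \<in> branches (W (pre p k)) (pre p k)"
      then obtain k where k: "p \<in> branches (W (pre p k)) (pre p k)" by blast
      then have "pre p k \<in> W (pre p k)" by (simp add: branches_def)
      then have "wins_from T own (pre p k) A" unfolding W_def by (auto split: if_splits)
      then show ?thesis using W k by blast
    qed
  qed
  ultimately show ?thesis unfolding wins_from_def by blast
qed

text \<open>All initial segments from \<open>h\<close> on are tested. This yields a tree which the
  opponent never has to leave, provided that \<open>h\<close> itself is not won.\<close>

definition nonlosing ::
    "'v list set \<Rightarrow> ('v list \<Rightarrow> bool) \<Rightarrow> 'v list \<Rightarrow> (nat \<Rightarrow> 'v) set \<Rightarrow> 'v list set" where
  "nonlosing T own h A =
     {g \<in> T. prefix h g \<and> (\<forall>k\<ge>length h. \<not> wins_from T own (take k g) A)}"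

lemma nonlosing_snoc:
  assumes "g \<in> nonlosing T own h A"
  shows "g @ [v] \<in> nonlosing T own h A \<longleftrightarrow> g @ [v] \<in> T \<and> \<not> wins_from T own (g @ [v]) A"
proof
  assume "g @ [v] \<in> nonlosing T own h A"
  then show "g @ [v] \<in> T \<and> \<not> wins_from T own (g @ [v]) A"
    using assms unfolding nonlosing_def
    by (auto dest!: prefix_length_le spec[of _ "Suc (length g)"])
next
  assume R: "g @ [v] \<in> T \<and> \<not> wins_from T own (g @ [v]) A"
  have "\<not> wins_from T own (take k (g @ [v])) A" if "k \<ge> length h" for k
    using assms that R unfolding nonlosing_def by (cases "k \<le> length g") auto
  then show "g @ [v] \<in> nonlosing T own h A" using assms R unfolding nonlosing_def by auto
qed

text \<open>This is the contraposition of \<open>wins_from_step\<close>, applied at each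
  position.\<close>

lemma nonlosing_quasi_strategy:
  assumes "h \<in> T" "\<not> wins_from T own h A"
  shows "quasi_strategy T (\<lambda>g. \<not> own g) h (nonlosing T own h A)"
proof (rule quasi_strategyI)
  fix g assume g: "g \<in> nonlosing T own h A" "\<not> own g"
  then have "g \<in> T" "\<not> wins_from T own g A"
    by (auto simp: nonlosing_def dest!: prefix_length_le spec[of _ "length g"])
  then show "\<exists>v. g @ [v] \<in> nonlosing T own h A"
    using nonlosing_snoc[OF g(1)] wins_from_step[of g T own A] g(2) by metis
next
  fix g v assume g: "g \<in> nonlosing T own h A" "\<not> \<not> own g" "g @ [v] \<in> T"
  then have "g \<in> T" "\<not> wins_from T own g A"
    by (auto simp: nonlosing_def dest!: prefix_length_le spec[of _ "length g"])
  then show "g @ [v] \<in> nonlosing T own h A"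
    using nonlosing_snoc[OF g(1)] wins_from_step[of g T own A] g(2,3) by metis
qed (use assms in \<open>auto simp: nonlosing_def\<close>)

text \<open>Removing the won positions does not help the player: they could follow a strategy for
  the smaller game until the opponent leaves it, which leads to a position won in
  \<open>T\<close>.\<close>

lemma nonlosing_not_wins:
  assumes "h \<in> T" "\<not> wins_from T own h A"
  shows "\<not> wins_from (nonlosing T own h A) own h A"
proof
  let ?N = "nonlosing T own h A"
  assume "wins_from ?N own h A"
  then obtain S where S: "quasi_strategy ?N own h S" "branches S h \<subseteq> A"
    unfolding wins_from_def by blast
  define W where "W e = (if wins_from T own e A
      then SOME S. quasi_strategy T own e S \<and> branches S e \<subseteq> A else {})" for e
  have W: "quasi_strategy T own e (W e) \<and> branches (W e) e \<subseteq> A" if "wins_from T own e A" for e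
    using someI_ex[OF that[unfolded wins_from_def]] that unfolding W_def by simp
  define H where "H g \<longleftrightarrow> (\<exists>k\<ge>length h. k \<le> length g \<and> wins_from T own (take k g) A)" for g
  have H1: "extension_closed H" unfolding extension_closed_def H_def by fastforce
  have H2: "\<not> H h" using assms(2) by (simp add: H_def)
  have SN: "\<not> H g" "g \<in> ?N" "g \<in> T" if "g \<in> S" for g
    using that quasi_strategyD(1)[OF S(1)] by (auto simp: H_def nonlosing_def)
  have "quasi_strategy T own h (glue H S W)"
  proof (rule glue_quasi_strategy[OF H1 H2])
    show "W e = {} \<or> quasi_strategy T own e (W e)" for e using W by (auto simp: W_def)
    show "h \<in> S" using quasi_strategyD(2)[OF S(1)] .
    show "g \<in> S \<Longrightarrow> \<not> H g \<Longrightarrow> g \<in> T" for g using SN by blast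
    show "\<exists>v. g @ [v] \<in> (if H (g @ [v]) then W (g @ [v]) else S)"
      if "g \<in> S" "\<not> H g" "own g" for g
      using quasi_strategyD(3)[OF S(1) that(1,3)] SN by fastforce
    show "g @ [v] \<in> (if H (g @ [v]) then W (g @ [v]) else S)"
      if g: "g \<in> S" "\<not> H g" "\<not> own g" "g @ [v] \<in> T" for g v
    proof (cases "g @ [v] \<in> ?N")
      case True
      then have "g @ [v] \<in> S" using quasi_strategyD(4)[OF S(1) g(1,3)] by blast
      then show ?thesis using SN by simp
    next
      case False
      then have win: "wins_from T own (g @ [v]) A" using nonlosing_snoc SN g by metis
      have "prefix h g" using SN(2)[OF g(1)] by (simp add: nonlosing_def)
      then have "H (g @ [v])" using win unfolding H_def
        by (auto dest!: prefix_length_le intro!: exI[of _ "Suc (length g)"])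
      then show ?thesis using W[OF win] quasi_strategyD(2) by auto
    qed
  qed
  moreover have "branches (glue H S W) h \<subseteq> A"
  proof
    fix p assume p: "p \<in> branches (glue H S W) h"
    from glue_branches[OF H1 H2 this] show "p \<in> A"
    proof
      assume "\<forall>n\<ge>length h. pre p n \<in> S \<and> \<not> H (pre p n)"
      then have "p \<in> branches S h" using p by (simp add: branches_def)
      then show ?thesis using S(2) by blast
    next
      assume "\<exists>k\<ge>length h. H (pre p k) \<and> p \<in> branches (W (pre p k)) (pre p k)"
      then obtain k where k: "p \<in> branches (W (pre p k)) (pre p k)" by blast
      then have "pre p k \<in> W (pre p k)" by (simp add: branches_def)
      then have "wins_from T own (pre p k) A" unfolding W_def by (auto split: if_splits)
      then show ?thesis using W k by blast
    qed
  qed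
  ultimately show False using assms(2) unfolding wins_from_def by blast
qed

text \<open>These are the good positions of the proof of Davis's theorem: the opponent of the player aiming at \<open>A\<close>
  can avoid \<open>B\<close> for good without turning the game into a win for that player.\<close>

definition avoidable ::
    "'v list set \<Rightarrow> ('v list \<Rightarrow> bool) \<Rightarrow> (nat \<Rightarrow> 'v) set \<Rightarrow> (nat \<Rightarrow> 'v) set \<Rightarrow> 'v list \<Rightarrow> bool" where
  "avoidable T own A B h \<longleftrightarrow> (\<exists>T'. quasi_strategy T (\<lambda>g. \<not> own g) h T'
     \<and> branches T' h \<inter> B = {} \<and> \<not> wins_from T' own h A)"

section \<open>Davis's theorem\<close>

definition pruned :: "'v list set \<Rightarrow> bool" where
  "pruned T \<longleftrightarrow> (\<forall>g\<in>T. \<exists>v. g @ [v] \<in> T)"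

lemma quasi_strategy_pruned: "pruned T \<Longrightarrow> quasi_strategy T own h S \<Longrightarrow> pruned S"
  unfolding pruned_def quasi_strategy_def by (meson subsetD)

lemma entry_append: "extension_closed H \<Longrightarrow> H g \<Longrightarrow> entry H (g @ z) = entry H g"
proof (induction z rule: rev_induct)
  case (snoc v z)
  then show ?case
    using entry_snoc[of H "g @ z" v] extension_closed_append[of H g z] by simp
qed simp

text \<open>\<open>U\<close> describes an open set around \<open>B\<close>. The opponent stays in
  the nonlosing positions for \<open>A \<union> E\<close>, with \<open>E\<close> as in the proof,
  until \<open>U\<close> is entered after \<open>h\<close>. The position reached is avoidable, as
  otherwise it would be won for \<open>E\<close>, and the witness of its avoidability takes
  over.\<close>

lemma avoidable_if_not_wins:
  assumes T: "pruned T" and h: "h \<in> T"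
    and U: "extension_closed U" "\<And>p. p \<in> B \<Longrightarrow> \<exists>k. U (pre p k)"
    and nw: "\<not> wins_from T own h
      (A \<union> {p. \<exists>k>length h. U (pre p k) \<and> \<not> avoidable T own A B (pre p k)})"
  shows "avoidable T own A B h"
proof -
  \<comment> \<open>Were \<open>k = length h\<close> allowed, \<open>E\<close> would contain all
    branches from \<open>h\<close> whenever \<open>h\<close> is in \<open>U\<close> and not
    avoidable, which can happen when the lemma is iterated.\<close>
  define E where "E = {p. \<exists>k>length h. U (pre p k) \<and> \<not> avoidable T own A B (pre p k)}"
  define N where "N = nonlosing T own h (A \<union> E)"
  have nw': "\<not> wins_from T own h (A \<union> E)" using nw unfolding E_def .
  have N: "quasi_strategy T (\<lambda>g. \<not> own g) h N" "\<not> wins_from N own h (A \<union> E)"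
    unfolding N_def using nonlosing_quasi_strategy[OF h nw'] nonlosing_not_wins[OF h nw'] .
  define H where "H g \<longleftrightarrow> length h < length g \<and> U g" for g
  have H: "extension_closed H" "\<not> H h" using U(1) by (auto simp: H_def extension_closed_def)
  define W where "W e = (if avoidable T own A B e \<and> e \<in> N
      then SOME T'. quasi_strategy T (\<lambda>g. \<not> own g) e T'
        \<and> branches T' e \<inter> B = {} \<and> \<not> wins_from T' own e A else {})" for e
  have W: "quasi_strategy T (\<lambda>g. \<not> own g) e (W e)" "branches (W e) e \<inter> B = {}"
      "\<not> wins_from (W e) own e A" if "avoidable T own A B e" "e \<in> N" for e
    using someI_ex[OF that(1)[unfolded avoidable_def]] that unfolding W_def by simp_all
  have WD: "avoidable T own A B e" "e \<in> N" if "g \<in> W e" for g e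
    using that unfolding W_def by (auto split: if_splits)
  have good: "g \<in> W g" if g: "g \<in> N" "H g" for g
  proof -
    have "avoidable T own A B g"
    proof (rule ccontr)
      assume "\<not> ?thesis"
      then have "branches {x \<in> T. prefix g x} g \<subseteq> E"
        using g(2) unfolding branches_def E_def H_def by (auto intro!: exI[of _ "length g"])
      moreover have "quasi_strategy T own g {x \<in> T. prefix g x}"
        using T g(1) unfolding quasi_strategy_def pruned_def N_def nonlosing_def by auto
      ultimately have "wins_from T own g (A \<union> E)" unfolding wins_from_def by blast
      then show False using g(1) unfolding N_def nonlosing_def
        by (auto dest!: prefix_length_le spec[of _ "length g"])
    qed
    then show ?thesis using W(1) g(1) quasi_strategyD(2) by blast
  qed
  let ?T = "glue H N W"
  have hN: "h \<in> N" using quasi_strategyD(2)[OF N(1)] .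
  have 1: "quasi_strategy T (\<lambda>g. \<not> own g) h ?T"
  proof (rule glue_quasi_strategy[OF H hN])
    show "W e = {} \<or> quasi_strategy T (\<lambda>g. \<not> own g) e (W e)" for e using W WD by blast
    show "g \<in> N \<Longrightarrow> \<not> H g \<Longrightarrow> g \<in> T" for g by (simp add: N_def nonlosing_def)
    show "\<exists>v. g @ [v] \<in> (if H (g @ [v]) then W (g @ [v]) else N)"
      if "g \<in> N" "\<not> H g" "\<not> own g" for g
      using quasi_strategyD(3)[OF N(1) that(1)] that(3) good by auto
    show "g @ [v] \<in> (if H (g @ [v]) then W (g @ [v]) else N)"
      if "g \<in> N" "\<not> H g" "\<not> \<not> own g" "g @ [v] \<in> T" for g v
      using quasi_strategyD(4)[OF N(1) that(1)] that(3,4) good by auto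
  qed
  have 2: "branches ?T h \<inter> B = {}"
  proof (rule ccontr)
    assume "branches ?T h \<inter> B \<noteq> {}"
    then obtain p where p: "p \<in> branches ?T h" "p \<in> B" by blast
    from glue_branches[OF H p(1)] show False
    proof
      assume no: "\<forall>n\<ge>length h. pre p n \<in> N \<and> \<not> H (pre p n)"
      obtain k where k: "U (pre p k)" using U(2) p(2) by blast
      let ?m = "max k (Suc (length h))"
      have "prefix (pre p k) (pre p ?m)" by (rule prefix_pre) simp
      then have "U (pre p ?m)" using extension_closed_prefix[OF U(1) k] by blast
      then show False using no unfolding H_def
        by (metis Suc_le_lessD length_pre less_imp_le_nat max.cobounded2)
    next
      assume "\<exists>k\<ge>length h. H (pre p k) \<and> p \<in> branches (W (pre p k)) (pre p k)"
      then obtain k where k: "p \<in> branches (W (pre p k)) (pre p k)" by blast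
      then have "pre p k \<in> W (pre p k)" by (simp add: branches_def)
      then show False using W(2)[OF WD] k p(2) by blast
    qed
  qed
  \<comment> \<open>A winning \<open>S\<close> in the glued tree either reaches \<open>H\<close>,
    and then wins in the tree \<open>W e\<close> attached there, or stays in \<open>N\<close>. Both
    are excluded.\<close>
  have 3: "\<not> wins_from ?T own h A"
  proof
    assume "wins_from ?T own h A"
    then obtain S where S: "quasi_strategy ?T own h S" "branches S h \<subseteq> A"
      unfolding wins_from_def by blast
    \<comment> \<open>The part of \<open>S\<close> reachable from \<open>h\<close>, as
      \<open>S\<close> need not be prefix closed.\<close>
    define R where "R = {g \<in> S. prefix h g \<and> (\<forall>k\<ge>length h. take k g \<in> S)}"
    have Rsnoc: "g @ [v] \<in> R" if "g \<in> R" "g @ [v] \<in> S" for g v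
    proof -
      have "take k (g @ [v]) \<in> S" if "k \<ge> length h" for k
        using \<open>g \<in> R\<close> \<open>g @ [v] \<in> S\<close> that by (cases "k \<le> length g") (auto simp: R_def)
      then show ?thesis using that by (simp add: R_def)
    qed
    have hR: "h \<in> R" using quasi_strategyD(2)[OF S(1)] by (simp add: R_def)
    show False
    proof (cases "\<exists>g\<in>R. H g")
      case True
      \<comment> \<open>Minimal length makes \<open>e\<close> the point of entry on its own
        path.\<close>
      then obtain e where e: "e \<in> R" "H e" and min: "\<And>g. g \<in> R \<Longrightarrow> H g \<Longrightarrow> length e \<le> length g"
        using ex_has_least_nat[of "\<lambda>g. g \<in> R \<and> H g" _ length] by metis
      have len: "length h < length e" using e(2) by (simp add: H_def)
      then obtain e' v where e': "e = e' @ [v]" by (cases e rule: rev_cases) auto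
      have "e' \<in> R"
      proof -
        have "take k e' \<in> S" if "k \<ge> length h" for k
        proof -
          have "take k e' = take (min k (length e')) e" using e' by (simp add: min_def)
          moreover have "length h \<le> min k (length e')" using that len e' by simp
          ultimately show ?thesis using e(1) unfolding R_def by auto
        qed
        moreover from this[of "length e'"] have "e' \<in> S" using len e' by simp
        moreover have "prefix h e'" using e(1) len e' by (auto simp: R_def)
        ultimately show ?thesis by (simp add: R_def)
      qed
      then have "\<not> H e'" using min[of e'] e' by auto
      then have ee: "entry H e = e" using entry_new[OF H(1)] e(2) e' by simp
      have eT: "e \<in> ?T" using e(1) quasi_strategyD(1)[OF S(1)] by (auto simp: R_def)
      then have eW: "e \<in> W e" using e(2) ee by (simp add: glue_def)
      have ext: "H x" "entry H x = e" if "prefix e x" for x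
        using that ee e(2) extension_closed_append[OF H(1) e(2)] entry_append[OF H(1) e(2)]
        by (auto simp: prefix_def)
      let ?S = "{x \<in> S. prefix e x}"
      have "quasi_strategy (W e) own e ?S"
      proof (rule quasi_strategyI)
        show "?S \<subseteq> W e"
          using ext quasi_strategyD(1)[OF S(1)] by (auto simp: glue_def split: if_splits)
        show "e \<in> ?S" using e(1) by (simp add: R_def)
        show "\<exists>v. g @ [v] \<in> ?S" if "g \<in> ?S" "own g" for g
          using quasi_strategyD(3)[OF S(1)] that by auto
        show "g @ [v] \<in> ?S" if g: "g \<in> ?S" "\<not> own g" "g @ [v] \<in> W e" for g v
        proof -
          have "prefix e (g @ [v])" using g(1) by simp
          then have "g @ [v] \<in> ?T" using ext g(3) by (simp add: glue_def)
          then show ?thesis using quasi_strategyD(4)[OF S(1) _ g(2)] g(1) by simp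
        qed
      qed
      moreover have "branches ?S e \<subseteq> branches S h"
      proof
        fix p assume p: "p \<in> branches ?S e"
        then have pe: "pre p (length e) = e" by (simp add: branches_def)
        have "pre p n = take n e" if "n \<le> length e" for n
          using that pe take_pre[of n p "length e"] by (simp add: min_def)
        moreover have "take (length h) e = h" using e(1) by (auto simp: R_def prefix_def)
        ultimately have "pre p (length h) = h" "\<And>n. length h \<le> n \<Longrightarrow> n \<le> length e \<Longrightarrow> pre p n \<in> S"
          using len e(1) by (auto simp: R_def)
        moreover have "pre p n \<in> S" if "n \<ge> length e" for n
          using p that by (simp add: branches_def)
        ultimately show "p \<in> branches S h"
          unfolding branches_def using nat_le_linear by blast
      qed
      ultimately have "wins_from (W e) own e A" using S(2) unfolding wins_from_def by blast
      then show False using W(3)[OF WD] eW by blast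
    next
      case False
      have "quasi_strategy N own h R"
      proof (rule quasi_strategyI)
        show "R \<subseteq> N"
          using False quasi_strategyD(1)[OF S(1)] by (auto simp: R_def glue_def split: if_splits)
        show "\<exists>v. g @ [v] \<in> R" if "g \<in> R" "own g" for g
        proof -
          have "g \<in> S" using that(1) by (simp add: R_def)
          then show ?thesis using quasi_strategyD(3)[OF S(1) _ that(2)] Rsnoc[OF that(1)] by blast
        qed
        show "g @ [v] \<in> R" if g: "g \<in> R" "\<not> own g" "g @ [v] \<in> N" for g v
        proof -
          have "\<not> H g" using False g(1) by blast
          then have "g @ [v] \<in> ?T"
            using good[OF g(3)] g(3) entry_new[OF H(1), of g v] by (auto simp: glue_def)
          then show ?thesis using quasi_strategyD(4)[OF S(1) _ g(2)] g(1) Rsnoc by (auto simp: R_def)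
        qed
      qed (use hR in auto)
      moreover have "branches R h \<subseteq> branches S h" by (auto simp: branches_def R_def)
      ultimately show False using S(2) N(2) unfolding wins_from_def by blast
    qed
  qed
  show ?thesis unfolding avoidable_def using 1 2 3 by blast
qed

text \<open>If \<open>h\<close> were not avoidable, the player could win in stages. In stage
  \<open>n\<close> they follow a strategy for \<open>A\<close> or for reaching a position in
  \<open>U n\<close> that is not avoidable; once such a position is reached, stage
  \<open>Suc n\<close> starts there. A play with a last stage is in \<open>A\<close>, and a play
  passing all stages meets every \<open>U n\<close>, so it is in \<open>B\<close>.\<close>

lemma avoidable_if_not_wins_from:
  fixes T :: "'v list set"
  assumes T: "pruned T" and h: "h \<in> T"
    and U: "\<And>n :: nat. extension_closed (U n)"
    and B: "B = {p. \<forall>n. \<exists>k. U n (pre p k)}" "B \<subseteq> A"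
    and nw: "\<not> wins_from T own h A"
  shows "avoidable T own A B h"
proof (rule ccontr)
  assume na: "\<not> avoidable T own A B h"
  let ?good = "avoidable T own A B"
  define E where "E n e = {p. \<exists>k>length e. U n (pre p k) \<and> \<not> ?good (pre p k)}" for n and e :: "'v list"
  define W where "W n e = (if wins_from T own e (A \<union> E n e)
     then SOME S. quasi_strategy T own e S \<and> branches S e \<subseteq> A \<union> E n e else {})" for n e
  have W: "quasi_strategy T own e (W n e)" "branches (W n e) e \<subseteq> A \<union> E n e"
    if "wins_from T own e (A \<union> E n e)" for n e
    using someI_ex[OF that[unfolded wins_from_def]] that unfolding W_def by simp_all
  have WI: "e \<in> W n e" if "e \<in> T" "\<not> ?good e" for n e
  proof -
    have "wins_from T own e (A \<union> E n e)"
      using avoidable_if_not_wins[OF T that(1) U[of n], of B own A] that(2) B(1)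
      unfolding E_def by blast
    then show ?thesis using W(1) quasi_strategyD(2) by blast
  qed
  have WD: "wins_from T own e (A \<union> E n e)" if "g \<in> W n e" for g n e
    using that unfolding W_def by (auto split: if_splits)
  \<comment> \<open>The state consists of the stage, of the position at which it began, and of the
    current position.\<close>
  define step where "step = (\<lambda>(n, e, c) v. let c' = c @ [v] in
     if U n c' \<and> \<not> ?good c' then (Suc n, c', c') else (n, e, c'))"
  define st where "st g = foldl step (0, h, h) (drop (length h) g)" for g
  define stage where "stage g = fst (st g)" for g
  define origin where "origin g = fst (snd (st g))" for g
  have st_h: "st h = (0, h, h)" by (simp add: st_def)
  have st_snoc: "st (g @ [v]) = step (st g) v" if "prefix h g" for g v
    using that by (auto simp: st_def prefix_def)
  have cur: "snd (snd (st g)) = g" if "prefix h g" for g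
  proof -
    obtain z where "g = h @ z" using \<open>prefix h g\<close> by (auto simp: prefix_def)
    moreover have "snd (snd (st (h @ z))) = h @ z"
    proof (induction z rule: rev_induct)
      case (snoc v z)
      have "st (h @ (z @ [v])) = step (st (h @ z)) v" using st_snoc[of "h @ z" v] by simp
      then show ?case using snoc by (auto simp: step_def Let_def split: prod.splits)
    qed (simp add: st_h)
    ultimately show ?thesis by simp
  qed
  have snoc: "stage (g @ [v]) = (if U (stage g) (g @ [v]) \<and> \<not> ?good (g @ [v]) then Suc (stage g) else stage g)"
    "origin (g @ [v]) = (if U (stage g) (g @ [v]) \<and> \<not> ?good (g @ [v]) then g @ [v] else origin g)"
    if "prefix h g" for g v
    using st_snoc[OF that, of v] cur[OF that] unfolding stage_def origin_def step_def
    by (auto simp: Let_def split: prod.splits)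
  define S where "S = {g. prefix h g \<and> g \<in> W (stage g) (origin g)}"
  have sub: "W n e \<subseteq> T" for n e
  proof
    fix g assume g: "g \<in> W n e"
    show "g \<in> T" using quasi_strategyD(1)[OF W(1)[OF WD[OF g]]] g by blast
  qed
  have child: "g @ [v] \<in> S" if "g \<in> S" "g @ [v] \<in> W (stage g) (origin g)" for g v
  proof -
    have pr: "prefix h g" "prefix h (g @ [v])" using that(1) by (simp_all add: S_def)
    have "g @ [v] \<in> T" using that(2) sub by blast
    then show ?thesis using that pr snoc[OF pr(1), of v] WI[of "g @ [v]"] by (simp add: S_def)
  qed
  have "quasi_strategy T own h S"
  proof (rule quasi_strategyI)
    show "S \<subseteq> T" using sub by (auto simp: S_def)
    show "h \<in> S" using WI[OF h na] by (simp add: S_def stage_def origin_def st_h)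
    show "\<exists>v. g @ [v] \<in> S" if g: "g \<in> S" "own g" for g
    proof -
      have gW: "g \<in> W (stage g) (origin g)" using g(1) by (simp add: S_def)
      then show ?thesis using quasi_strategyD(3)[OF W(1)[OF WD[OF gW]] gW g(2)] child[OF g(1)] by blast
    qed
    show "g @ [v] \<in> S" if g: "g \<in> S" "\<not> own g" "g @ [v] \<in> T" for g v
    proof -
      have gW: "g \<in> W (stage g) (origin g)" using g(1) by (simp add: S_def)
      then show ?thesis using quasi_strategyD(4)[OF W(1)[OF WD[OF gW]] gW g(2,3)] child[OF g(1)] by blast
    qed
  qed
  moreover have "branches S h \<subseteq> A"
  proof
    fix p assume p: "p \<in> branches S h"
    define s where "s j = stage (pre p (length h + j))" for j
    have pr: "prefix h (pre p (length h + j))" for j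
      using p prefix_pre[of "length h" "length h + j" p] by (simp add: branches_def)
    have sS: "s (Suc j) = (if U (s j) (pre p (length h + Suc j)) \<and> \<not> ?good (pre p (length h + Suc j))
        then Suc (s j) else s j)" for j
      using snoc(1)[OF pr[of j], of "p (length h + j)"] unfolding s_def by simp
    show "p \<in> A"
    proof (cases "\<forall>n. \<exists>j. s j > n")
      case True
      have "\<exists>k. U n (pre p k)" for n
      proof -
        obtain j where "s j > n" using True by blast
        moreover have "s 0 \<le> n" using p by (simp add: s_def branches_def stage_def st_h)
        ultimately obtain i where "s i \<le> n" "s (Suc i) > n"
          using ex_least_nat_less[of "\<lambda>j. n < s j" j] by (auto simp: not_less)
        then have "s i = n" "U (s i) (pre p (length h + Suc i))" using sS[of i] by (auto split: if_splits)
        then show ?thesis by blast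
      qed
      then show ?thesis using B by blast
    next
      case False
      then obtain n where n: "\<And>j. s j \<le> n" by (meson not_le)
      then have fin: "finite (range s)" by (auto simp: finite_nat_set_iff_bounded_le)
      then have "Max (range s) \<in> range s" by (intro Max_in) auto
      then obtain j where "s j = Max (range s)" by (metis imageE)
      then have j: "s i \<le> s j" for i using Max_ge[OF fin] by simp
      define e where "e = origin (pre p (length h + j))"
      have const: "s (j + i) = s j \<and> origin (pre p (length h + j + i)) = e" for i
      proof (induction i)
        case (Suc i)
        have "s (Suc (j + i)) \<le> s (j + i)" using j Suc by metis
        then have "\<not> (U (s (j + i)) (pre p (length h + Suc (j + i))) \<and> \<not> ?good (pre p (length h + Suc (j + i))))"
          using sS[of "j + i"] by (auto split: if_splits)
        then show ?case
          using Suc snoc[OF pr[of "j + i"], of "p (length h + (j + i))"] unfolding s_def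
          by (simp add: add.assoc)
      qed (simp add: e_def)
      have inW: "pre p (length h + j + i) \<in> W (s j) e" for i
      proof -
        have "pre p (length h + j + i) \<in> S" using p by (simp add: branches_def)
        then show ?thesis using const[of i] by (simp add: S_def s_def add.assoc)
      qed
      \<comment> \<open>Stage and origin do not change from the position \<open>q\<close> on at
        which the current stage began. So the play lies in the tree \<open>W (s j) e\<close> from
        \<open>e\<close> on, and not merely from the later time \<open>j\<close> on.\<close>
      define since where "since i q \<longleftrightarrow> q = pre p (length q) \<and> length h \<le> length q \<and> length q \<le> length h + i
          \<and> (\<forall>m. length q \<le> m \<longrightarrow> m \<le> length h + i \<longrightarrow> stage (pre p m) = s i \<and> origin (pre p m) = q)"
        for i q
      have since: "since i (origin (pre p (length h + i)))" for i
      proof (induction i)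
        case 0
        have "pre p (length h) = h" using p by (simp add: branches_def)
        then show ?case by (auto simp: since_def s_def origin_def st_h dest: le_antisym)
      next
        case (Suc i)
        let ?g = "pre p (length h + i)" and ?m = "length h + Suc i"
        have eq: "pre p ?m = ?g @ [p (length h + i)]" by simp
        have sm: "stage (pre p ?m) = s (Suc i)" unfolding s_def ..
        show ?case
        proof (cases "U (stage ?g) (?g @ [p (length h + i)]) \<and> \<not> ?good (?g @ [p (length h + i)])")
          case True
          then have o: "origin (pre p ?m) = pre p ?m"
            using snoc(2)[OF pr[of i]] eq by presburger
          have "m = ?m" if "?m \<le> m" "m \<le> ?m" for m using that by simp
          then show ?thesis unfolding since_def o using sm o by (auto simp del: pre_Suc add_Suc_right)
        next
          case False
          then have o: "origin (pre p ?m) = origin ?g" "s (Suc i) = s i"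
            using snoc[OF pr[of i], of "p (length h + i)"] eq sm unfolding s_def by presburger+
          have IH: "stage (pre p m) = s i \<and> origin (pre p m) = origin ?g"
            if "length (origin ?g) \<le> m" "m \<le> length h + i" for m
            using Suc that unfolding since_def by blast
          have "stage (pre p m) = s (Suc i) \<and> origin (pre p m) = origin ?g"
            if "length (origin ?g) \<le> m" "m \<le> ?m" for m
          proof (cases "m = ?m")
            case True
            then show ?thesis using o sm by blast
          next
            case False
            then have "m \<le> length h + i" using that(2) by simp
            then show ?thesis using IH[OF that(1)] o(2) by presburger
          qed
          moreover have "length (origin ?g) \<le> length h + i" using Suc unfolding since_def by blast
          then have "length (origin ?g) \<le> ?m" by simp
          ultimately show ?thesis unfolding o(1) using Suc unfolding since_def by blast
        qed
      qed
      have orig: "e = pre p (length e)" "length h \<le> length e" "length e \<le> length h + j"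
        "\<And>m. length e \<le> m \<Longrightarrow> m \<le> length h + j \<Longrightarrow> stage (pre p m) = s j \<and> origin (pre p m) = e"
        using since[of j] unfolding e_def since_def by blast+
      have "p \<in> branches (W (s j) e) e"
        unfolding branches_def
      proof (intro CollectI conjI allI impI)
        show "pre p (length e) = e" using orig(1) by simp
        fix m assume m: "m \<ge> length e"
        show "pre p m \<in> W (s j) e"
        proof (cases "m \<le> length h + j")
          case True
          then have "stage (pre p m) = s j" "origin (pre p m) = e" using orig(4) m by auto
          moreover have "pre p m \<in> S" using p orig(2) m by (auto simp: branches_def)
          ultimately show ?thesis by (simp add: S_def)
        next
          case False
          then show ?thesis using inW[of "m - (length h + j)"] by simp
        qed
      qed
      then have "p \<in> A \<union> E (s j) e" using W(2)[OF WD[OF inW[of 0]]] by blast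
      moreover have "p \<notin> E (s j) e"
      proof
        \<comment> \<open>Such a \<open>k\<close> would have started another stage.\<close>
        assume "p \<in> E (s j) e"
        then obtain k where k: "k > length e" "U (s j) (pre p k)" "\<not> ?good (pre p k)"
          by (auto simp: E_def)
        then obtain k' where k': "k = Suc k'" "k' \<ge> length e" by (cases k) auto
        have pk: "prefix h (pre p k')" using pr[of "k' - length h"] k'(2) orig(2) by simp
        have "stage (pre p m) = s j \<and> origin (pre p m) = e" if "m \<ge> length e" for m
        proof (cases "m \<le> length h + j")
          case True
          then show ?thesis using orig(4) that by blast
        next
          case False
          then show ?thesis using const[of "m - (length h + j)"] unfolding s_def by (simp add: add.assoc[symmetric])
        qed
        from this[of k'] this[of k] show False
          using snoc(1)[OF pk, of "p k'"] k k' by auto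
      qed
      ultimately show ?thesis by blast
    qed
  qed
  ultimately show False using nw unfolding wins_from_def by blast
qed

text \<open>A fusion argument. As long as the player does not win, the opponent can replace the game
  tree after the \<open>n\<close>-th move by a subtree whose branches avoid \<open>B n\<close> and
  in which the player still does not win. The trees are nested, so a play that stays in all of them
  avoids every \<open>B n\<close>.\<close>

theorem wins_from_or_opponent:
  fixes T :: "'v list set" and U :: "nat \<Rightarrow> nat \<Rightarrow> 'v list set"
  assumes T: "pruned T" and h: "h \<in> T"
    and A: "A = {p. \<exists>n. \<forall>m. \<exists>k. pre p k \<in> U n m}"
  shows "wins_from T own h A \<or> wins_from T (\<lambda>g. \<not> own g) h (- A)"
proof (subst disj_commute, rule disjCI)
  assume nw: "\<not> wins_from T own h A"
  \<comment> \<open>Closing under extensions changes no set of limits and gives the shape required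
    by \<open>avoidable_if_not_wins_from\<close>.\<close>
  define U' where "U' n m g \<longleftrightarrow> (\<exists>k. take k g \<in> U n m)" for n m g
  have U': "extension_closed (U' n m)" for n m
    unfolding extension_closed_def
  proof (intro allI impI)
    fix g v assume "U' n m g"
    then obtain k where "take k g \<in> U n m" by (auto simp: U'_def)
    then have "take (min k (length g)) (g @ [v]) \<in> U n m" by (cases "k \<le> length g") (auto simp: min_def)
    then show "U' n m (g @ [v])" unfolding U'_def by blast
  qed
  define B where "B n = {p. \<forall>m. \<exists>k. U' n m (pre p k)}" for n
  have U'_iff: "(\<exists>k. U' n m (pre p k)) \<longleftrightarrow> (\<exists>k. pre p k \<in> U n m)" for n m p
    unfolding U'_def take_pre by (metis min.idem)
  have AB: "A = (\<Union>n. B n)" unfolding A B_def U'_iff by blast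
  define next_tree where "next_tree n S g = (if avoidable S own A (B n) g
      then SOME S'. quasi_strategy S (\<lambda>g. \<not> own g) g S'
        \<and> branches S' g \<inter> B n = {} \<and> \<not> wins_from S' own g A else {})" for n S g
  have next_tree: "quasi_strategy S (\<lambda>g. \<not> own g) g (next_tree n S g)"
      "branches (next_tree n S g) g \<inter> B n = {}" "\<not> wins_from (next_tree n S g) own g A"
    if "x \<in> next_tree n S g" for x n S g
  proof -
    have "avoidable S own A (B n) g" using that unfolding next_tree_def by (auto split: if_splits)
    from someI_ex[OF this[unfolded avoidable_def]] this
    show "quasi_strategy S (\<lambda>g. \<not> own g) g (next_tree n S g)"
      "branches (next_tree n S g) g \<inter> B n = {}" "\<not> wins_from (next_tree n S g) own g A"
      unfolding next_tree_def by simp_all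
  qed
  have next_mem: "g \<in> next_tree n S g" if "pruned S" "g \<in> S" "\<not> wins_from S own g A" for n S g
  proof -
    have "avoidable S own A (B n) g"
      by (rule avoidable_if_not_wins_from[OF that(1,2) U'[of n] _ _ that(3)]) (auto simp: B_def AB)
    from someI_ex[OF this[unfolded avoidable_def]] this show ?thesis
      unfolding next_tree_def by (auto dest: quasi_strategyD(2))
  qed
  \<comment> \<open>The state holds the index of the next set to avoid, the current position and the
    current tree; at \<open>h\<close>, the set \<open>B 0\<close> has already been dealt
    with.\<close>
  define step where "step = (\<lambda>(n, c, S) v. (Suc n, c @ [v], next_tree n S (c @ [v])))"
  define st where "st g = foldl step (1, h, next_tree 0 T h) (drop (length h) g)" for g
  define Tr where "Tr g = snd (snd (st g))" for g
  have st_snoc: "st (g @ [v]) = step (st g) v" if "prefix h g" for g v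
    using that by (auto simp: st_def prefix_def)
  have st: "fst (st g) = Suc (length g - length h) \<and> fst (snd (st g)) = g" if "prefix h g" for g
  proof -
    obtain z where "g = h @ z" using \<open>prefix h g\<close> by (auto simp: prefix_def)
    moreover have "fst (st (h @ z)) = Suc (length z) \<and> fst (snd (st (h @ z))) = h @ z"
    proof (induction z rule: rev_induct)
      case (snoc v z)
      have "st (h @ (z @ [v])) = step (st (h @ z)) v" using st_snoc[of "h @ z" v] by simp
      then show ?case using snoc by (auto simp: step_def split: prod.splits)
    qed (simp add: st_def)
    ultimately show ?thesis by simp
  qed
  have Tr_h: "Tr h = next_tree 0 T h" by (simp add: Tr_def st_def)
  have Tr_snoc: "Tr (g @ [v]) = next_tree (Suc (length g - length h)) (Tr g) (g @ [v])"
    if "prefix h g" for g v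
    using st_snoc[OF that, of v] st[OF that] by (auto simp: Tr_def step_def split: prod.splits)
  define S where "S = {g. prefix h g \<and> g \<in> Tr g \<and> quasi_strategy T (\<lambda>g. \<not> own g) g (Tr g)
      \<and> \<not> wins_from (Tr g) own g A}"
  have child: "g @ [v] \<in> S" if g: "g \<in> S" "g @ [v] \<in> Tr g" "\<not> wins_from (Tr g) own (g @ [v]) A" for g v
  proof -
    have pr: "prefix h g" and qs: "quasi_strategy T (\<lambda>g. \<not> own g) g (Tr g)"
      using g(1) by (simp_all add: S_def)
    have "pruned (Tr g)" using quasi_strategy_pruned[OF T qs] .
    then have mem: "g @ [v] \<in> Tr (g @ [v])" using next_mem g(2,3) Tr_snoc[OF pr] by simp
    have "quasi_strategy (Tr g) (\<lambda>g. \<not> own g) (g @ [v]) (Tr (g @ [v]))"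
      "\<not> wins_from (Tr (g @ [v])) own (g @ [v]) A"
      using next_tree mem Tr_snoc[OF pr] by metis+
    then show ?thesis using mem pr quasi_strategy_trans[OF qs] by (simp add: S_def)
  qed
  have "quasi_strategy T (\<lambda>g. \<not> own g) h S"
  proof (rule quasi_strategyI)
    show "S \<subseteq> T"
    proof
      fix g assume "g \<in> S"
      then show "g \<in> T" using quasi_strategyD(1) unfolding S_def by blast
    qed
    have mem: "h \<in> Tr h" unfolding Tr_h using next_mem[OF T h nw] .
    have "quasi_strategy T (\<lambda>g. \<not> own g) h (Tr h)" "\<not> wins_from (Tr h) own h A"
      using next_tree mem Tr_h by metis+
    then show "h \<in> S" using mem by (simp add: S_def)
  next
    fix g assume g: "g \<in> S" "\<not> own g"
    then have "g \<in> Tr g" "\<not> wins_from (Tr g) own g A" by (simp_all add: S_def)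
    then obtain v where "g @ [v] \<in> Tr g" "\<not> wins_from (Tr g) own (g @ [v]) A"
      using wins_from_step[of g "Tr g" own A] g(2) by auto
    then show "\<exists>v. g @ [v] \<in> S" using child[OF g(1)] by blast
  next
    fix g v assume g: "g \<in> S" "\<not> \<not> own g" "g @ [v] \<in> T"
    then have gT: "g \<in> Tr g" "\<not> wins_from (Tr g) own g A"
      and qs: "quasi_strategy T (\<lambda>g. \<not> own g) g (Tr g)" by (simp_all add: S_def)
    have v: "g @ [v] \<in> Tr g" using quasi_strategyD(4)[OF qs gT(1) g(2,3)] .
    then have "\<not> wins_from (Tr g) own (g @ [v]) A"
      using wins_from_step[of g "Tr g" own A] gT g(2) by auto
    then show "g @ [v] \<in> S" using child[OF g(1) v] by blast
  qed
  moreover have "branches S h \<subseteq> - A"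
  proof
    fix p assume p: "p \<in> branches S h"
    define g where "g n = pre p (length h + n)" for n
    have gS: "g n \<in> S" for n using p by (simp add: branches_def g_def)
    have pr: "prefix h (g n)" for n using gS by (simp add: S_def)
    have g0: "g 0 = h" using p by (simp add: g_def branches_def)
    have gS': "g (Suc n) = g n @ [p (length h + n)]" for n by (simp add: g_def)
    have mem: "g n \<in> Tr (g n)" for n using gS by (simp add: S_def)
    have len: "length (g n) = length h + n" for n by (simp add: g_def)
    have TrS: "Tr (g (Suc n)) = next_tree (Suc n) (Tr (g n)) (g (Suc n))" for n
      using Tr_snoc[OF pr[of n], of "p (length h + n)"] by (simp add: gS' len)
    have sub: "Tr (g (Suc n)) \<subseteq> Tr (g n)" for n
      using next_tree(1) quasi_strategyD(1) mem[of "Suc n"] TrS[of n] by metis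
    have sub': "Tr (g m) \<subseteq> Tr (g n)" if "n \<le> m" for n m
      using that by (induction m rule: dec_induct) (use sub in blast)+
    have "p \<notin> B n" for n
    proof -
      have "branches (Tr (g n)) (g n) \<inter> B n = {}"
      proof (cases n)
        case 0
        then show ?thesis using next_tree(2) mem[of 0] Tr_h g0 by metis
      next
        case (Suc m)
        then show ?thesis using next_tree(2) mem[of "Suc m"] TrS[of m] by metis
      qed
      moreover have "p \<in> branches (Tr (g n)) (g n)"
        unfolding branches_def
      proof (intro CollectI conjI allI impI)
        show "pre p (length (g n)) = g n" by (simp add: g_def)
        fix m assume m: "length (g n) \<le> m"
        then have "pre p m = g (m - length h)" "n \<le> m - length h" using len[of n] by (simp_all add: g_def)
        then show "pre p m \<in> Tr (g n)" using mem sub' by auto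
      qed
      ultimately show ?thesis by blast
    qed
    then show "p \<in> - A" using AB by blast
  qed
  ultimately show "wins_from T (\<lambda>g. \<not> own g) h (- A)" unfolding wins_from_def by blast
qed

lemma pref_InfSeq_pre: "pref (InfSeq p) n = pre p n"
  by (simp add: pre_def)

text \<open>No length is skipped, so that prefixes of the limit are elements of the chain and
  inherit its invariants.\<close>

lemma chain_pref_in:
  assumes chain: "\<And>n. prefix (c n) (c (Suc n))" and grow: "\<And>n. length (c (Suc n)) \<le> Suc (length (c n))"
    and lim: "tends_to c s" and k: "length (c 0) \<le> k"
  shows "\<exists>n. pref s k = c n"
proof -
  have "\<exists>m. take k (c n) = c m" for n
  proof (induction n)
    case 0
    then show ?case using k by (metis take_all)
  next
    case (Suc n)
    show ?case
    proof (cases "length (c (Suc n)) \<le> k")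
      case False
      then have "k \<le> length (c n)" using grow[of n] by simp
      then have "take k (c (Suc n)) = take k (c n)" using prefix_take[OF chain] by blast
      then show ?thesis using Suc by simp
    qed (metis take_all)
  qed
  then show ?thesis using lim unfolding tends_to_def by (metis order_refl)
qed

text \<open>The partial plays that agree with one strategy form a prefix closed tree, so it suffices
  to turn the tree into a strategy and back.\<close>

lemma tree_core:
  assumes "tree G P S"
  shows "\<exists>S'. tree G P S' \<and> prefix_closed S' \<and> (\<forall>p. play G p \<and> follows S' p \<longrightarrow> follows S p)"
  using tree_strategy[OF assms] strategy_tree by metis

lemma ensuresI:
  assumes "tree G P S" "\<And>p. play G p \<Longrightarrow> follows S p \<Longrightarrow> secures P t (payoff G f p)"
  shows "ensures G P f t"
  using tree_core[OF assms(1)] assms(2) unfolding ensures_def by metis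

lemma play_progress:
  assumes "play G p" "(last (pref p (Suc n)), v) \<in> edges G"
  shows "\<exists>v. pref p (Suc (Suc n)) = pref p (Suc n) @ [v] \<and> (last (pref p (Suc n)), v) \<in> edges G"
proof (rule ccontr)
  assume no: "\<not> ?thesis"
  then have eq: "pref p (Suc (Suc n)) = pref p (Suc n)" using play_pref_Suc[OF assms(1)] by blast
  show False
  proof (cases p)
    case (FinSeq h)
    have "length (take (Suc (Suc n)) h) = length (take (Suc n) h)" using eq FinSeq by simp
    then have "length h \<le> Suc n" by auto
    then show False using assms FinSeq by simp
  next
    case (InfSeq q)
    then have "length (pref p (Suc (Suc n))) \<noteq> length (pref p (Suc n))" by simp
    then show False using eq by metis
  qed
qed

section \<open>Letter games\<close>

lemma letter_game_simps [simp]: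
  "init_pos (letter_game P A) = LState (start A)"
  "edges (letter_game P A) = {(s, s'). letter_edge A s s'}"
  "edge_label (letter_game P A) = letter_label"
  "positions (letter_game P A) = UNIV"
  by (simp_all add: letter_game_def)

inductive_simps letter_edge_LState: "letter_edge A (LState q) s"
inductive_simps letter_edge_LChoice: "letter_edge A (LChoice a \<phi>) s"
inductive_simps resolve_Atom [simp]: "resolve (Atom x) \<psi>"
inductive_simps resolve_Or [simp]: "resolve (Or \<phi> \<psi>) \<theta>"
inductive_simps resolve_And [simp]: "resolve (And \<phi> \<psi>) \<theta>"

lemma resolve_size: "resolve \<phi> \<psi> \<Longrightarrow> size \<psi> < size \<phi>"
  by (induction rule: resolve.induct) auto

lemma letter_label_LChoice [simp]: "letter_label (LChoice a \<phi>, LChoice b \<psi>) = None"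
  by (cases \<phi>) auto

lemma weight_label_Choice [simp]: "weight_label (Choice v \<phi>, Choice v' \<psi>) = None"
  by (cases \<phi>) auto

lemma letter_owned [simp]:
  "LState q \<in> owned (letter_game P' A) P \<longleftrightarrow> P = P'"
  "LChoice a (Or \<phi> \<psi>) \<in> owned (letter_game P' A) P \<longleftrightarrow> P = Eve"
  "LChoice a (And \<phi> \<psi>) \<in> owned (letter_game P' A) P \<longleftrightarrow> P = Adam"
  "LChoice a (Atom x) \<in> owned (letter_game P' A) P \<longleftrightarrow> P = Adam"
  by (cases P; cases P'; auto simp: letter_game_def)+

lemma wf_letter_game [simp]: "wf_arena (letter_game P A)"
  by (simp add: wf_arena_def)

lemma letter_edge_ex: "\<exists>s'. letter_edge A s s'"
proof (cases s)
  case (LState q)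
  then show ?thesis by (auto simp: letter_edge_LState)
next
  case (LChoice a \<phi>)
  then show ?thesis by (cases \<phi>) (auto simp: letter_edge_LChoice)
qed

lemma letter_tree_Or:
  assumes "tree (letter_game P' A) P S" "l \<in> S" "last l = LChoice a (Or \<phi> \<psi>)"
  shows "if P = Eve then l @ [LChoice a \<phi>] \<in> S \<or> l @ [LChoice a \<psi>] \<in> S
      else l @ [LChoice a \<phi>] \<in> S \<and> l @ [LChoice a \<psi>] \<in> S"
  by (rule tree_choice[OF assms(1,2)], simp only: assms(3) letter_owned)
    (auto simp: assms(3) letter_edge_LChoice)

lemma letter_tree_And:
  assumes "tree (letter_game P' A) P S" "l \<in> S" "last l = LChoice a (And \<phi> \<psi>)"
  shows "if P = Adam then l @ [LChoice a \<phi>] \<in> S \<or> l @ [LChoice a \<psi>] \<in> S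
      else l @ [LChoice a \<phi>] \<in> S \<and> l @ [LChoice a \<psi>] \<in> S"
  by (rule tree_choice[OF assms(1,2)], simp only: assms(3) letter_owned)
    (auto simp: assms(3) letter_edge_LChoice)

lemma letter_tree_Atom:
  assumes "tree (letter_game P' A) P S" "l \<in> S" "last l = LChoice a (Atom (x, q))"
  shows "l @ [LState q] \<in> S"
proof -
  have "(last l, LState q) \<in> edges (letter_game P' A)"
    using assms(3) by (simp add: letter_edge_LChoice)
  then obtain s where "l @ [s] \<in> S" using tree_ext[OF assms(1,2)] by blast
  moreover have "l \<noteq> []" using partial_play_nonempty[OF tree_partial_play[OF assms(1,2)]] .
  ultimately have "letter_edge A (LChoice a (Atom (x, q))) s"
    using tree_partial_play[OF assms(1), of "l @ [s]"] partial_play_snoc[of l "letter_game P' A" s] assms(3)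
    by simp
  then show ?thesis using \<open>l @ [s] \<in> S\<close> by (auto simp: letter_edge_LChoice)
qed

text \<open>Resolving makes the formula smaller, so a play cannot stay at \<open>LChoice\<close>
  positions for ever.\<close>

lemma letter_play_LState:
  assumes "play (letter_game P A) p"
  shows "\<exists>m\<ge>n. \<exists>q. last (pref p (Suc m)) = LState q"
proof -
  have "\<exists>m\<ge>n. \<exists>q. last (pref p (Suc m)) = LState q" if "last (pref p (Suc n)) = LChoice a \<phi>" for n a \<phi>
    using that
  proof (induction \<phi> arbitrary: n rule: measure_induct_rule[of size])
    case (less \<phi>)
    obtain s where "letter_edge A (last (pref p (Suc n))) s" using letter_edge_ex by blast
    then obtain s where s: "pref p (Suc (Suc n)) = pref p (Suc n) @ [s]" "letter_edge A (LChoice a \<phi>) s"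
      using play_progress[OF assms, of n s] less.prems by auto
    have last: "last (pref p (Suc (Suc n))) = s" using s(1) by simp
    from s(2) consider \<psi> where "s = LChoice a \<psi>" "resolve \<phi> \<psi>" | q where "s = LState q"
      by (auto simp: letter_edge_LChoice)
    then show ?case
    proof cases
      case 1
      then show ?thesis using less.IH[of \<psi> "Suc n"] resolve_size last Suc_leD by blast
    next
      case 2
      then show ?thesis using last by (intro exI[of _ "Suc n"]) simp
    qed
  qed
  then show ?thesis by (cases "last (pref p (Suc n))") (auto intro: exI[of _ n])
qed

lemma length_letter_labs:
  assumes "play (letter_game P A) p"
  shows "\<exists>n. k \<le> length (labs (letter_game P A) (pref p (Suc n)))"
proof (induction k)
  case (Suc k)
  let ?L = "letter_game P A"
  obtain n where n: "k \<le> length (labs ?L (pref p (Suc n)))" using Suc by blast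
  obtain m q where m: "m \<ge> n" "last (pref p (Suc m)) = LState q"
    using letter_play_LState[OF assms] by blast
  have ne: "pref p (Suc i) \<noteq> []" for i using play_pref[OF assms] partial_play_nonempty by blast
  obtain s where s: "pref p (Suc (Suc m)) = pref p (Suc m) @ [s]" "letter_edge A (LState q) s"
    using play_progress[OF assms, of m] letter_edge_ex[of A "LState q"] m by fastforce
  define len where "len i = length (labs ?L (pref p (Suc i)))" for i
  have mono: "len i \<le> len j" if "i \<le> j" for i j
    unfolding len_def using that by (intro prefix_length_le labs_prefix prefix_pref_le) simp
  \<comment> \<open>By induction on the size of the formula: the resolution ends in an atom, and
    leaving that outputs a label.\<close>
  have grow: "\<exists>j>i. len i < len j" if "last (pref p (Suc i)) = LChoice a \<phi>" for i a \<phi>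
    using that
  proof (induction \<phi> arbitrary: i rule: measure_induct_rule[of size])
    case (less \<phi>)
    obtain s where "letter_edge A (last (pref p (Suc i))) s" using letter_edge_ex by blast
    then obtain s where s: "pref p (Suc (Suc i)) = pref p (Suc i) @ [s]" "letter_edge A (LChoice a \<phi>) s"
      using play_progress[OF assms, of i s] less.prems by auto
    have last: "last (pref p (Suc (Suc i))) = s" using s(1) by simp
    from s(2) consider \<psi> where "s = LChoice a \<psi>" "resolve \<phi> \<psi>"
      | x q where "\<phi> = Atom (x, q)" "s = LState q" by (auto simp: letter_edge_LChoice)
    then show ?case
    proof cases
      case 1
      then obtain j where "j > Suc i" "len (Suc i) < len j"
        using less.IH[OF resolve_size[OF 1(2)], of "Suc i"] last by auto
      then show ?thesis using mono[of i "Suc i"] by (intro exI[of _ j]) simp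
    next
      case 2
      have "labs ?L (pref p (Suc (Suc i))) = labs ?L (pref p (Suc i)) @ [(a, x)]"
        unfolding s(1) labs_snoc[OF ne] using less.prems 2 by simp
      then show ?thesis by (intro exI[of _ "Suc i"]) (simp add: len_def)
    qed
  qed
  have "last (pref p (Suc (Suc m))) = s" using s(1) by simp
  then obtain j where "len (Suc m) < len j"
    using s(2) grow[of "Suc m"] unfolding letter_edge_LState by blast
  moreover have "len n \<le> len (Suc m)" using m(1) by (intro mono) simp
  ultimately have "Suc k \<le> len j" using n unfolding len_def by simp
  then show ?case unfolding len_def by blast
qed simp

lemma letter_play_InfSeq:
  assumes "play (letter_game P A) p"
  obtains q s where "p = InfSeq q" "out_word (letter_game P A) p = InfSeq s"
    "\<And>n. labs (letter_game P A) (pre q (Suc n)) = pre s (length (labs (letter_game P A) (pre q (Suc n))))"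
proof -
  let ?L = "letter_game P A"
  have no: False if "play ?L (FinSeq h)" for h using that letter_edge_ex[of A "last h"] by auto
  then obtain q where q: "p = InfSeq q" using assms by (cases p) auto
  have lim: "tends_to (\<lambda>n. labs ?L (pref p (Suc n))) (out_word ?L p)" by (rule tends_to_out_word)
  have chain: "prefix (labs ?L (pref p (Suc n))) (labs ?L (pref p (Suc (Suc n))))" for n
    by (intro labs_prefix prefix_pref)
  obtain s where s: "out_word ?L p = InfSeq s"
  proof (cases "out_word ?L p")
    case (FinSeq u)
    then obtain N where N: "\<And>n. n \<ge> N \<Longrightarrow> labs ?L (pref p (Suc n)) = u"
      using tends_to_FinSeq lim by metis
    obtain n where n: "Suc (length u) \<le> length (labs ?L (pref p (Suc n)))"
      using length_letter_labs[OF assms] by blast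
    have "prefix (pref p (Suc n)) (pref p (Suc (max n N)))" by (rule prefix_pref_le) simp
    then have "prefix (labs ?L (pref p (Suc n))) u"
      using labs_prefix N[of "max n N"] by (metis max.cobounded2)
    then show ?thesis using n prefix_length_le by fastforce
  qed auto
  have "labs ?L (pref p (Suc n)) = pref (InfSeq s) (length (labs ?L (pref p (Suc n))))" for n
    using chain_eq_pref[OF chain lim] unfolding s .
  then show thesis using that[OF q s] unfolding q pref_InfSeq_pre by blast
qed

section \<open>Product games\<close>

text \<open>A \<open>State\<close> is reached both by an edge without a letter and at the end of a
  resolution. Whether the letter component is at an \<open>LState\<close> tells which of these has
  happened.\<close>

fun proj_step ::
    "('v, 'a) arena \<Rightarrow> 'v list \<times> ('a, 'q) lpos list \<Rightarrow> ('v, 'q) pos \<Rightarrow> 'v list \<times> ('a, 'q) lpos list" where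
  "proj_step G (g, l) (State v q) =
     (case last l of LState _ \<Rightarrow> (g @ [v], l) | LChoice a \<phi> \<Rightarrow> (g, l @ [LState q]))"
| "proj_step G (g, l) (Choice v \<phi>) =
     (case last l of LState _ \<Rightarrow> (g @ [v], l @ [LChoice (the (edge_label G (last g, v))) \<phi>])
      | LChoice a _ \<Rightarrow> (g, l @ [LChoice a \<phi>]))"

text \<open>A partial play of the product game consists of one of the game and one of the letter game.\<close>

definition proj ::
    "('v, 'a) arena \<Rightarrow> ('a, 'q) automaton \<Rightarrow> ('v, 'q) pos list \<Rightarrow> 'v list \<times> ('a, 'q) lpos list" where
  "proj G A h = foldl (proj_step G) ([init_pos G], [LState (start A)]) (tl h)"

lemma proj_singleton [simp]: "proj G A [s] = ([init_pos G], [LState (start A)])"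
  by (simp add: proj_def)

lemma proj_snoc: "h \<noteq> [] \<Longrightarrow> proj G A (h @ [s]) = proj_step G (proj G A h) s"
  by (simp add: proj_def)

lemma product_simps [simp]:
  "init_pos (product G A) = State (init_pos G) (start A)"
  "edges (product G A) = {(s, s'). product_edge G A s s'}"
  "edge_label (product G A) = weight_label"
  by (simp_all add: product_def)

text \<open>During a resolution, the game is one letter ahead of the letter game, which outputs its
  letter only along with the weight.\<close>

definition synced ::
    "('v, 'a) arena \<Rightarrow> ('a, 'q) automaton \<Rightarrow> player \<Rightarrow> ('v, 'q) pos list \<Rightarrow> 'v list \<times> ('a, 'q) lpos list \<Rightarrow> bool" where
  "synced G A P h gl \<longleftrightarrow> (let (g, l) = gl in
     partial_play G g \<and> partial_play (letter_game P A) l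
     \<and> labs (product G A) h = map snd (labs (letter_game P A) l)
     \<and> (case last h of
          State v q \<Rightarrow> last g = v \<and> last l = LState q \<and> labs G g = map fst (labs (letter_game P A) l)
        | Choice v \<phi> \<Rightarrow> \<exists>a. last g = v \<and> last l = LChoice a \<phi>
            \<and> labs G g = map fst (labs (letter_game P A) l) @ [a]))"

lemma synced_proj: "partial_play (product G A) h \<Longrightarrow> synced G A P h (proj G A h)"
proof (induction h rule: rev_induct)
  case (snoc s h)
  show ?case
  proof (cases "h = []")
    case True
    then show ?thesis using snoc.prems by (simp add: synced_def)
  next
    case False
    have pp: "partial_play (product G A) h" and edge: "product_edge G A (last h) s"
      using snoc.prems partial_play_snoc[OF False, of "product G A"] by auto
    obtain g l where gl: "proj G A h = (g, l)" by (metis surj_pair)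
    have IH: "synced G A P h (g, l)" using snoc.IH[OF pp] gl by simp
    then have ne: "g \<noteq> []" "l \<noteq> []" using partial_play_nonempty by (auto simp: synced_def)
    note simps = synced_def proj_snoc[OF False] gl labs_snoc[OF False] labs_snoc[OF ne(1)]
      labs_snoc[OF ne(2)] partial_play_snoc[OF ne(1)] partial_play_snoc[OF ne(2)]
    from edge show ?thesis
    proof cases
      case (1 v v' q)
      then show ?thesis using IH by (simp add: simps)
    next
      case (2 v v' a q)
      then show ?thesis using IH by (simp add: simps letter_edge_LState) 
    next
      case (3 v \<phi> \<psi>)
      then show ?thesis using IH by (auto simp: simps letter_edge_LChoice)
    next
      case (4 v x q)
      then show ?thesis using IH by (auto simp: simps letter_edge_LChoice)
    qed
  qed
qed (simp add: partial_play_def)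

lemma wf_product: "wf_arena G \<Longrightarrow> wf_arena (product G A)"
  unfolding wf_arena_def product_def by (auto elim!: product_edge.cases)

lemma product_owned:
  assumes "wf_arena G" "v \<in> positions G"
  shows "State v q \<in> owned (product G A) P \<longleftrightarrow> v \<in> owned G P"
    "Choice v (Or \<phi> \<psi>) \<in> owned (product G A) P \<longleftrightarrow> P = Eve"
    "Choice v (And \<phi> \<psi>) \<in> owned (product G A) P \<longleftrightarrow> P = Adam"
    "Choice v (Atom x) \<in> owned (product G A) P \<longleftrightarrow> P = Adam"
  using assms by (cases P; auto simp: product_def wf_arena_def)+

lemma proj_step_grow:
  "prefix (fst gl) (fst (proj_step G gl s))" "prefix (snd gl) (snd (proj_step G gl s))"
  "length (fst (proj_step G gl s)) \<le> Suc (length (fst gl))"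
  "length (snd (proj_step G gl s)) \<le> Suc (length (snd gl))"
  by (cases gl; cases s; auto split: lpos.split)+

inductive_simps product_edge_Choice: "product_edge G A (Choice v \<phi>) s"

lemma product_edge_Choice_ex: "v \<in> positions G \<Longrightarrow> \<exists>s. product_edge G A (Choice v \<phi>) s"
  by (cases \<phi>) (auto simp: product_edge_Choice)

lemma product_Choice_positions:
  assumes "wf_arena G" "partial_play (product G A) h" "last h = Choice v \<phi>"
  shows "v \<in> positions G"
  using partial_play_positions[OF wf_product[OF assms(1)] assms(2)] assms(3)
  by (auto simp: product_def)

lemma product_play_State:
  assumes wf: "wf_arena G" and p: "play (product G A) p"
  shows "\<exists>m\<ge>n. \<exists>v q. last (pref p (Suc m)) = State v q"
proof -
  have "\<exists>m\<ge>n. \<exists>v q. last (pref p (Suc m)) = State v q"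
    if "last (pref p (Suc n)) = Choice v \<phi>" for n v \<phi>
    using that
  proof (induction \<phi> arbitrary: n rule: measure_induct_rule[of size])
    case (less \<phi>)
    have "v \<in> positions G" using product_Choice_positions[OF wf play_pref[OF p] less.prems] .
    then obtain s where "product_edge G A (Choice v \<phi>) s"
      using product_edge_Choice_ex[of v G A \<phi>] by auto
    then obtain s where s: "pref p (Suc (Suc n)) = pref p (Suc n) @ [s]" "product_edge G A (Choice v \<phi>) s"
      using play_progress[OF p, of n s] less.prems by auto
    have last: "last (pref p (Suc (Suc n))) = s" using s(1) by simp
    from s(2) consider \<psi> where "s = Choice v \<psi>" "resolve \<phi> \<psi>" | q where "s = State v q"
      by (auto simp: product_edge_Choice)
    then show ?case
    proof cases
      case 1
      then show ?thesis using less.IH[of \<psi> "Suc n"] resolve_size last Suc_leD by blast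
    next
      case 2
      then show ?thesis using last by (intro exI[of _ "Suc n"]) simp
    qed
  qed
  then show ?thesis by (cases "last (pref p (Suc n))") (auto intro: exI[of _ n])
qed

lemma play_start: "play G p \<Longrightarrow> pref p (Suc 0) = [init_pos G]"
  by (cases p) (auto simp: partial_play_def take_Suc)

text \<open>The game component grows with each move at a \<open>State\<close>, so its limit is a
  play. The letter component comes to a halt if only edges without letters remain; the output is
  then read off at any late visit to an \<open>LState\<close>.\<close>

lemma product_play_projections:
  fixes G :: "('v, 'a) arena" and A :: "('a, 'q) automaton" and P :: player
  assumes wf: "wf_arena G" and p: "play (product G A) p"
  defines "g \<equiv> \<lambda>n. fst (proj G A (pref p (Suc n)))"
    and "l \<equiv> \<lambda>n. snd (proj G A (pref p (Suc n)))"
    and "L \<equiv> letter_game P A"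
  obtains r where "play G r" "tends_to g r" "\<And>m. \<exists>n. pref r (Suc m) = g n"
    "\<And>N. \<exists>n\<ge>N. \<exists>q. last (l n) = LState q"
    "\<And>w. out_word G r = InfSeq w \<Longrightarrow> \<exists>q s. play L (InfSeq q) \<and> (\<forall>m. \<exists>n. pref (InfSeq q) (Suc m) = l n)
       \<and> out_word L (InfSeq q) = InfSeq s \<and> w = fst \<circ> s \<and> out_word (product G A) p = InfSeq (snd \<circ> s)"
    "\<And>u. out_word G r = FinSeq u \<Longrightarrow> \<exists>N. \<forall>n\<ge>N. \<forall>q. last (l n) = LState q \<longrightarrow>
       u = map fst (labs L (l n)) \<and> out_word (product G A) p = FinSeq (map snd (labs L (l n)))"
proof -
  let ?W = "product G A"
  have pp: "partial_play ?W (pref p (Suc n))" for n using play_pref[OF p] .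
  have ne: "pref p (Suc n) \<noteq> []" for n using partial_play_nonempty[OF pp] .
  have step: "proj G A (pref p (Suc (Suc n))) = proj G A (pref p (Suc n))
      \<or> (\<exists>s. proj G A (pref p (Suc (Suc n))) = proj_step G (proj G A (pref p (Suc n))) s)" for n
    using play_pref_Suc[OF p, of n] proj_snoc[OF ne[of n]] by metis
  have g: "prefix (g n) (g (Suc n))" "length (g (Suc n)) \<le> Suc (length (g n))" for n
    using step[of n] proj_step_grow[where gl = "proj G A (pref p (Suc n))" and G = G] unfolding g_def by auto
  have l: "prefix (l n) (l (Suc n))" "length (l (Suc n)) \<le> Suc (length (l n))" for n
    using step[of n] proj_step_grow[where gl = "proj G A (pref p (Suc n))" and G = G] unfolding l_def by auto
  have gl0: "g 0 = [init_pos G]" "l 0 = [LState (start A)]"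
    using play_start[OF p] unfolding g_def l_def by simp_all
  have sync: "synced G A P (pref p (Suc n)) (g n, l n)" for n
    using synced_proj[OF pp, of P n] unfolding g_def l_def by simp
  have gl: "partial_play G (g n)" "partial_play L (l n)" "g n \<noteq> []" "l n \<noteq> []"
    "labs ?W (pref p (Suc n)) = map snd (labs L (l n))"
    "prefix (map fst (labs L (l n))) (labs G (g n))"
    "length (labs G (g n)) \<le> Suc (length (labs L (l n)))" for n
    using sync[of n] partial_play_nonempty unfolding synced_def L_def by (auto split: pos.splits)
  have lstate: "labs G (g n) = map fst (labs L (l n))" if "last (l n) = LState q" for n q
    using sync[of n] that unfolding synced_def L_def by (auto split: pos.splits)
  have state: "last (g n) = v" "last (l n) = LState q" "labs G (g n) = map fst (labs L (l n))"
    if "last (pref p (Suc n)) = State v q" for n v q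
    using sync[of n] that unfolding synced_def L_def by auto
  obtain r where r: "tends_to g r" using chain_limit[of g, OF g(1)] by blast
  have r_pref: "\<exists>n. pref r (Suc m) = g n" for m
    using chain_pref_in[of g, OF g r] gl0 by simp
  have play_r: "play G r"
  proof (cases r)
    case (FinSeq u)
    then obtain N where N: "\<And>n. n \<ge> N \<Longrightarrow> g n = u" using tends_to_FinSeq r by metis
    obtain n v q where n: "n \<ge> N" "last (pref p (Suc n)) = State v q"
      using product_play_State[OF wf p] by blast
    have "(v, v') \<notin> edges G" for v'
    proof
      \<comment> \<open>Such an edge would let the product play, and with it the game component,
        continue beyond \<open>N\<close>.\<close>
      assume e: "(v, v') \<in> edges G"
      have "\<exists>s. product_edge G A (State v q) s"
        using product_edge.intros(1)[OF e, of A q] product_edge.intros(2)[OF e, of _ A q]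
        by (cases "edge_label G (v, v')") auto
      then obtain s where s: "pref p (Suc (Suc n)) = pref p (Suc n) @ [s]"
        using play_progress[OF p, of n] n(2) by auto
      have "length (g (Suc n)) = Suc (length (g n))"
        using state(2)[OF n(2)] proj_snoc[OF ne[of n], of G A s]
        unfolding g_def l_def s by (cases "proj G A (pref p (Suc n))"; cases s) auto
      then show False using N[of n] N[of "Suc n"] n(1) by simp
    qed
    then show ?thesis using FinSeq N[OF n(1)] gl(1)[of n] state(1)[OF n(2)] by simp
  next
    case (InfSeq q)
    have "partial_play G (map q [0..<Suc n])" for n
      using r_pref[of n] gl(1) InfSeq by (metis pref.simps(2))
    then show ?thesis using InfSeq play_InfSeq_iff by blast
  qed
  have lim_g: "tends_to (\<lambda>n. labs G (g n)) (out_word G r)"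
    using tends_to_labs[of g, OF g(1) r gl(3)] .
  have lim_p: "tends_to (\<lambda>n. map snd (labs L (l n))) (out_word ?W p)"
    using tends_to_out_word[of ?W p] gl(5) by simp
  have chain_l: "prefix (labs L (l n)) (labs L (l (Suc n)))" for n using labs_prefix[OF l(1)] .
  have inf: "\<exists>q s. play L (InfSeq q) \<and> (\<forall>m. \<exists>n. pref (InfSeq q) (Suc m) = l n)
       \<and> out_word L (InfSeq q) = InfSeq s \<and> w = fst \<circ> s \<and> out_word ?W p = InfSeq (snd \<circ> s)"
    if w: "out_word G r = InfSeq w" for w
  proof -
    \<comment> \<open>The letter component is at most one letter behind the game component.\<close>
    have unb: "\<exists>N. \<forall>n\<ge>N. k \<le> length (labs L (l n))" for k
    proof -
      obtain N where "\<And>n. n \<ge> N \<Longrightarrow> Suc k \<le> length (labs G (g n))"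
        using tends_to_InfSeq lim_g w by metis
      then show ?thesis using gl(7) by (meson Suc_le_mono le_trans)
    qed
    obtain lr where lr: "tends_to l lr" using chain_limit[of l, OF l(1)] by blast
    have lim_l: "tends_to (\<lambda>n. labs L (l n)) (out_word L lr)"
      using tends_to_labs[of l, OF l(1) lr gl(4)] .
    obtain s where s: "out_word L lr = InfSeq s"
    proof (cases "out_word L lr")
      case (FinSeq u)
      then obtain N where N: "\<And>n. n \<ge> N \<Longrightarrow> labs L (l n) = u" using tends_to_FinSeq lim_l by metis
      obtain N' where "\<And>n. n \<ge> N' \<Longrightarrow> Suc (length u) \<le> length (labs L (l n))" using unb by blast
      from this[of "max N N'"] N[of "max N N'"] show ?thesis by simp
    qed auto
    obtain q where q: "lr = InfSeq q"
    proof (cases lr)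
      case (FinSeq u)
      then show ?thesis using s by (simp add: out_word_def)
    qed auto
    have l_pref: "\<exists>n. pref lr (Suc m) = l n" for m
      using chain_pref_in[of l, OF l lr] gl0 by simp
    have "partial_play L (map q [0..<Suc n])" for n
      using l_pref[of n] gl(2) q by (metis pref.simps(2))
    then have "play L (InfSeq q)" using play_InfSeq_iff by blast
    moreover have "out_word ?W p = InfSeq (snd \<circ> s)"
      using tends_to_unique[OF lim_p tends_to_map[OF lim_l]] s by simp
    moreover have "w = fst \<circ> s"
    proof -
      have 1: "tends_to (\<lambda>n. map fst (labs L (l n))) (InfSeq (fst \<circ> s))"
        using tends_to_map[OF lim_l, of fst] s by simp
      have "tends_to (\<lambda>n. map fst (labs L (l n))) (out_word G r)"
        unfolding tends_to_def
      proof
        fix k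
        obtain N where N: "\<And>n. n \<ge> N \<Longrightarrow> take k (labs G (g n)) = pref (out_word G r) k"
          using lim_g unfolding tends_to_def by blast
        obtain N' where N': "\<And>n. n \<ge> N' \<Longrightarrow> k \<le> length (labs L (l n))" using unb by blast
        have "take k (map fst (labs L (l n))) = pref (out_word G r) k" if "n \<ge> max N N'" for n
          using N[of n] N'[of n] that prefix_take[OF gl(6)[of n], of k] by simp
        then show "\<exists>N. \<forall>n\<ge>N. take k (map fst (labs L (l n))) = pref (out_word G r) k" by blast
      qed
      from tends_to_unique[OF 1 this] w show ?thesis by simp
    qed
    ultimately show ?thesis using l_pref s q by blast
  qed
  have fin: "\<exists>N. \<forall>n\<ge>N. \<forall>q. last (l n) = LState q \<longrightarrow>
       u = map fst (labs L (l n)) \<and> out_word ?W p = FinSeq (map snd (labs L (l n)))"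
    if u: "out_word G r = FinSeq u" for u
  proof -
    obtain N where N: "\<And>n. n \<ge> N \<Longrightarrow> labs G (g n) = u" using tends_to_FinSeq lim_g u by metis
    have "u = map fst (labs L (l n)) \<and> out_word ?W p = FinSeq (map snd (labs L (l n)))"
      if n: "n \<ge> N" "last (l n) = LState q" for n q
    proof -
      have un: "u = map fst (labs L (l n))" using lstate[OF n(2)] N[OF n(1)] by simp
      have stable: "labs L (l m) = labs L (l n)" if "m \<ge> n" for m
      proof -
        have "prefix (labs L (l n)) (labs L (l m))"
          using chain_prefix[of "\<lambda>n. labs L (l n)", OF chain_l that] .
        moreover have "length (labs L (l m)) \<le> length (labs L (l n))"
          using prefix_length_le[OF gl(6)[of m]] N[of m] n(1) that un by simp
        ultimately show ?thesis by (metis prefix_length_prefix prefix_order.antisym prefix_order.refl)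
      qed
      have "tends_to (\<lambda>m. map snd (labs L (l m))) (FinSeq (map snd (labs L (l n))))"
        by (rule tends_to_FinSeqI[of n]) (rule arg_cong[of _ _ "map snd", OF stable])
      from tends_to_unique[OF lim_p this] show ?thesis using un by blast
    qed
    then show ?thesis by blast
  qed
  have rec: "\<exists>n\<ge>N. \<exists>q. last (l n) = LState q" for N
    using product_play_State[OF wf p] state(2) by meson
  show thesis by (rule that[OF play_r r r_pref rec inf fin])
qed

text \<open>The invariant \<open>R\<close> couples the two components. In
  \<open>product_ensures\<close> it is membership in two separate trees; in
  \<open>word_arena_product\<close> it ties the position of the game to the word of the letter
  play.\<close>

lemma product_tree:
  fixes G :: "('v, 'a) arena" and A :: "('a, 'q) automaton"
  assumes wf: "wf_arena G" and init: "R [init_pos G] [LState (start A)]"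
    and own: "\<And>g l q v. R g l \<Longrightarrow> last l = LState q \<Longrightarrow> last g \<in> owned G P \<Longrightarrow> (last g, v) \<in> edges G
      \<Longrightarrow> \<exists>v. (last g, v) \<in> edges G \<and> (case edge_label G (last g, v) of
            None \<Rightarrow> R (g @ [v]) l | Some a \<Rightarrow> R (g @ [v]) (l @ [LChoice a (delta A q a)]))"
    and other: "\<And>g l q v. R g l \<Longrightarrow> last l = LState q \<Longrightarrow> last g \<notin> owned G P \<Longrightarrow> (last g, v) \<in> edges G
      \<Longrightarrow> (case edge_label G (last g, v) of
            None \<Rightarrow> R (g @ [v]) l | Some a \<Rightarrow> R (g @ [v]) (l @ [LChoice a (delta A q a)]))"
    and Or: "\<And>g l a \<phi> \<psi>. R g l \<Longrightarrow> last l = LChoice a (Or \<phi> \<psi>) \<Longrightarrow>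
      if P = Eve then R g (l @ [LChoice a \<phi>]) \<or> R g (l @ [LChoice a \<psi>])
      else R g (l @ [LChoice a \<phi>]) \<and> R g (l @ [LChoice a \<psi>])"
    and And: "\<And>g l a \<phi> \<psi>. R g l \<Longrightarrow> last l = LChoice a (And \<phi> \<psi>) \<Longrightarrow>
      if P = Adam then R g (l @ [LChoice a \<phi>]) \<or> R g (l @ [LChoice a \<psi>])
      else R g (l @ [LChoice a \<phi>]) \<and> R g (l @ [LChoice a \<psi>])"
    and Atom: "\<And>g l a x q. R g l \<Longrightarrow> last l = LChoice a (Atom (x, q)) \<Longrightarrow> R g (l @ [LState q])"
  shows "tree (product G A) P
    {h. partial_play (product G A) h \<and> R (fst (proj G A h)) (snd (proj G A h))}" (is "tree ?W P ?S")
  unfolding tree_def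
proof (intro conjI ballI)
  show "[init_pos ?W] \<in> ?S" using init by simp
  fix h assume h: "h \<in> ?S"
  then show pp: "partial_play ?W h" by simp
  then have ne: "h \<noteq> []" by (rule partial_play_nonempty)
  obtain g l where gl: "proj G A h = (g, l)" by (metis surj_pair)
  have R: "R g l" using h gl by simp
  have sync: "synced G A P h (g, l)" using synced_proj[OF pp] gl by simp
  have pos: "last h \<in> positions ?W" using partial_play_positions[OF wf_product[OF wf] pp] .
  have ext: "h @ [s] \<in> ?S \<longleftrightarrow> product_edge G A (last h) s
      \<and> R (fst (proj_step G (g, l) s)) (snd (proj_step G (g, l) s))" for s
    using pp partial_play_snoc[OF ne, of ?W s] proj_snoc[OF ne, of G A s] gl by auto
  show "if last h \<in> owned ?W P
        then (\<exists>v. (last h, v) \<in> edges ?W) \<longrightarrow> (\<exists>v. (last h, v) \<in> edges ?W \<and> h @ [v] \<in> ?S)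
        else \<forall>v. (last h, v) \<in> edges ?W \<longrightarrow> h @ [v] \<in> ?S"
  proof (cases "last h")
    case (State v q)
    have v: "last g = v" "last l = LState q" using sync State by (auto simp: synced_def)
    have vG: "v \<in> positions G" using pos State by (auto simp: product_def)
    let ?ok = "\<lambda>v'. case edge_label G (v, v') of
            None \<Rightarrow> R (g @ [v']) l | Some a \<Rightarrow> R (g @ [v']) (l @ [LChoice a (delta A q a)])"
    have succ: "\<exists>s. product_edge G A (State v q) s \<and> h @ [s] \<in> ?S"
      if "(v, v') \<in> edges G" "?ok v'" for v'
    proof (cases "edge_label G (v, v')")
      case None
      then show ?thesis
        using that product_edge.intros(1)[OF that(1) None] ext State v by (intro exI[of _ "State v' q"]) auto
    next
      case (Some a)
      then show ?thesis
        using that product_edge.intros(2)[OF that(1) Some] ext State v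
        by (intro exI[of _ "Choice v' (delta A q a)"]) auto
    qed
    show ?thesis
    proof (cases "v \<in> owned G P")
      case True
      have "\<exists>s. product_edge G A (State v q) s \<and> h @ [s] \<in> ?S" if e: "product_edge G A (State v q) s" for s
      proof -
        obtain v' where "(v, v') \<in> edges G" using e by (auto elim: product_edge.cases)
        then obtain v' where "(v, v') \<in> edges G" "?ok v'" using own[OF R v(2)] v(1) True by auto
        then show ?thesis using succ by blast
      qed
      then show ?thesis using product_owned(1)[OF wf vG, where A = A and P = P and q = q] True State by auto
    next
      case False
      have "h @ [s] \<in> ?S" if e: "product_edge G A (State v q) s" for s
        using e
      proof cases
        case (1 v')
        then show ?thesis using other[OF R v(2), of v'] v False ext State e by simp
      next
        case (2 v' a)
        then show ?thesis using other[OF R v(2), of v'] v False ext State e by simp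
      qed
      then show ?thesis using product_owned(1)[OF wf vG, where A = A and P = P and q = q] False State by auto
    qed
  next
    case (Choice v \<phi>)
    obtain a where v: "last g = v" "last l = LChoice a \<phi>" using sync Choice by (auto simp: synced_def)
    have vG: "v \<in> positions G" using pos Choice by (auto simp: product_def)
    show ?thesis
    proof (cases \<phi>)
      case (Atom y)
      obtain x q where y: "y = (x, q)" by (metis surj_pair)
      have "h @ [s] \<in> ?S \<and> s = State v q" if "product_edge G A (last h) s" for s
        using that assms(7)[of g l a x q] R v Choice \<open>\<phi> = Atom y\<close> y ext by (auto simp: product_edge_Choice)
      then show ?thesis by (auto split: if_splits)
    next
      case (Or \<phi>1 \<phi>2)
      then show ?thesis
        using assms(5)[OF R, of a \<phi>1 \<phi>2] v Choice product_owned(2)[OF wf vG, where A = A and P = P] vG ext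
        by (auto simp: product_edge_Choice split: if_splits)
    next
      case (And \<phi>1 \<phi>2)
      then show ?thesis
        using assms(6)[OF R, of a \<phi>1 \<phi>2] v Choice product_owned(3)[OF wf vG, where A = A and P = P] vG ext
        by (auto simp: product_edge_Choice split: if_splits)
    qed
  qed
qed

section \<open>Threshold history determinism implies good for games\<close>

fun letter_condition ::
    "player \<Rightarrow> ('a, 'q) automaton \<Rightarrow> rat seqfun \<Rightarrow> real \<Rightarrow> ('a \<times> rat) seq \<Rightarrow> bool" where
  "letter_condition Eve = eve_condition"
| "letter_condition Adam = adam_condition"

lemma threshold_history_deterministic_iff:
  "threshold_history_deterministic A Val \<longleftrightarrow>
     (\<forall>t P. wins (letter_game (opponent P) A) P (letter_condition P A Val t))"
proof -
  have "(\<forall>P. X P) \<longleftrightarrow> X Eve \<and> X Adam" for X :: "player \<Rightarrow> bool" by (metis player.exhaust)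
  then show ?thesis
    unfolding threshold_history_deterministic_def threshold_history_deterministic_at_def by simp
qed

lemma letter_condition_OnInf:
  "letter_condition P A (OnInf v) t (InfSeq s) \<longleftrightarrow>
     (secures P t (aut_value A (OnInf v) (InfSeq (fst \<circ> s))) \<longrightarrow> secures P t (ereal (v (snd \<circ> s))))"
  by (cases P) (simp_all add: comp_def)

lemma letter_condition_OnFin:
  "letter_condition P A (OnFin v) t (InfSeq s) \<longleftrightarrow>
     (\<forall>i. secures P t (aut_value A (OnFin v) (FinSeq (map fst (pre s (Suc i)))))
        \<longrightarrow> secures P t (ereal (v (map snd (pre s (Suc i))))))"
  by (cases P) (simp_all add: comp_def pre_def del: upt_Suc)

lemma wf_word_game [simp]: "wf_arena (word_game A w)"
  by (simp add: wf_arena_def word_game_def)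

text \<open>The letter game on finite words only tests nonempty prefixes, so the empty word needs
  separate treatment. Its game is over at once.\<close>

lemma aut_value_Nil: "aut_value A (OnFin v) (FinSeq []) = ereal (v [])"
proof -
  let ?G = "word_game A (FinSeq [])"
  have no: "(State 0 (start A), s) \<notin> edges ?G" for s
    by (auto simp: word_game_def elim: word_edge.cases)
  have tree: "tree ?G P {[State 0 (start A)]}" for P
    using no by (simp add: tree_def) (simp add: word_game_def)
  have pay: "payoff ?G (OnFin v) p = ereal (v [])" if p: "play ?G p" "follows {[State 0 (start A)]} p" for p
  proof (cases p)
    case (FinSeq h)
    have "pref p (Suc (length h)) = [State 0 (start A)]" using p(2) by (simp add: follows_def)
    then have "h = [State 0 (start A)]" using FinSeq by simp
    then show ?thesis using FinSeq by (simp add: payoff_def out_word_def)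
  next
    case (InfSeq q)
    have "pref p (Suc (Suc 0)) = [State 0 (start A)]" using p(2) unfolding follows_def by blast
    then show ?thesis using InfSeq by simp
  qed
  have "ereal (v []) \<le> eve_value ?G (OnFin v)" using ensures_Eve_value[OF tree] pay by simp
  moreover have "adam_value ?G (OnFin v) \<le> ereal (v [])" using ensures_Adam_value[OF tree] pay by simp
  ultimately show ?thesis
    unfolding aut_value_def using eve_value_le_adam_value[of ?G "OnFin v"] by simp
qed

lemma realizes_aut_value:
  "realizes A (OnInf v) (OnInf f) \<Longrightarrow> aut_value A (OnInf v) (InfSeq w) = ereal (f w)"
  "realizes A (OnFin v') (OnFin g) \<Longrightarrow> aut_value A (OnFin v') (FinSeq u) = ereal (g u)"
  by simp_all

lemma realizes_cases:
  assumes "realizes A Val f"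
  obtains v g where "Val = OnFin v" "f = OnFin g" | v g where "Val = OnInf v" "f = OnInf g"
  using assms by (cases Val; cases f) auto

lemma product_ensures:
  fixes G :: "('v, 'a) arena" and A :: "('a, 'q) automaton"
  assumes G: "is_game G f" and A: "realizes A Val f"
    and L: "wins (letter_game (opponent P) A) P (letter_condition P A Val t)"
    and e: "ensures G P f t"
  shows "ensures (product G A) P Val t"
proof -
  let ?L = "letter_game (opponent P) A"
  have wf: "wf_arena G" using G by (simp add: is_game_def)
  obtain S where S: "tree G P S" "prefix_closed S"
      "\<And>p. play G p \<Longrightarrow> follows S p \<Longrightarrow> secures P t (payoff G f p)"
    using e unfolding ensures_def by blast
  obtain S' where S': "tree ?L P S'" "prefix_closed S'"
      "\<And>p. play ?L p \<Longrightarrow> follows S' p \<Longrightarrow> letter_condition P A Val t (out_word ?L p)"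
    using L unfolding wins_tree by blast
  define R where "R g l \<longleftrightarrow> g \<in> S \<and> l \<in> S'" for g l
  \<comment> \<open>The opponent of \<open>P\<close> picks the letters of this letter game, so
    \<open>S'\<close> is prepared for any letter that the game \<open>G\<close> produces.\<close>
  have letter: "l @ [LChoice a (delta A q a)] \<in> S'" if "l \<in> S'" "last l = LState q" for l q a
    using tree_other[OF S'(1) that(1), of "LChoice a (delta A q a)"] that(2)
    by (cases P) (auto simp: letter_edge_LState letter_game_def)
  have "tree (product G A) P
      {h. partial_play (product G A) h \<and> R (fst (proj G A h)) (snd (proj G A h))}"
  proof (rule product_tree[OF wf])
    show "R [init_pos G] [LState (start A)]"
      using tree_init[OF S(1)] tree_init[OF S'(1)] by (simp add: R_def)
  next
    fix g l q v assume "R g l" "last l = LState q" "last g \<in> owned G P" "(last g, v) \<in> edges G"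
    then show "\<exists>v. (last g, v) \<in> edges G \<and> (case edge_label G (last g, v) of
            None \<Rightarrow> R (g @ [v]) l | Some a \<Rightarrow> R (g @ [v]) (l @ [LChoice a (delta A q a)]))"
      using tree_own[OF S(1)] letter unfolding R_def by (fastforce split: option.split)
  next
    fix g l q v assume "R g l" "last l = LState q" "last g \<notin> owned G P" "(last g, v) \<in> edges G"
    then show "case edge_label G (last g, v) of
            None \<Rightarrow> R (g @ [v]) l | Some a \<Rightarrow> R (g @ [v]) (l @ [LChoice a (delta A q a)])"
      using tree_other[OF S(1)] letter unfolding R_def by (auto split: option.split)
  qed (use letter_tree_Or[OF S'(1)] letter_tree_And[OF S'(1)] letter_tree_Atom[OF S'(1)]
       in \<open>auto simp: R_def split: if_splits\<close>)
  then show ?thesis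
  proof (rule ensuresI)
    fix p assume p: "play (product G A) p"
      "follows {h. partial_play (product G A) h \<and> R (fst (proj G A h)) (snd (proj G A h))} p"
    let ?g = "\<lambda>n. fst (proj G A (pref p (Suc n)))" and ?l = "\<lambda>n. snd (proj G A (pref p (Suc n)))"
    have R: "?g n \<in> S" "?l n \<in> S'" for n using p(2) by (auto simp: follows_def R_def)
    obtain r where r: "play G r" "tends_to ?g r" "\<And>m. \<exists>n. pref r (Suc m) = ?g n"
      "\<And>N. \<exists>n\<ge>N. \<exists>q. last (?l n) = LState q"
      "\<And>w. out_word G r = InfSeq w \<Longrightarrow> \<exists>q s. play ?L (InfSeq q) \<and> (\<forall>m. \<exists>n. pref (InfSeq q) (Suc m) = ?l n)
       \<and> out_word ?L (InfSeq q) = InfSeq s \<and> w = fst \<circ> s \<and> out_word (product G A) p = InfSeq (snd \<circ> s)"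
      "\<And>u. out_word G r = FinSeq u \<Longrightarrow> \<exists>N. \<forall>n\<ge>N. \<forall>q. last (?l n) = LState q \<longrightarrow>
         u = map fst (labs ?L (?l n)) \<and> out_word (product G A) p = FinSeq (map snd (labs ?L (?l n)))"
      using product_play_projections[OF wf p(1), where P = "opponent P"] by blast
    have "follows S r" unfolding follows_def using r(3) R(1) by metis
    then have sec: "secures P t (payoff G f r)" using S(3) r(1) by blast
    have dom: "out_word G r \<in> seqdom f" using G r(1) unfolding is_game_def by blast
    from A show "secures P t (payoff (product G A) Val p)"
    proof (cases rule: realizes_cases)
      case (1 v g)
      then obtain u where u: "out_word G r = FinSeq u" using dom by auto
      obtain N where N: "\<And>n q. n \<ge> N \<Longrightarrow> last (?l n) = LState q \<Longrightarrow>
         u = map fst (labs ?L (?l n)) \<and> out_word (product G A) p = FinSeq (map snd (labs ?L (?l n)))"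
        using r(6)[OF u] by blast
      obtain n q where n: "n \<ge> N" "last (?l n) = LState q" using r(4) by blast
      let ?z = "labs ?L (?l n)"
      have z: "u = map fst ?z" "out_word (product G A) p = FinSeq (map snd ?z)" using N[OF n] by auto
      have gu: "secures P t (ereal (g u))" using sec u 1 by (simp add: payoff_def)
      have "secures P t (ereal (v (map snd ?z)))"
      proof (cases "?z = []")
        case True
        have "ereal (g []) = ereal (v [])"
          using realizes_aut_value(2)[of A v g "[]"] A 1 aut_value_Nil[of A v] by simp
        then show ?thesis using gu z True by simp
      next
        case False
        \<comment> \<open>The winning condition speaks of infinite plays; so the finite letter play
          is extended inside \<open>S'\<close>, and the condition is used at the prefix in
          question.\<close>
        obtain q where q: "play ?L q" "pref q (length (?l n)) = ?l n" "follows S' q"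
          using tree_prefix_closed_play_exists[OF S'(1,2) R(2)] by blast
        obtain q' s where s: "q = InfSeq q'" "out_word ?L q = InfSeq s"
          "\<And>n. labs ?L (pre q' (Suc n)) = pre s (length (labs ?L (pre q' (Suc n))))"
          using letter_play_InfSeq[OF q(1)] by blast
        have len: "length (?l n) = Suc (length (?l n) - 1)"
          using partial_play_nonempty[OF tree_partial_play[OF S'(1) R(2)]] by (cases "?l n") auto
        have "?z = pre s (length ?z)"
          using s(3)[of "length (?l n) - 1"] q(2) unfolding s(1) pref_InfSeq_pre len[symmetric] by simp
        then have zs: "?z = pre s (Suc (length ?z - 1))" using False by simp
        have "letter_condition P A (OnFin v) t (InfSeq s)" using S'(3)[OF q(1,3)] s(2) 1 by simp
        then have "secures P t (aut_value A (OnFin v) (FinSeq (map fst ?z)))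
            \<longrightarrow> secures P t (ereal (v (map snd ?z)))"
          unfolding letter_condition_OnFin zs[symmetric] using zs by metis
        then show ?thesis using realizes_aut_value(2)[of A v g u] A 1 gu z(1) by simp
      qed
      then show ?thesis using z 1 by (simp add: payoff_def)
    next
      case (2 v g)
      then obtain w where w: "out_word G r = InfSeq w" using dom by auto
      obtain q s where q: "play ?L (InfSeq q)" "\<And>m. \<exists>n. pref (InfSeq q) (Suc m) = ?l n"
        "out_word ?L (InfSeq q) = InfSeq s" "w = fst \<circ> s" "out_word (product G A) p = InfSeq (snd \<circ> s)"
        using r(5)[OF w] by blast
      have "follows S' (InfSeq q)" unfolding follows_def using q(2) R(2) by metis
      then have "letter_condition P A (OnInf v) t (InfSeq s)" using S'(3) q(1,3) 2 by metis
      then have "secures P t (ereal (v (snd \<circ> s)))"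
        unfolding letter_condition_OnInf
        using sec w q(4) 2 realizes_aut_value(1)[of A v g w] A by (simp add: payoff_def)
      then show ?thesis using q(5) 2 by (simp add: payoff_def)
    qed
  qed
qed

theorem threshold_history_deterministic_good_for_games:
  assumes A: "realizes A Val f" and T: "threshold_history_deterministic A Val"
  shows "good_for_games TYPE('v) A Val f"
  unfolding good_for_games_def
proof (intro allI impI)
  fix G :: "('v, 'a) arena" assume "is_game G f \<and> determined G f"
  then have G: "is_game G f" "eve_value G f = adam_value G f" by (simp_all add: determined_def)
  have L: "wins (letter_game (opponent P) A) P (letter_condition P A Val t)" for P t
    using T unfolding threshold_history_deterministic_iff by blast
  let ?W = "product G A"
  \<comment> \<open>A threshold strictly between the two values would be ensured by Eve in
    \<open>G\<close>, hence in the product by \<open>product_ensures\<close>.\<close>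
  have "eve_value G f \<le> eve_value ?W Val"
  proof (rule ccontr)
    assume "\<not> ?thesis"
    then obtain t where t: "eve_value ?W Val < ereal t" "ereal t < eve_value G f"
      using ereal_dense2 not_le by metis
    obtain S where "tree ?W Eve S" "\<And>p. play ?W p \<Longrightarrow> follows S p \<Longrightarrow> ereal t \<le> payoff ?W Val p"
      using product_ensures[OF G(1) A L eve_value_ensures[OF t(2)]] unfolding ensures_def by auto
    then show False using ensures_Eve_value t(1) by (metis not_le)
  qed
  moreover have "adam_value ?W Val \<le> adam_value G f"
  proof (rule ccontr)
    assume "\<not> ?thesis"
    then obtain t where t: "adam_value G f < ereal t" "ereal t < adam_value ?W Val"
      using ereal_dense2 not_le by metis
    obtain S where "tree ?W Adam S" "\<And>p. play ?W p \<Longrightarrow> follows S p \<Longrightarrow> payoff ?W Val p < ereal t"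
      using product_ensures[OF G(1) A L adam_value_ensures[OF t(1)]] unfolding ensures_def by auto
    then show False using ensures_Adam_value t(2) by (metis not_le less_imp_le)
  qed
  moreover have "eve_value ?W Val \<le> adam_value ?W Val"
    using G(1) by (intro eve_value_le_adam_value wf_product) (simp add: is_game_def)
  ultimately show "\<exists>x. has_value G f x \<and> has_value ?W Val x"
    using G(2) unfolding has_value_def by (metis order.trans order.antisym)
qed

section \<open>Determinacy of letter games\<close>

text \<open>Each \<open>U m\<close> generates the open set of all sequences with a prefix in it, so
  these are the countable intersections of open sets.\<close>

definition gdelta :: "(nat \<Rightarrow> 'l) set \<Rightarrow> bool" where
  "gdelta X \<longleftrightarrow> (\<exists>U :: nat \<Rightarrow> 'l list set. X = {s. \<forall>m. \<exists>k. pre s k \<in> U m})"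

definition sigma3 :: "(nat \<Rightarrow> 'l) set \<Rightarrow> bool" where
  "sigma3 X \<longleftrightarrow> (\<exists>B :: nat \<Rightarrow> (nat \<Rightarrow> 'l) set. (\<forall>n. gdelta (B n)) \<and> X = (\<Union>n. B n))"

lemma sigma3_levels:
  fixes X :: "(nat \<Rightarrow> 'l) set"
  assumes "sigma3 X"
  obtains U :: "nat \<Rightarrow> nat \<Rightarrow> 'l list set" where "X = {s. \<exists>n. \<forall>m. \<exists>k. pre s k \<in> U n m}"
proof -
  obtain B :: "nat \<Rightarrow> (nat \<Rightarrow> 'l) set" where "(\<forall>n. gdelta (B n)) \<and> X = (\<Union>n. B n)"
    using assms unfolding sigma3_def ..
  then have B: "gdelta (B n)" "X = (\<Union>n. B n)" for n by simp_all
  have "\<forall>n. \<exists>V :: nat \<Rightarrow> 'l list set. B n = {s. \<forall>m. \<exists>k. pre s k \<in> V m}"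
    using B(1) unfolding gdelta_def by (rule allI)
  from choice[OF this] obtain U :: "nat \<Rightarrow> nat \<Rightarrow> 'l list set"
    where U: "\<forall>n. B n = {s. \<forall>m. \<exists>k. pre s k \<in> U n m}" ..
  have "X = {s. \<exists>n. \<forall>m. \<exists>k. pre s k \<in> U n m}" unfolding B(2) by (rule set_eqI) (simp add: U)
  then show thesis by (rule that)
qed

text \<open>\<open>X\<close> is about outputs and Davis's theorem about sequences of positions. As
  each label of the output appears after finitely many moves, the preimage of \<open>X\<close> has
  the same form.\<close>

lemma letter_game_determined:
  fixes A :: "('a, 'q) automaton"
  assumes X: "sigma3 X"
    and W: "\<And>q s. play (letter_game (opponent P) A) (InfSeq q)
      \<Longrightarrow> out_word (letter_game (opponent P) A) (InfSeq q) = InfSeq s \<Longrightarrow> W (InfSeq s) \<longleftrightarrow> s \<notin> X"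
    and nw: "\<not> wins (letter_game (opponent P) A) P W"
  obtains S where "tree (letter_game (opponent P) A) (opponent P) S" "prefix_closed S"
    "\<And>q s. play (letter_game (opponent P) A) (InfSeq q) \<Longrightarrow> follows S (InfSeq q)
      \<Longrightarrow> out_word (letter_game (opponent P) A) (InfSeq q) = InfSeq s \<Longrightarrow> s \<in> X"
proof -
  let ?L = "letter_game (opponent P) A" and ?O = "opponent P"
  obtain U :: "nat \<Rightarrow> nat \<Rightarrow> _" where U: "X = {s. \<exists>n. \<forall>m. \<exists>k. pre s k \<in> U n m}"
    by (rule sigma3_levels[OF X])
  define T where "T = Collect (partial_play ?L)"
  define own where "own h \<longleftrightarrow> last h \<in> owned ?L ?O" for h
  define U' where "U' n m = {h. \<exists>k\<le>length (labs ?L h). take k (labs ?L h) \<in> U n m}" for n m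
  define Y where "Y = {q. \<exists>n. \<forall>m. \<exists>k. pre q k \<in> U' n m}"
  have T_snoc: "h @ [s] \<in> T \<longleftrightarrow> letter_edge A (last h) s" if "h \<in> T" for h s
    using that partial_play_snoc[OF partial_play_nonempty, of ?L h ?L s] unfolding T_def by simp
  have pruned: "pruned T" unfolding pruned_def using T_snoc letter_edge_ex by blast
  have init: "[LState (start A)] \<in> T" by (simp add: T_def)
  have Y_iff: "q \<in> Y \<longleftrightarrow> s \<in> X" if q: "play ?L (InfSeq q)" "out_word ?L (InfSeq q) = InfSeq s" for q s
  proof -
    obtain q' s' where s': "InfSeq q = InfSeq q'" "out_word ?L (InfSeq q) = InfSeq s'"
      "\<And>n. labs ?L (pre q' (Suc n)) = pre s' (length (labs ?L (pre q' (Suc n))))"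
      using letter_play_InfSeq[OF q(1)] by blast
    then have s: "labs ?L (pre q (Suc n)) = pre s (length (labs ?L (pre q (Suc n))))" for n
      using q(2) by simp
    have s0: "labs ?L (pre q n) = pre s (length (labs ?L (pre q n)))" for n
      using s by (cases n) (auto simp: labs_def)
    have "(\<exists>k. pre q k \<in> U' n m) \<longleftrightarrow> (\<exists>k. pre s k \<in> U n m)" for n m
    proof
      assume "\<exists>k. pre q k \<in> U' n m"
      then obtain k j where "j \<le> length (labs ?L (pre q k))" "take j (labs ?L (pre q k)) \<in> U n m"
        unfolding U'_def by blast
      then show "\<exists>k. pre s k \<in> U n m" using s0[of k] take_pre[of j s] by metis
    next
      assume "\<exists>k. pre s k \<in> U n m"
      then obtain k where k: "pre s k \<in> U n m" by blast
      obtain j where j: "k \<le> length (labs ?L (pre q (Suc j)))"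
        using length_letter_labs[OF q(1), of k] unfolding pref_InfSeq_pre by blast
      then have "take k (labs ?L (pre q (Suc j))) = pre s k"
        using s[of j] take_pre[of k s] by (metis min.absorb1)
      then have "pre q (Suc j) \<in> U' n m" unfolding U'_def using k j by auto
      then show "\<exists>k. pre q k \<in> U' n m" by blast
    qed
    then show ?thesis unfolding Y_def U by simp
  qed
  have to_tree: "tree ?L Q S" if S: "quasi_strategy T (\<lambda>h. last h \<in> owned ?L Q) [LState (start A)] S" for Q S
    unfolding tree_def
  proof (intro conjI ballI)
    fix h assume h: "h \<in> S"
    then have hT: "h \<in> T" using quasi_strategyD(1)[OF S] by blast
    then show "partial_play ?L h" by (simp add: T_def)
    have TS: "letter_edge A (last h) s" if "h @ [s] \<in> S" for s
      using T_snoc[OF hT] quasi_strategyD(1)[OF S] that by blast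
    show "if last h \<in> owned ?L Q
      then (\<exists>v. (last h, v) \<in> edges ?L) \<longrightarrow> (\<exists>v. (last h, v) \<in> edges ?L \<and> h @ [v] \<in> S)
      else \<forall>v. (last h, v) \<in> edges ?L \<longrightarrow> h @ [v] \<in> S"
    proof (cases "last h \<in> owned ?L Q")
      case True
      then show ?thesis using quasi_strategyD(3)[OF S h] TS by auto
    next
      case False
      then show ?thesis using quasi_strategyD(4)[OF S h] T_snoc[OF hT] by auto
    qed
  qed (use quasi_strategyD(2)[OF S] in simp)
  have to_branch: "q \<in> branches S [LState (start A)]"
    if "play ?L (InfSeq q)" "follows S (InfSeq q)" for S q
  proof -
    have "pre q n \<in> S" if "n \<ge> 1" for n
      using \<open>follows S (InfSeq q)\<close> that unfolding follows_def pref_InfSeq_pre by (metis Suc_le_D One_nat_def)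
    then show ?thesis using play_start[OF that(1)] unfolding branches_def pref_InfSeq_pre by simp
  qed
  from wins_from_or_opponent[OF pruned init Y_def, of own] show thesis
  proof
    assume "wins_from T own [LState (start A)] Y"
    then obtain S where S: "quasi_strategy T own [LState (start A)] S" "branches S [LState (start A)] \<subseteq> Y"
      unfolding wins_from_def by blast
    have "tree ?L ?O S" using to_tree S(1) unfolding own_def by blast
    from tree_core[OF this] obtain S' where S': "tree ?L ?O S'" "prefix_closed S'"
      "\<And>p. play ?L p \<Longrightarrow> follows S' p \<Longrightarrow> follows S p" by blast
    show thesis
      using that[OF S'(1,2)] S'(3) to_branch S(2) Y_iff by blast
  next
    assume "wins_from T (\<lambda>g. \<not> own g) [LState (start A)] (- Y)"
    then obtain S where S: "quasi_strategy T (\<lambda>g. \<not> own g) [LState (start A)] S"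
      "branches S [LState (start A)] \<subseteq> - Y"
      unfolding wins_from_def by blast
    have "(\<lambda>g. \<not> own g) = (\<lambda>h. last h \<in> owned ?L P)"
      unfolding own_def using owned_opponent[OF wf_letter_game] by fastforce
    then have "tree ?L P S" using to_tree S(1) by metis
    from tree_core[OF this] obtain S' where S': "tree ?L P S'" "prefix_closed S'"
      "\<And>p. play ?L p \<Longrightarrow> follows S' p \<Longrightarrow> follows S p" by blast
    have "W (out_word ?L p)" if p: "play ?L p" "follows S' p" for p
    proof -
      obtain q s where q: "p = InfSeq q" "out_word ?L p = InfSeq s" using letter_play_InfSeq[OF p(1)] by blast
      then have "q \<notin> Y" using S(2) to_branch S'(3)[OF p] p(1) by blast
      then show ?thesis using W Y_iff p(1) q by metis
    qed
    then show thesis using nw S'(1,2) unfolding wins_tree by blast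
  qed
qed

section \<open>Solitary games\<close>

lemma tree_all:
  assumes "wf_arena G" "positions G \<subseteq> owned G P"
  shows "tree G (opponent P) (Collect (partial_play G))"
  unfolding tree_def
proof (intro conjI ballI)
  fix h assume h: "h \<in> Collect (partial_play G)"
  then have "last h \<in> owned G P" using partial_play_positions assms by blast
  then have "last h \<notin> owned G (opponent P)"
    using owned_opponent[OF assms(1)] partial_play_positions[OF assms(1)] h by simp
  then show "if last h \<in> owned G (opponent P)
    then (\<exists>v. (last h, v) \<in> edges G) \<longrightarrow>
      (\<exists>v. (last h, v) \<in> edges G \<and> h @ [v] \<in> Collect (partial_play G))
    else \<forall>v. (last h, v) \<in> edges G \<longrightarrow> h @ [v] \<in> Collect (partial_play G)"
    using h by (simp add: partial_play_snoc[OF partial_play_nonempty[of G h]])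
qed auto

lemma tree_one_play:
  assumes own: "wf_arena G" "positions G \<subseteq> owned G P" and p: "play G p"
  obtains S where "tree G P S" "\<And>p'. play G p' \<Longrightarrow> follows S p' \<Longrightarrow> p' = p"
proof -
  define S where "S = range (\<lambda>n. pref p (Suc n))"
  have ne: "pref p (Suc n) \<noteq> []" for n using play_pref[OF p] partial_play_nonempty by blast
  have "tree G P S"
    unfolding tree_def
  proof (intro conjI ballI)
    show "[init_pos G] \<in> S" using play_start[OF p] unfolding S_def by (metis rangeI)
    fix h assume "h \<in> S"
    then obtain n where n: "h = pref p (Suc n)" by (auto simp: S_def)
    then show "partial_play G h" using play_pref[OF p] by simp
    then have "last h \<in> owned G P" using partial_play_positions own by blast
    moreover have "\<exists>v. (last h, v) \<in> edges G \<and> h @ [v] \<in> S" if "(last h, v) \<in> edges G" for v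
      using play_progress[OF p, of n v] that unfolding n S_def by (metis rangeI)
    ultimately show "if last h \<in> owned G P
      then (\<exists>v. (last h, v) \<in> edges G) \<longrightarrow> (\<exists>v. (last h, v) \<in> edges G \<and> h @ [v] \<in> S)
      else \<forall>v. (last h, v) \<in> edges G \<longrightarrow> h @ [v] \<in> S" by auto
  qed
  moreover have "p' = p" if p': "play G p'" "follows S p'" for p'
  proof -
    have eq: "pref p' (Suc n) = pref p (Suc n)" for n
    proof (induction n)
      case 0
      then show ?case using play_start p p'(1) by metis
    next
      case (Suc n)
      show ?case
      proof (cases "\<exists>v. (last (pref p (Suc n)), v) \<in> edges G")
        case True
        then obtain v where v: "pref p (Suc (Suc n)) = pref p (Suc n) @ [v]"
          using play_progress[OF p] by blast
        obtain v' where v': "pref p' (Suc (Suc n)) = pref p (Suc n) @ [v']"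
          using play_progress[OF p'(1), of n] True Suc by auto
        obtain m where m: "pref p' (Suc (Suc n)) = pref p (Suc m)"
          using p'(2) unfolding follows_def S_def by blast
        have "prefix (pref p (Suc m)) (pref p (Suc (Suc n))) \<or> prefix (pref p (Suc (Suc n))) (pref p (Suc m))"
          using prefix_pref_le by (metis linear)
        then show ?thesis unfolding m[symmetric] v v' by auto
      next
        case False
        then have "pref p (Suc (Suc n)) = pref p (Suc n)" "pref p' (Suc (Suc n)) = pref p' (Suc n)"
          using play_pref_Suc[OF p, of n] play_pref_Suc[OF p'(1), of n] Suc by auto
        then show ?thesis using Suc by simp
      qed
    qed
    have pref0: "pref s 0 = []" for s :: "'a seq" by (cases s) auto
    have "pref p' k = pref p k" for k using eq pref0 by (cases k) auto
    then show ?thesis by (rule pref_inj)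
  qed
  ultimately show thesis using that by blast
qed

text \<open>The owner of all positions can force any single play, and the other player excludes
  none. So both values are the supremum, or the infimum if Adam is the owner, of the payoffs of all
  plays.\<close>

lemma solitary_determined:
  assumes own: "wf_arena G" "positions G \<subseteq> owned G P"
  shows "determined G f"
proof (rule ccontr)
  assume "\<not> ?thesis"
  then have "eve_value G f < adam_value G f"
    using eve_value_le_adam_value[OF own(1), of f] unfolding determined_def by simp
  then obtain t where t: "eve_value G f < ereal t" "ereal t < adam_value G f" using ereal_dense2 by blast
  obtain u where u: "eve_value G f < ereal u" "ereal u < ereal t" using ereal_dense2 t(1) by blast
  obtain w where w: "ereal t < ereal w" "ereal w < adam_value G f" using ereal_dense2 t(2) by blast
  show False
  proof (cases P)
    case Eve
    have "payoff G f p \<le> ereal t" if p: "play G p" for p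
    proof (rule ccontr)
      assume "\<not> ?thesis"
      moreover obtain S where "tree G Eve S" "\<And>p'. play G p' \<Longrightarrow> follows S p' \<Longrightarrow> p' = p"
        using tree_one_play[OF own p] Eve by blast
      ultimately have "ereal t \<le> eve_value G f" by (intro ensures_Eve_value) auto
      then show False using t(1) by simp
    qed
    then have "adam_value G f \<le> ereal t"
      using tree_all[OF own] Eve by (intro ensures_Adam_value) auto
    then show False using t(2) by simp
  next
    case Adam
    have "ereal t \<le> payoff G f p" if p: "play G p" for p
    proof (rule ccontr)
      assume "\<not> ?thesis"
      moreover obtain S where "tree G Adam S" "\<And>p'. play G p' \<Longrightarrow> follows S p' \<Longrightarrow> p' = p"
        using tree_one_play[OF own p] Adam by blast
      ultimately have "adam_value G f \<le> ereal t" by (intro ensures_Adam_value) auto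
      then show False using t(2) by simp
    qed
    then have "ereal t \<le> eve_value G f"
      using tree_all[OF own] Adam by (intro ensures_Eve_value) auto
    then show False using t(1) by simp
  qed
qed

text \<open>The opponent of \<open>P\<close> makes all moves of \<open>G\<close>, so the tree of all
  partial plays is one of \<open>P\<close>, and \<open>lo\<close> bounds the value through it.
  \<open>S\<close> bounds the value of the product on the other side of the gap.\<close>

lemma not_good_for_games_if_solitary:
  fixes G :: "('v, 'a) arena"
  assumes gfg: "good_for_games TYPE('v) A Val f" and G: "is_game G f"
    and own: "positions G \<subseteq> owned G (opponent P)"
    and S: "tree (product G A) (opponent P) S"
    and sep: "a < b"
    and lo: "\<And>p. play G p \<Longrightarrow> if P = Eve then ereal b \<le> payoff G f p else payoff G f p \<le> ereal a"
    and hi: "\<And>p. play (product G A) p \<Longrightarrow> follows S p \<Longrightarrow>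
      if P = Eve then payoff (product G A) Val p \<le> ereal a else ereal b \<le> payoff (product G A) Val p"
  shows False
proof -
  have wf: "wf_arena G" using G by (simp add: is_game_def)
  obtain x where x: "has_value G f x" "has_value (product G A) Val x"
    using gfg G solitary_determined[OF wf own] unfolding good_for_games_def by blast
  have all: "tree G P (Collect (partial_play G))" using tree_all[OF wf own] by simp
  show False
  proof (cases P)
    case Eve
    have "ereal b \<le> eve_value G f" using all lo Eve by (intro ensures_Eve_value) auto
    moreover have "adam_value (product G A) Val \<le> ereal a" using S hi Eve by (intro ensures_Adam_value) auto
    ultimately have "ereal b \<le> ereal a" using x unfolding has_value_def by (metis order.trans)
    then show False using sep by simp
  next
    case Adam
    have "adam_value G f \<le> ereal a" using all lo Adam by (intro ensures_Adam_value) auto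
    moreover have "ereal b \<le> eve_value (product G A) Val" using S hi Adam by (intro ensures_Eve_value) auto
    ultimately have "ereal b \<le> ereal a" using x unfolding has_value_def by (metis order.trans)
    then show False using sep by simp
  qed
qed

section \<open>Solitary games in which a word is chosen\<close>

text \<open>From \<open>(u, False)\<close> the player may append a letter, or stop at \<open>(u, True)\<close> if \<open>u \<in> F\<close>.\<close>

definition word_arena ::
    "player \<Rightarrow> 'a list set \<Rightarrow> 'a list set \<Rightarrow> ('a list \<times> bool \<Rightarrow> 'v) \<Rightarrow> ('v, 'a) arena" where
  "word_arena P T F e =
    (let V = e ` (T \<times> {False} \<union> (T \<inter> F) \<times> {True}) in
    \<lparr> positions = V,
      eve_positions = (if P = Eve then V else {}),
      init_pos = e ([], False),
      edges = {(e (u, False), e (u @ [a], False)) | u a. u \<in> T \<and> u @ [a] \<in> T}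
        \<union> {(e (u, False), e (u, True)) | u. u \<in> T \<inter> F},
      edge_label = (\<lambda>(x, y). case inv e y of (u, b) \<Rightarrow> if b then None else Some (last u)) \<rparr>)"

lemma word_arena_simps [simp]:
  "init_pos (word_arena P T F e) = e ([], False)"
  "positions (word_arena P T F e) = e ` (T \<times> {False} \<union> (T \<inter> F) \<times> {True})"
  "owned (word_arena P T F e) P = e ` (T \<times> {False} \<union> (T \<inter> F) \<times> {True})"
  by (cases P; simp add: word_arena_def Let_def)+

lemma word_arena_edges:
  assumes "inj e"
  shows "(e (u, b), y) \<in> edges (word_arena P T F e) \<longleftrightarrow> \<not> b \<and> u \<in> T
    \<and> ((\<exists>a. y = e (u @ [a], False) \<and> u @ [a] \<in> T) \<or> y = e (u, True) \<and> u \<in> F)"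
  using assms by (auto simp: word_arena_def Let_def inj_eq)

lemma word_arena_label:
  assumes "inj e"
  shows "edge_label (word_arena P T F e) (x, e (u, b)) = (if b then None else Some (last u))"
  using assms by (simp add: word_arena_def Let_def)

lemma wf_word_arena: "[] \<in> T \<Longrightarrow> wf_arena (word_arena P T F e)"
  unfolding wf_arena_def by (auto simp: word_arena_def Let_def)

text \<open>A position stores the word read so far. The length in the last conjunct makes the words
  of infinite plays infinite.\<close>

lemma word_arena_partial_play:
  assumes e: "inj e" and T: "[] \<in> T" and h: "partial_play (word_arena P T F e) h"
  shows "\<exists>b. last h = e (labs (word_arena P T F e) h, b) \<and> labs (word_arena P T F e) h \<in> T
    \<and> (b \<longrightarrow> labs (word_arena P T F e) h \<in> F)
    \<and> (\<not> b \<longrightarrow> length h = Suc (length (labs (word_arena P T F e) h)))"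
  using h
proof (induction h rule: rev_induct)
  case (snoc v h)
  let ?G = "word_arena P T F e"
  show ?case
  proof (cases "h = []")
    case True
    then show ?thesis using snoc.prems T by auto
  next
    case False
    then have pp: "partial_play ?G h" and edge: "(last h, v) \<in> edges ?G"
      using snoc.prems partial_play_snoc[OF False, of ?G v] by auto
    obtain b where b: "last h = e (labs ?G h, b)" "labs ?G h \<in> T" "b \<longrightarrow> labs ?G h \<in> F"
      "\<not> b \<longrightarrow> length h = Suc (length (labs ?G h))" using snoc.IH[OF pp] by blast
    then show ?thesis
      using edge unfolding b(1) word_arena_edges[OF e]
      by (auto simp: labs_snoc[OF False] word_arena_label[OF e] inj_eq[OF e])
  qed
qed (simp add: partial_play_def)

text \<open>A position at which the player has stopped is a dead end, so an infinite play never
  stops and reads a letter with every move.\<close>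

lemma word_arena_play:
  assumes e: "inj e" and T: "[] \<in> T" and p: "play (word_arena P T F e) p"
  shows "(\<exists>h. p = FinSeq h \<and> (\<exists>b. last h = e (labs (word_arena P T F e) h, b)
        \<and> labs (word_arena P T F e) h \<in> T \<and> (b \<longrightarrow> labs (word_arena P T F e) h \<in> F)
        \<and> (\<not> b \<longrightarrow> labs (word_arena P T F e) h \<notin> F \<and> (\<forall>a. labs (word_arena P T F e) h @ [a] \<notin> T)))
        \<and> out_word (word_arena P T F e) p = FinSeq (labs (word_arena P T F e) h))
    \<or> (\<exists>q w. p = InfSeq q \<and> out_word (word_arena P T F e) p = InfSeq w \<and> (\<forall>n. pre w n \<in> T))"
proof (cases p)
  case (FinSeq h)
  let ?G = "word_arena P T F e"
  have h: "partial_play ?G h" "\<And>v. (last h, v) \<notin> edges ?G" using p FinSeq by auto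
  obtain b where b: "last h = e (labs ?G h, b)" "labs ?G h \<in> T" "b \<longrightarrow> labs ?G h \<in> F"
    using word_arena_partial_play[OF e T h(1)] by blast
  moreover have "\<not> b \<longrightarrow> labs ?G h \<notin> F \<and> (\<forall>a. labs ?G h @ [a] \<notin> T)"
    using h(2) b(2) unfolding b(1) word_arena_edges[OF e] by blast
  moreover have "out_word ?G p = FinSeq (labs ?G h)" by (simp add: FinSeq out_word_def labs_def)
  ultimately show ?thesis using FinSeq by blast
next
  case (InfSeq q)
  let ?G = "word_arena P T F e"
  have pp: "partial_play ?G (pre q (Suc n))" for n
    using play_pref[OF p, of n] unfolding InfSeq pref_InfSeq_pre .
  have len: "labs ?G (pre q (Suc n)) \<in> T \<and> length (labs ?G (pre q (Suc n))) = n" for n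
  proof -
    obtain b where b: "last (pre q (Suc n)) = e (labs ?G (pre q (Suc n)), b)"
      "labs ?G (pre q (Suc n)) \<in> T"
      "\<not> b \<longrightarrow> length (pre q (Suc n)) = Suc (length (labs ?G (pre q (Suc n))))"
      using word_arena_partial_play[OF e T pp] by blast
    have "(q n, q (Suc n)) \<in> edges ?G" using p InfSeq by simp
    moreover have "q n = e (labs ?G (pre q (Suc n)), b)" using b(1) by simp
    ultimately have "\<not> b" using word_arena_edges[OF e] by metis
    then show ?thesis using b by simp
  qed
  have lim: "tends_to (\<lambda>n. labs ?G (pre q (Suc n))) (out_word ?G p)"
    using tends_to_out_word[of ?G p] unfolding InfSeq pref_InfSeq_pre .
  have chain: "prefix (labs ?G (pre q (Suc n))) (labs ?G (pre q (Suc (Suc n))))" for n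
    by (intro labs_prefix prefix_pre) simp
  obtain w where w: "out_word ?G p = InfSeq w"
  proof (cases "out_word ?G p")
    case (FinSeq u)
    then obtain N where "\<And>n. n \<ge> N \<Longrightarrow> labs ?G (pre q (Suc n)) = u" using tends_to_FinSeq lim by metis
    then show ?thesis using len by (metis le_SucI n_not_Suc_n order_refl)
  qed auto
  have "pre w n \<in> T" for n
    using chain_eq_pref[OF chain lim, of n] len[of n] unfolding w pref_InfSeq_pre by simp
  then show ?thesis using InfSeq w by blast
qed

section \<open>Compactness\<close>

lemma infinite_path:
  assumes "[] \<in> Y" "\<And>h. h \<in> Y \<Longrightarrow> \<exists>v. h @ [v] \<in> Y"
  shows "\<exists>p. \<forall>n. pre p n \<in> Y"
proof -
  define c where "c = rec_nat [] (\<lambda>_ h. h @ [SOME v. h @ [v] \<in> Y])"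
  define p where "p n = (SOME v. c n @ [v] \<in> Y)" for n
  have c: "c 0 = []" "c (Suc n) = c n @ [p n]" for n by (simp_all add: c_def p_def)
  have "c n \<in> Y" for n
  proof (induction n)
    case (Suc n)
    then show ?case unfolding c(2) p_def using someI_ex[OF assms(2)] by blast
  qed (simp add: c assms)
  moreover have "pre p n = c n" for n by (induction n) (simp_all add: c)
  ultimately show ?thesis by metis
qed

lemma koenig:
  assumes closed: "\<And>h v. h @ [v] \<in> X \<Longrightarrow> h \<in> X"
    and fin: "\<And>h. h \<in> X \<Longrightarrow> finite {v. h @ [v] \<in> X}"
    and unb: "\<And>n. \<exists>h\<in>X. n \<le> length h"
  shows "\<exists>p. \<forall>n. pre p n \<in> X"
proof -
  have closed': "g \<in> X" if "prefix g h" "h \<in> X" for g h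
  proof -
    obtain z where z: "h = g @ z" using \<open>prefix g h\<close> by (auto simp: prefix_def)
    have "g @ z \<in> X \<Longrightarrow> g \<in> X"
      by (induction z rule: rev_induct) (auto simp flip: append_assoc dest: closed)
    then show ?thesis using z that by simp
  qed
  define Y where "Y = {h \<in> X. \<forall>n. \<exists>g\<in>X. prefix h g \<and> n \<le> length g}"
  have "\<exists>p. \<forall>n. pre p n \<in> Y"
  proof (rule infinite_path)
    obtain h where "h \<in> X" using unb by blast
    then show "[] \<in> Y" using unb closed'[of "[]" h] unfolding Y_def by simp
  next
    fix h assume h: "h \<in> Y"
    show "\<exists>v. h @ [v] \<in> Y"
    proof (rule ccontr)
      assume no: "\<not> ?thesis"
      let ?V = "{v. h @ [v] \<in> X}"
      have "\<forall>v\<in>?V. \<exists>n. \<forall>g\<in>X. prefix (h @ [v]) g \<longrightarrow> length g < n"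
        using no unfolding Y_def by (auto simp: not_le)
      then obtain N where N: "\<And>v g. v \<in> ?V \<Longrightarrow> g \<in> X \<Longrightarrow> prefix (h @ [v]) g \<Longrightarrow> length g < N v"
        by metis
      have fV: "finite ?V" using fin h by (simp add: Y_def)
      \<comment> \<open>The sum over the finitely many children is at least each of their
        bounds.\<close>
      obtain g where g: "g \<in> X" "prefix h g" "Suc (length h + sum N ?V) \<le> length g"
        using h unfolding Y_def by blast
      then obtain z where z: "g = h @ z" by (auto simp: prefix_def)
      then obtain v z' where "z = v # z'" using g(3) by (cases z) auto
      then have pg: "prefix (h @ [v]) g" using z by simp
      then have v: "v \<in> ?V" using closed' g(1) by blast
      then have "length g < N v" using N g(1) pg by blast
      also have "N v \<le> sum N ?V" using fV v by (simp add: member_le_sum)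
      finally show False using g(3) by simp
    qed
  qed
  then show ?thesis unfolding Y_def by blast
qed

text \<open>If no bound below \<open>t\<close> served all of \<open>C\<close>, the construction of
  Koenig's lemma would yield a sequence none of whose neighbourhoods has such a bound. By
  \<open>closed\<close> it is in \<open>C\<close>, contradicting \<open>local\<close>.\<close>

lemma compact_bound:
  fixes g :: "(nat \<Rightarrow> 'v) \<Rightarrow> real"
  assumes fin: "\<And>h. finite {p (length h) | p. p \<in> C \<and> pre p (length h) = h}"
    and closed: "\<And>p. (\<And>n. \<exists>p'\<in>C. pre p' n = pre p n) \<Longrightarrow> p \<in> C"
    and local: "\<And>p. p \<in> C \<Longrightarrow> \<exists>c<t. \<exists>n. \<forall>p'\<in>C. pre p' n = pre p n \<longrightarrow> g p' \<le> c"
  shows "\<exists>c<t. \<forall>p\<in>C. g p \<le> c"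
proof (rule ccontr)
  assume no: "\<not> ?thesis"
  define Y where "Y = {h. \<forall>c<t. \<exists>p\<in>C. pre p (length h) = h \<and> c < g p}"
  have "\<exists>p. \<forall>n. pre p n \<in> Y"
  proof (rule infinite_path)
    show "[] \<in> Y" using no unfolding Y_def by (auto simp: not_le)
  next
    fix h assume h: "h \<in> Y"
    show "\<exists>v. h @ [v] \<in> Y"
    proof (rule ccontr)
      assume no': "\<not> ?thesis"
      let ?V = "{p (length h) | p. p \<in> C \<and> pre p (length h) = h}"
      have "\<forall>v. \<exists>c<t. \<forall>p\<in>C. pre p (Suc (length h)) = h @ [v] \<longrightarrow> g p \<le> c"
      proof
        fix v
        have "h @ [v] \<notin> Y" using no' by blast
        then obtain c where "c < t" "\<And>p. p \<in> C \<Longrightarrow> pre p (length (h @ [v])) = h @ [v] \<Longrightarrow> \<not> c < g p"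
          unfolding Y_def by blast
        then show "\<exists>c<t. \<forall>p\<in>C. pre p (Suc (length h)) = h @ [v] \<longrightarrow> g p \<le> c"
          by (intro exI[of _ c]) (auto simp: not_less)
      qed
      then obtain c where c: "\<And>v. c v < t"
        "\<And>v p. p \<in> C \<Longrightarrow> pre p (Suc (length h)) = h @ [v] \<Longrightarrow> g p \<le> c v" by metis
      \<comment> \<open>Inserting \<open>t - 1\<close> makes the set nonempty whatever
        \<open>?V\<close> is, with a maximum still below \<open>t\<close>.\<close>
      let ?m = "Max (insert (t - 1) (c ` ?V))"
      have fV: "finite (insert (t - 1) (c ` ?V))" using fin[of h] by simp
      have "?m \<in> insert (t - 1) (c ` ?V)" using fV by (intro Max_in) auto
      then have "?m < t" using c(1) by auto
      then obtain p where p: "p \<in> C" "pre p (length h) = h" "?m < g p" using h unfolding Y_def by blast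
      have "g p \<le> c (p (length h))" using p by (intro c(2)) auto
      also have "\<dots> \<le> ?m" using fV p by (intro Max_ge) auto
      finally show False using p(3) by simp
    qed
  qed
  then obtain p where p: "\<And>n. pre p n \<in> Y" by blast
  have pY: "\<exists>p'\<in>C. pre p' n = pre p n \<and> c < g p'" if "c < t" for n c
    using p[of n] that unfolding Y_def by simp
  have "p \<in> C" using pY[of "t - 1"] by (intro closed) auto
  then obtain c n where c: "c < t" "\<And>p'. p' \<in> C \<Longrightarrow> pre p' n = pre p n \<Longrightarrow> g p' \<le> c"
    using local by blast
  then show False using pY[OF c(1), of n] by force
qed

section \<open>Words of letter plays\<close>

definition pending :: "('a, 'q) lpos list \<Rightarrow> 'a list" where
  "pending l = (case last l of LState _ \<Rightarrow> [] | LChoice a _ \<Rightarrow> [a])"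

text \<open>Includes a letter that has been picked but not yet output, so that the word grows at the
  moment of the choice. Labels depend neither on the player nor on the automaton; both arguments of
  \<open>letter_game\<close> are dummies here.\<close>

definition letters :: "('a, 'q) lpos list \<Rightarrow> 'a list" where
  "letters l = map fst (labs (letter_game Eve (undefined :: ('a, 'q) automaton)) l) @ pending l"

lemma labs_letter_game: "labs (letter_game P A) l = labs (letter_game P' A') l"
  by (simp add: labs_def)

lemma letters_eq: "letters l = map fst (labs (letter_game P A) l) @ pending l"
  unfolding letters_def using labs_letter_game by metis

lemma letters_singleton [simp]: "letters [LState q] = []"
  by (simp add: letters_def pending_def)

lemma letters_snoc:
  assumes "l \<noteq> []" "letter_edge A (last l) s"
  shows "letters (l @ [s]) = letters l @ (case (last l, s) of (LState _, LChoice a _) \<Rightarrow> [a] | _ \<Rightarrow> [])"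
  using assms(2)
  by cases (auto simp: letters_eq[of _ Eve A] labs_snoc[OF assms(1)] pending_def)

lemma partial_play_snoc_letter:
  "l \<noteq> [] \<Longrightarrow> partial_play (letter_game P A) (l @ [s])
     \<longleftrightarrow> partial_play (letter_game P A) l \<and> letter_edge A (last l) s"
  using partial_play_snoc[of l "letter_game P A" s] by simp

section \<open>Finite branching and the finite set of weights\<close>

lemma finite_set_pbf: "finite (set_pbf \<phi>)"
  by (induction \<phi>) auto

lemma finite_resolve: "finite {\<psi>. resolve \<phi> \<psi>}"
  by (cases \<phi>) auto

lemma finite_letter_edge: "finite {s. letter_edge (A :: ('a::finite, 'q) automaton) s0 s}"
proof (cases s0)
  case (LState q)
  then have "{s. letter_edge A s0 s} = range (\<lambda>a. LChoice a (delta A q a))"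
    by (auto simp: letter_edge_LState)
  then show ?thesis by simp
next
  case (LChoice a \<phi>)
  have "{s. letter_edge A s0 s} \<subseteq> LChoice a ` {\<psi>. resolve \<phi> \<psi>} \<union> (LState \<circ> snd) ` set_pbf \<phi>"
    using LChoice by (auto simp: letter_edge_LChoice image_iff)
  then show ?thesis by (rule finite_subset) (simp add: finite_resolve finite_set_pbf)
qed

lemma letters_length: "partial_play (letter_game P A) l \<Longrightarrow> length (letters l) \<le> length l"
proof (induction l rule: rev_induct)
  case (snoc s l)
  show ?case
  proof (cases "l = []")
    case True
    then show ?thesis using snoc.prems by (auto simp: partial_play_def)
  next
    case False
    then show ?thesis
      using snoc letters_snoc[OF False] partial_play_snoc_letter[OF False]
      by (auto split: lpos.splits)
  qed
qed (simp add: partial_play_def)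

definition weights :: "('a, 'q) automaton \<Rightarrow> rat set" where
  "weights A = fst ` (\<Union>q a. set_pbf (delta A q a))"

lemma finite_weights: "finite (weights (A :: ('a::finite, 'q::finite) automaton))"
  unfolding weights_def by (intro finite_imageI finite_UN_I) (auto simp: finite_set_pbf)

lemma resolve_set: "resolve \<phi> \<psi> \<Longrightarrow> set_pbf \<psi> \<subseteq> set_pbf \<phi>"
  by (induction rule: resolve.induct) auto

text \<open>The second conjunct strengthens the induction: it accounts for the weight that is output
  on leaving an atom.\<close>

lemma letter_weights_subset:
  fixes A :: "('a, 'q) automaton"
  assumes "partial_play (letter_game P A) l"
  shows "set (map snd (labs (letter_game P A) l)) \<subseteq> weights A
    \<and> (\<forall>a \<phi>. last l = LChoice a \<phi> \<longrightarrow> fst ` set_pbf \<phi> \<subseteq> weights A)"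
  using assms
proof (induction l rule: rev_induct)
  case (snoc s l)
  show ?case
  proof (cases "l = []")
    case True
    then show ?thesis using snoc.prems by (auto simp: partial_play_def)
  next
    case False
    then have pp: "partial_play (letter_game P A) l" "letter_edge A (last l) s"
      using snoc.prems partial_play_snoc_letter by blast+
    from pp(2) show ?thesis
      by cases (use snoc.IH[OF pp(1)] labs_snoc[OF False, of "letter_game P A" s] resolve_set in
          \<open>force simp: weights_def\<close>)+
  qed
qed (simp add: partial_play_def)

lemma letter_play_weights:
  assumes q: "play (letter_game P A) (InfSeq q)" "out_word (letter_game P A) (InfSeq q) = InfSeq s"
  shows "snd (s i) \<in> weights A"
proof -
  let ?L = "letter_game P A"
  obtain q' s' where s': "InfSeq q = InfSeq q'" "out_word ?L (InfSeq q) = InfSeq s'"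
      "\<And>n. labs ?L (pre q' (Suc n)) = pre s' (length (labs ?L (pre q' (Suc n))))"
    using letter_play_InfSeq[OF q(1)] by blast
  obtain n where n: "Suc i \<le> length (labs ?L (pre q (Suc n)))"
    using length_letter_labs[OF q(1), of "Suc i"] unfolding pref_InfSeq_pre by blast
  have eq: "labs ?L (pre q (Suc n)) = pre s (length (labs ?L (pre q (Suc n))))"
    using s' q(2) by simp
  then have "labs ?L (pre q (Suc n)) ! i = s i" using n by (metis Suc_le_lessD nth_pre)
  then have "s i \<in> set (labs ?L (pre q (Suc n)))" using n by (metis Suc_le_lessD nth_mem)
  then show ?thesis
    using letter_weights_subset[OF play_pref[OF q(1), of n]] unfolding pref_InfSeq_pre by force
qed

text \<open>Koenig's lemma for the partial plays in \<open>S\<close> whose letters form a prefix of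
  \<open>w\<close>. Branching is finite over a finite alphabet, and by \<open>letters_length\<close>
  these plays are arbitrarily long.\<close>

lemma letter_tree_word:
  fixes A :: "('a::finite, 'q) automaton"
  assumes S: "tree (letter_game P A) Q S" "prefix_closed S" and w: "\<And>n. pre w n \<in> letters ` S"
  obtains q s where "play (letter_game P A) (InfSeq q)" "follows S (InfSeq q)"
    "out_word (letter_game P A) (InfSeq q) = InfSeq s" "w = fst \<circ> s"
proof -
  let ?L = "letter_game P A"
  \<comment> \<open>The empty list is added since \<open>koenig\<close> requires closure under all
    initial segments.\<close>
  define X where "X = {l. l = [] \<or> l \<in> S \<and> letters l = pre w (length (letters l))}"
  have SL: "partial_play ?L l" "l \<noteq> []" if "l \<in> S" for l
    using tree_partial_play[OF S(1) that] partial_play_nonempty by blast+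
  have mono: "prefix (letters l) (letters (l @ [s]))" if "l @ [s] \<in> S" "l \<noteq> []" for l s
    using letters_snoc[OF that(2)] SL(1)[OF that(1)] partial_play_snoc_letter[OF that(2)] by fastforce
  have pw: "u = pre w (length u)" if "prefix u (pre w n)" for u n
    using that take_pre[of "length u" w n] prefix_length_le[OF that]
    by (metis append_eq_conv_conj length_pre min.absorb1 prefixE)
  have "\<exists>q. \<forall>n. pre q n \<in> X"
  proof (rule koenig)
    fix l s assume "l @ [s] \<in> X"
    then show "l \<in> X" using S(2) mono pw unfolding X_def prefix_closed_def
      by (cases "l = []") (auto, metis)
  next
    fix l assume l: "l \<in> X"
    show "finite {s. l @ [s] \<in> X}"
    proof (cases "l = []")
      case True
      have "{s. l @ [s] \<in> X} \<subseteq> {LState (start A)}"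
      proof
        fix s assume "s \<in> {s. l @ [s] \<in> X}"
        then have "[s] \<in> S" using True by (simp add: X_def)
        from SL(1)[OF this] show "s \<in> {LState (start A)}" by simp
      qed
      then show ?thesis using finite_subset by blast
    next
      case False
      have "{s. l @ [s] \<in> X} \<subseteq> {s. letter_edge A (last l) s}"
        using SL(1) partial_play_snoc_letter[OF False] by (auto simp: X_def)
      then show ?thesis using finite_letter_edge finite_subset by blast
    qed
  next
    fix n
    obtain l where l: "l \<in> S" "letters l = pre w n" using w[of n] by (metis imageE)
    then have "l \<in> X" by (simp add: X_def)
    moreover have "n \<le> length l" using letters_length[OF SL(1)[OF l(1)]] l(2) by simp
    ultimately show "\<exists>h\<in>X. n \<le> length h" by blast
  qed
  then obtain q where q: "\<And>n. pre q n \<in> X" by blast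
  have qS: "pre q (Suc n) \<in> S" "letters (pre q (Suc n)) = pre w (length (letters (pre q (Suc n))))" for n
    using q[of "Suc n"] by (auto simp: X_def)
  have play: "play ?L (InfSeq q)"
    unfolding play_InfSeq_iff using SL(1)[OF qS(1)] by (simp add: pre_def del: upt_Suc)
  have fol: "follows S (InfSeq q)" unfolding follows_def pref_InfSeq_pre using qS(1) by blast
  obtain q' s where s': "InfSeq q = InfSeq q'" "out_word ?L (InfSeq q) = InfSeq s"
      "\<And>n. labs ?L (pre q' (Suc n)) = pre s (length (labs ?L (pre q' (Suc n))))"
    using letter_play_InfSeq[OF play] by blast
  have "w i = fst (s i)" for i
  proof -
    obtain n where n: "Suc i \<le> length (labs ?L (pre q (Suc n)))"
      using length_letter_labs[OF play, of "Suc i"] unfolding pref_InfSeq_pre by blast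
    have "letters (pre q (Suc n)) ! i = fst (s i)"
      using s' n unfolding letters_eq[of _ P A]
      by (simp add: nth_append) (metis Suc_le_lessD nth_pre)
    moreover have "letters (pre q (Suc n)) ! i = w i"
      using qS(2)[of n] n unfolding letters_eq[of _ P A]
      by (metis Suc_le_lessD length_append length_map nth_pre trans_less_add1)
    ultimately show ?thesis by simp
  qed
  then have "w = fst \<circ> s" by auto
  then show thesis using that[OF play fol s'(2)] by blast
qed

text \<open>\<open>P\<close> owns the arena and picks the letters in the letter game, so
  \<open>S\<close> tells which letter to append. \<open>fin\<close> marks the letter plays after
  which \<open>P\<close> stops; it is constantly false in the application to infinite words.\<close>

lemma word_arena_product:
  fixes A :: "('a, 'q) automaton" and e :: "'a list \<times> bool \<Rightarrow> 'v"
  assumes e: "inj e" and S: "tree (letter_game P A) P S" "prefix_closed S"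
    and fin_state: "\<And>l. fin l \<Longrightarrow> \<exists>q. last l = LState q"
    and T: "\<And>l. l \<in> S \<Longrightarrow> (\<And>l'. l' \<in> S \<Longrightarrow> strict_prefix l' l \<Longrightarrow> \<not> fin l') \<Longrightarrow> letters l \<in> T"
    and F: "\<And>l. l \<in> S \<Longrightarrow> fin l \<Longrightarrow> letters l \<in> F"
  obtains S' where "tree (product (word_arena P T F e) A) P S'"
    "\<And>p. play (product (word_arena P T F e) A) p \<Longrightarrow> follows S' p \<Longrightarrow>
      (\<exists>l\<in>S. fin l \<and> (\<forall>l'\<in>S. strict_prefix l' l \<longrightarrow> \<not> fin l')
          \<and> out_word (product (word_arena P T F e) A) p = FinSeq (map snd (labs (letter_game P A) l)))
      \<or> (\<exists>q s. play (letter_game P A) (InfSeq q) \<and> follows S (InfSeq q) \<and> (\<forall>n. \<not> fin (pre q (Suc n)))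
          \<and> out_word (letter_game P A) (InfSeq q) = InfSeq s
          \<and> out_word (product (word_arena P T F e) A) p = InfSeq (snd \<circ> s))"
proof -
  let ?G = "word_arena P T F e" and ?L = "letter_game P A"
  have SL: "partial_play ?L l" "l \<noteq> []" if "l \<in> S" for l
    using tree_partial_play[OF S(1) that] partial_play_nonempty by blast+
  have SE: "letter_edge A (last l) s" if "l @ [s] \<in> S" "l \<noteq> []" for l s
    using SL(1)[OF that(1)] partial_play_snoc_letter[OF that(2)] by blast
  define unfin where "unfin l \<longleftrightarrow> (\<forall>l'\<in>S. strict_prefix l' l \<longrightarrow> \<not> fin l')" for l
  have T': "letters l \<in> T" if "l \<in> S" "unfin l" for l using T[OF that(1)] that(2) unfolding unfin_def by blast
  have unfin_snoc: "unfin (l @ [s])" if "unfin l" "\<not> fin l" for l s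
    using that unfolding unfin_def strict_prefix_def by auto
  have start: "[LState (start A)] \<in> S" using tree_init[OF S(1)] by simp
  have unfin0: "unfin [LState (start A)]"
    unfolding unfin_def using SL(2) by (auto simp: strict_prefix_def prefix_Cons)
  have nilT: "[] \<in> T" using T'[OF start unfin0] by simp
  have wf: "wf_arena ?G" using wf_word_arena[OF nilT] .
  define R where "R g l \<longleftrightarrow> l \<in> S \<and> unfin l \<and> (\<exists>b. last g = e (letters l, b)
      \<and> (b \<longrightarrow> fin l))" for g l
  have R_choice: "last g = e (letters l, False)" if "R g l" "last l = LChoice a \<phi>" for g l a \<phi>
    using that fin_state[of l] unfolding R_def by auto
  have R_step: "R g (l @ [s])" if "R g l" "last l = LChoice a \<phi>" "l @ [s] \<in> S" for g l a \<phi> s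
  proof -
    have "\<not> fin l" using fin_state[of l] that(2) by auto
    moreover have "l \<noteq> []" using that(1) SL(2) by (simp add: R_def)
    moreover from this have "letters (l @ [s]) = letters l"
      using letters_snoc[OF _ SE[OF that(3)]] that(2) by auto
    ultimately show ?thesis
      using that unfin_snoc R_choice[OF that(1,2)] unfolding R_def by auto
  qed
  have tree: "tree (product ?G A) P
      {h. partial_play (product ?G A) h \<and> R (fst (proj ?G A h)) (snd (proj ?G A h))}"
  proof (rule product_tree[OF wf])
    show "R [init_pos ?G] [LState (start A)]" using start unfin0 by (auto simp: R_def)
  next
    fix g l q v assume R: "R g l" and l: "last l = LState q" and e': "(last g, v) \<in> edges ?G"
    obtain b where b: "l \<in> S" "unfin l" "last g = e (letters l, b)" using R unfolding R_def by blast
    have b': "\<not> b" "letters l \<in> T" using e' unfolding b(3) word_arena_edges[OF e] by auto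
    show "\<exists>v. (last g, v) \<in> edges ?G \<and> (case edge_label ?G (last g, v) of
            None \<Rightarrow> R (g @ [v]) l | Some a \<Rightarrow> R (g @ [v]) (l @ [LChoice a (delta A q a)]))"
    proof (cases "fin l")
      case True
      then show ?thesis
        using b b' F[OF b(1) True] word_arena_edges[OF e, of "letters l" False] word_arena_label[OF e]
        by (intro exI[of _ "e (letters l, True)"]) (auto simp: R_def)
    next
      case False
      obtain s0 where "letter_edge A (LState q) s0" using letter_edge_ex by blast
      then obtain s where s: "l @ [s] \<in> S" using tree_ext[OF S(1) b(1)] l by auto
      have se: "letter_edge A (LState q) s" using SE[OF s SL(2)[OF b(1)]] l by simp
      then obtain a where a: "s = LChoice a (delta A q a)" by (auto simp: letter_edge_LState)
      have ls: "letters (l @ [s]) = letters l @ [a]"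
        using letters_snoc[OF SL(2)[OF b(1)], of A s] se l a by simp
      have "letters l @ [a] \<in> T" using T'[OF s unfin_snoc[OF b(2) False]] ls by simp
      then show ?thesis
        using b b' s ls a unfin_snoc[OF b(2) False] word_arena_edges[OF e, of "letters l" False]
          word_arena_label[OF e]
        by (intro exI[of _ "e (letters l @ [a], False)"]) (auto simp: R_def)
    qed
  next
    fix g l q v assume "R g l" "last l = LState q" "last g \<notin> owned ?G P" "(last g, v) \<in> edges ?G"
    then have False using wf unfolding wf_arena_def by auto
    then show "case edge_label ?G (last g, v) of
            None \<Rightarrow> R (g @ [v]) l | Some a \<Rightarrow> R (g @ [v]) (l @ [LChoice a (delta A q a)])" ..
  next
    fix g l a \<phi> \<psi> assume R: "R g l" "last l = LChoice a (Or \<phi> \<psi>)"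
    then show "if P = Eve then R g (l @ [LChoice a \<phi>]) \<or> R g (l @ [LChoice a \<psi>])
      else R g (l @ [LChoice a \<phi>]) \<and> R g (l @ [LChoice a \<psi>])"
      using letter_tree_Or[OF S(1) _ R(2)] R_step[OF R] by (auto simp: R_def split: if_splits)
  next
    fix g l a \<phi> \<psi> assume R: "R g l" "last l = LChoice a (And \<phi> \<psi>)"
    then show "if P = Adam then R g (l @ [LChoice a \<phi>]) \<or> R g (l @ [LChoice a \<psi>])
      else R g (l @ [LChoice a \<phi>]) \<and> R g (l @ [LChoice a \<psi>])"
      using letter_tree_And[OF S(1) _ R(2)] R_step[OF R] by (auto simp: R_def split: if_splits)
  next
    fix g l a x q assume R: "R g l" "last l = LChoice a (Atom (x, q))"
    then show "R g (l @ [LState q])"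
      using letter_tree_Atom[OF S(1) _ R(2)] R_step[OF R] by (simp add: R_def)
  qed
  show thesis
  proof (rule that[OF tree])
    fix p assume p: "play (product ?G A) p"
      "follows {h. partial_play (product ?G A) h \<and> R (fst (proj ?G A h)) (snd (proj ?G A h))} p"
    let ?g = "\<lambda>n. fst (proj ?G A (pref p (Suc n)))" and ?l = "\<lambda>n. snd (proj ?G A (pref p (Suc n)))"
    have R: "R (?g n) (?l n)" for n using p(2) by (auto simp: follows_def)
    obtain r where r: "play ?G r" "tends_to ?g r" "\<And>m. \<exists>n. pref r (Suc m) = ?g n"
      "\<And>N. \<exists>n\<ge>N. \<exists>q. last (?l n) = LState q"
      "\<And>w. out_word ?G r = InfSeq w \<Longrightarrow> \<exists>q s. play ?L (InfSeq q) \<and> (\<forall>m. \<exists>n. pref (InfSeq q) (Suc m) = ?l n)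
       \<and> out_word ?L (InfSeq q) = InfSeq s \<and> w = fst \<circ> s \<and> out_word (product ?G A) p = InfSeq (snd \<circ> s)"
      "\<And>u. out_word ?G r = FinSeq u \<Longrightarrow> \<exists>N. \<forall>n\<ge>N. \<forall>q. last (?l n) = LState q \<longrightarrow>
         u = map fst (labs ?L (?l n)) \<and> out_word (product ?G A) p = FinSeq (map snd (labs ?L (?l n)))"
      using product_play_projections[OF wf p(1), where P = P] by blast
    from word_arena_play[OF e nilT r(1)]
    show "(\<exists>l\<in>S. fin l \<and> (\<forall>l'\<in>S. strict_prefix l' l \<longrightarrow> \<not> fin l') \<and> out_word (product ?G A) p = FinSeq (map snd (labs ?L l)))
      \<or> (\<exists>q s. play ?L (InfSeq q) \<and> follows S (InfSeq q) \<and> (\<forall>n. \<not> fin (pre q (Suc n)))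
          \<and> out_word ?L (InfSeq q) = InfSeq s \<and> out_word (product ?G A) p = InfSeq (snd \<circ> s))"
    proof (elim disjE exE conjE)
      fix h b
      assume h: "r = FinSeq h" "out_word ?G r = FinSeq (labs ?G h)"
      obtain N where N: "\<And>n q. n \<ge> N \<Longrightarrow> last (?l n) = LState q \<Longrightarrow>
         out_word (product ?G A) p = FinSeq (map snd (labs ?L (?l n)))"
        using r(6)[OF h(2)] by blast
      obtain N' where N': "\<And>n. n \<ge> N' \<Longrightarrow> ?g n = h" using tends_to_FinSeq r(2) h(1) by metis
      obtain n q where n: "n \<ge> max N N'" "last (?l n) = LState q" using r(4) by blast
      obtain b where b: "?l n \<in> S" "unfin (?l n)" "last h = e (letters (?l n), b)" "b \<longrightarrow> fin (?l n)"
        using R[of n] N'[of n] n(1) unfolding R_def by auto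
      have dead: "(last h, v) \<notin> edges ?G" for v using r(1) h(1) by simp
      have lT: "letters (?l n) \<in> T" using T'[OF b(1,2)] .
      \<comment> \<open>Otherwise \<open>S\<close> contains a further letter, and appending it would
        be an edge out of the dead end.\<close>
      have "fin (?l n)"
      proof (rule ccontr)
        assume nf: "\<not> fin (?l n)"
        obtain s0 where "letter_edge A (LState q) s0" using letter_edge_ex by blast
        then obtain s where s: "?l n @ [s] \<in> S" using tree_ext[OF S(1) b(1)] n(2) by auto
        have se: "letter_edge A (LState q) s" using SE[OF s SL(2)[OF b(1)]] n(2) by simp
        then obtain a where a: "s = LChoice a (delta A q a)" by (auto simp: letter_edge_LState)
        have ls: "letters (?l n @ [s]) = letters (?l n) @ [a]"
          using letters_snoc[OF SL(2)[OF b(1)], of A s] se n(2) a by simp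
        have "letters (?l n) @ [a] \<in> T" using T'[OF s unfin_snoc[OF b(2) nf]] ls by simp
        then show False
          using dead[of "e (letters (?l n) @ [a], False)"] b(3,4) nf lT
          unfolding b(3) word_arena_edges[OF e] by blast
      qed
      then show ?thesis using N[of n q] n b(1,2) unfolding unfin_def by auto
    next
      fix q' w assume "out_word ?G r = InfSeq w"
      then obtain q s where q: "play ?L (InfSeq q)" "\<And>m. \<exists>n. pref (InfSeq q) (Suc m) = ?l n"
        "out_word ?L (InfSeq q) = InfSeq s" "out_word (product ?G A) p = InfSeq (snd \<circ> s)"
        using r(5) by blast
      have qS: "pre q (Suc n) \<in> S" "unfin (pre q (Suc n))" for n
        using q(2)[of n] R unfolding R_def pref_InfSeq_pre by metis+
      have "follows S (InfSeq q)" unfolding follows_def pref_InfSeq_pre using qS by blast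
      moreover have "\<not> fin (pre q (Suc n))" for n
        using qS(2)[of "Suc n"] qS(1)[of n] unfolding unfin_def by (simp add: strict_prefix_def)
      ultimately show ?thesis using q by blast
    qed
  qed
qed

text \<open>Widens a strict inequality to the gap that \<open>not_good_for_games_if_solitary\<close>
  requires; \<open>t - 1\<close> covers the case without values below \<open>t\<close>.\<close>

lemma finite_strict_bound:
  fixes t :: real
  assumes "finite Z"
  shows "\<exists>a<t. \<forall>z\<in>Z. z < t \<longrightarrow> z \<le> a"
proof -
  let ?Z = "insert (t - 1) (Z \<inter> {..<t})"
  have "finite ?Z" using assms by simp
  moreover from this have "Max ?Z \<in> ?Z" by (intro Max_in) auto
  ultimately show ?thesis by (intro exI[of _ "Max ?Z"]) auto
qed

section \<open>Refuting good for games by a letter strategy of the opponent\<close>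

lemma ex_position_encoding:
  assumes "infinite (UNIV :: 'v set)"
  shows "\<exists>e :: 'a::finite list \<times> bool \<Rightarrow> 'v. inj e"
proof -
  obtain f :: "nat \<Rightarrow> 'v" where "inj f" using infinite_countable_subset[OF assms] by blast
  then have "inj (f \<circ> (to_nat :: 'a list \<times> bool \<Rightarrow> nat))" by (intro inj_compose) auto
  then show ?thesis by blast
qed

lemma letters_prefix_mono:
  assumes "partial_play (letter_game P A) l'" "prefix l l'" "l \<noteq> []"
  shows "prefix (letters l) (letters l')"
proof -
  obtain z where z: "l' = l @ z" using assms(2) by (auto simp: prefix_def)
  have "partial_play (letter_game P A) (l @ z) \<Longrightarrow> prefix (letters l) (letters (l @ z))"
  proof (induction z rule: rev_induct)
    case (snoc s z)
    have ne: "l @ z \<noteq> []" using assms(3) by simp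
    have pp: "partial_play (letter_game P A) (l @ z)" "letter_edge A (last (l @ z)) s"
      using snoc.prems partial_play_snoc_letter[OF ne, of P A s] by simp_all
    have "prefix (letters (l @ z)) (letters ((l @ z) @ [s]))"
      using letters_snoc[OF ne pp(2)] by (metis prefixI)
    then show ?case using snoc.IH[OF pp(1)] prefix_order.trans by fastforce
  qed simp
  then show ?thesis using assms(1) z by simp
qed

lemma letters_prefix:
  assumes S: "tree (letter_game P A) Q S" "prefix_closed S"
  shows "l \<in> S \<Longrightarrow> prefix u (letters l) \<Longrightarrow> \<exists>l'\<in>S. letters l' = u"
proof (induction l rule: rev_induct)
  case (snoc s l)
  have pp: "partial_play (letter_game P A) (l @ [s])" using tree_partial_play[OF S(1) snoc.prems(1)] .
  consider "u = letters (l @ [s])" | "l = []" | "l \<noteq> []" "u \<noteq> letters (l @ [s])" by blast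
  then show ?case
  proof cases
    case 1
    then show ?thesis using snoc.prems by blast
  next
    case 2
    then have "letters (l @ [s]) = []" using pp by simp
    then show ?thesis using snoc.prems by auto
  next
    case 3
    then have ne: "l \<noteq> []" by simp
    then have l: "l \<in> S" using snoc.prems(1) S(2) unfolding prefix_closed_def by blast
    have "letter_edge A (last l) s" using pp partial_play_snoc_letter[OF ne] by blast
    then have "prefix u (letters l)"
      using letters_snoc[OF ne] snoc.prems(2) 3 by (auto split: lpos.splits)
    then show ?thesis using snoc.IH[OF l] by blast
  qed
qed (use tree_partial_play[OF S(1)] in \<open>auto simp: partial_play_def\<close>)

text \<open>Ensures that the arena of producible words has no dead ends.\<close>

lemma letters_child:
  assumes S: "tree (letter_game P A) Q S" "prefix_closed S" and l: "l \<in> S"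
  shows "\<exists>a. letters l @ [a] \<in> letters ` S"
proof -
  let ?L = "letter_game P A"
  have ne: "l \<noteq> []" using partial_play_nonempty[OF tree_partial_play[OF S(1) l]] .
  obtain p where p: "play ?L p" "pref p (length l) = l" "follows S p"
    using tree_prefix_closed_play_exists[OF S l] by blast
  obtain n where n: "Suc (length (letters l)) \<le> length (labs ?L (pref p (Suc n)))"
    using length_letter_labs[OF p(1)] by blast
  define l' where "l' = pref p (Suc (max n (length l)))"
  have l': "l' \<in> S" using p(3) unfolding follows_def l'_def by blast
  have pp: "partial_play ?L l'" using tree_partial_play[OF S(1) l'] .
  have "prefix l l'" using prefix_pref_le[of "length l" "Suc (max n (length l))" p] p(2) by (simp add: l'_def)
  then have pl: "prefix (letters l) (letters l')" using letters_prefix_mono[OF pp] ne by blast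
  have "prefix (pref p (Suc n)) l'" unfolding l'_def by (intro prefix_pref_le) simp
  then have "length (labs ?L (pref p (Suc n))) \<le> length (labs ?L l')"
    by (intro prefix_length_le labs_prefix)
  then have "length (letters l) < length (letters l')" using n by (simp add: letters_eq[of l' P A])
  then obtain a z where "letters l' = letters l @ a # z" using pl by (auto simp: prefix_def neq_Nil_conv)
  then have "prefix (letters l @ [a]) (letters l')" by simp
  then show ?thesis using letters_prefix[OF S l'] by (metis imageI)
qed

text \<open>The arena consists of the words that \<open>S\<close> can produce, without the option to
  stop. By \<open>letter_tree_word\<close>, each of its plays has the word of a letter play
  following \<open>S\<close>, so the bound on \<open>g\<close> in \<open>S_val\<close> holds for all
  of them.\<close>

lemma not_good_for_games_infinite:
  fixes A :: "('a::finite, 'q::finite) automaton"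
  assumes inf: "infinite (UNIV :: 'v set)"
    and gfg: "good_for_games TYPE('v) A (OnInf v) (OnInf g)"
    and S: "tree (letter_game (opponent P) A) (opponent P) S" "prefix_closed S"
    and sep: "a < b"
    and S_val: "\<And>q s. play (letter_game (opponent P) A) (InfSeq q) \<Longrightarrow> follows S (InfSeq q)
      \<Longrightarrow> out_word (letter_game (opponent P) A) (InfSeq q) = InfSeq s \<Longrightarrow>
      if P = Eve then b \<le> g (fst \<circ> s) \<and> v (snd \<circ> s) \<le> a else g (fst \<circ> s) \<le> a \<and> b \<le> v (snd \<circ> s)"
  shows False
proof -
  let ?O = "opponent P" let ?L = "letter_game ?O A"
  obtain e :: "'a list \<times> bool \<Rightarrow> 'v" where e: "inj e" using ex_position_encoding[OF inf] by blast
  let ?T = "letters ` S" let ?G = "word_arena ?O ?T {} e"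
  have nil: "[] \<in> ?T" using tree_init[OF S(1)] letters_singleton by (metis imageI letter_game_simps(1))
  have child: "\<exists>a. u @ [a] \<in> ?T" if "u \<in> ?T" for u using letters_child[OF S] that by blast
  have G_play: "\<exists>q s. play ?L (InfSeq q) \<and> follows S (InfSeq q) \<and> out_word ?L (InfSeq q) = InfSeq s
      \<and> out_word ?G p = InfSeq (fst \<circ> s)" if p: "play ?G p" for p
  proof -
    obtain w where w: "out_word ?G p = InfSeq w" "\<And>n. pre w n \<in> ?T"
      using word_arena_play[OF e nil p] child by blast
    show ?thesis using letter_tree_word[OF S w(2)] w(1) by metis
  qed
  have game: "is_game ?G (OnInf g)"
    unfolding is_game_def
  proof (intro conjI allI impI ballI)
    show "wf_arena ?G" using wf_word_arena[OF nil] .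
    show "out_word ?G p \<in> seqdom (OnInf g)" if "play ?G p" for p using G_play[OF that] by auto
    fix x assume "x \<in> positions ?G"
    then obtain u where u: "u \<in> ?T" "x = e (u, False)" by auto
    then show "\<exists>y. (x, y) \<in> edges ?G" using child[OF u(1)] unfolding u(2) word_arena_edges[OF e] by blast
  qed
  obtain S' where S': "tree (product ?G A) ?O S'"
    "\<And>p. play (product ?G A) p \<Longrightarrow> follows S' p \<Longrightarrow>
      \<exists>q s. play ?L (InfSeq q) \<and> follows S (InfSeq q) \<and> out_word ?L (InfSeq q) = InfSeq s
        \<and> out_word (product ?G A) p = InfSeq (snd \<circ> s)"
    by (rule word_arena_product[OF e S, of "\<lambda>_. False" ?T "{}"]) auto
  show False
  proof (rule not_good_for_games_if_solitary[OF gfg game _ S'(1) sep])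
    show "positions ?G \<subseteq> owned ?G ?O" by simp
  next
    fix p assume "play ?G p"
    from G_play[OF this] S_val
    show "if P = Eve then ereal b \<le> payoff ?G (OnInf g) p else payoff ?G (OnInf g) p \<le> ereal a"
      by (fastforce simp: payoff_def)
  next
    fix p assume "play (product ?G A) p" "follows S' p"
    from S'(2)[OF this] S_val
    show "if P = Eve then payoff (product ?G A) (OnInf v) p \<le> ereal a
      else ereal b \<le> payoff (product ?G A) (OnInf v) p"
      by (fastforce simp: payoff_def)
  qed
qed

text \<open>At the first time when the output is longer than \<open>i\<close>, its length is
  \<open>Suc i\<close>, as each move outputs at most one label, and a label is output on entering an
  \<open>LState\<close>.\<close>

lemma letter_play_at:
  assumes q: "play (letter_game P A) (InfSeq q)" "out_word (letter_game P A) (InfSeq q) = InfSeq s"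
  shows "\<exists>n st. labs (letter_game P A) (pre q (Suc n)) = pre s (Suc i) \<and> last (pre q (Suc n)) = LState st"
proof -
  let ?L = "letter_game P A"
  obtain q' s' where s': "InfSeq q = InfSeq q'" "out_word ?L (InfSeq q) = InfSeq s'"
      "\<And>n. labs ?L (pre q' (Suc n)) = pre s' (length (labs ?L (pre q' (Suc n))))"
    using letter_play_InfSeq[OF q(1)] by blast
  have eq: "labs ?L (pre q (Suc n)) = pre s (length (labs ?L (pre q (Suc n))))" for n
    using s' q(2) by simp
  define len where "len n = length (labs ?L (pre q (Suc n)))" for n
  obtain m where "Suc i \<le> len m"
    using length_letter_labs[OF q(1), of "Suc i"] unfolding pref_InfSeq_pre len_def by blast
  then have "i < len m" by simp
  moreover have "\<not> i < len 0" by (simp add: len_def)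
  ultimately obtain n where n: "len n \<le> i" "i < len (Suc n)"
    using ex_least_nat_less[of "\<lambda>n. i < len n" m] by (auto simp: not_less)
  have ne: "pre q (Suc n) \<noteq> []" by simp
  have step: "labs ?L (pre q (Suc (Suc n))) = labs ?L (pre q (Suc n))
      @ (case letter_label (q n, q (Suc n)) of None \<Rightarrow> [] | Some y \<Rightarrow> [y])"
    using labs_snoc[OF ne, of ?L "q (Suc n)"] by simp
  then obtain y where y: "letter_label (q n, q (Suc n)) = Some y"
    using n by (cases "letter_label (q n, q (Suc n))") (auto simp: len_def)
  then have "len (Suc n) = Suc (len n)" using step by (simp add: len_def)
  then have "labs ?L (pre q (Suc (Suc n))) = pre s (Suc i)"
    using eq[of "Suc n"] n unfolding len_def by (metis le_antisym less_Suc_eq_le)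
  moreover obtain st where "q (Suc n) = LState st" using y by (cases "q n"; cases "q (Suc n)") auto
  ultimately show ?thesis by (intro exI[of _ "Suc n"] exI[of _ st]) simp
qed

text \<open>The opponent stops as soon as their strategy has put the two values on different sides
  of \<open>t\<close>. By Koenig's lemma this happens on all plays within a common number of moves,
  so only finitely many words and weight sequences matter.\<close>

lemma not_good_for_games_finite:
  fixes A :: "('a::finite, 'q::finite) automaton"
  assumes inf: "infinite (UNIV :: 'v set)"
    and gfg: "good_for_games TYPE('v) A (OnFin v) (OnFin g)"
    and S: "tree (letter_game (opponent P) A) (opponent P) S" "prefix_closed S"
    and S_val: "\<And>q s. play (letter_game (opponent P) A) (InfSeq q) \<Longrightarrow> follows S (InfSeq q)
      \<Longrightarrow> out_word (letter_game (opponent P) A) (InfSeq q) = InfSeq s \<Longrightarrow>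
      \<exists>i. secures P t (ereal (g (map fst (pre s (Suc i))))) \<and> \<not> secures P t (ereal (v (map snd (pre s (Suc i)))))"
  shows False
proof -
  let ?O = "opponent P" let ?L = "letter_game ?O A"
  obtain e :: "'a list \<times> bool \<Rightarrow> 'v" where e: "inj e" using ex_position_encoding[OF inf] by blast
  define fin where "fin l \<longleftrightarrow> (\<exists>q. last l = LState q) \<and> secures P t (ereal (g (letters l)))
      \<and> \<not> secures P t (ereal (v (map snd (labs ?L l))))" for l
  define unfin where "unfin l \<longleftrightarrow> (\<forall>l'\<in>S. strict_prefix l' l \<longrightarrow> \<not> fin l')" for l
  have SL: "partial_play ?L l" "l \<noteq> []" if "l \<in> S" for l
    using tree_partial_play[OF S(1) that] partial_play_nonempty by blast+
  have ends: "\<exists>n. fin (pre q (Suc n))" if q: "play ?L (InfSeq q)" "follows S (InfSeq q)" for q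
  proof -
    obtain s where s: "out_word ?L (InfSeq q) = InfSeq s" using letter_play_InfSeq[OF q(1)] by blast
    obtain i where i: "secures P t (ereal (g (map fst (pre s (Suc i)))))"
      "\<not> secures P t (ereal (v (map snd (pre s (Suc i)))))" using S_val[OF q s] by blast
    obtain n st where "labs ?L (pre q (Suc n)) = pre s (Suc i)" "last (pre q (Suc n)) = LState st"
      using letter_play_at[OF q(1) s, of i] by blast
    then have "fin (pre q (Suc n))"
      using i unfolding fin_def letters_eq[of _ ?O A] by (simp add: pending_def)
    then show ?thesis by blast
  qed
  have "\<exists>N. \<forall>l\<in>S. unfin l \<longrightarrow> length l < N"
  proof (rule ccontr)
    assume no: "\<not> ?thesis"
    define X where "X = {l. l = [] \<or> l \<in> S \<and> unfin l}"
    have "\<exists>q. \<forall>n. pre q n \<in> X"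
    proof (rule koenig)
      fix l s assume "l @ [s] \<in> X"
      moreover have "unfin (l @ [s]) \<Longrightarrow> unfin l"
        unfolding unfin_def using prefix_order.strict_trans1 by (auto simp: strict_prefix_def)
      ultimately show "l \<in> X" using S(2) unfolding X_def prefix_closed_def by auto
    next
      fix l assume l: "l \<in> X"
      show "finite {s. l @ [s] \<in> X}"
      proof (cases "l = []")
        case True
        have "{s. l @ [s] \<in> X} \<subseteq> {LState (start A)}"
        proof
          fix s assume "s \<in> {s. l @ [s] \<in> X}"
          then have "[s] \<in> S" using True by (simp add: X_def)
          from SL(1)[OF this] show "s \<in> {LState (start A)}" by simp
        qed
        then show ?thesis using finite_subset by blast
      next
        case False
        have "{s. l @ [s] \<in> X} \<subseteq> {s. letter_edge A (last l) s}"
          using SL(1) partial_play_snoc_letter[OF False] by (auto simp: X_def)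
        then show ?thesis using finite_letter_edge finite_subset by blast
      qed
    next
      fix n show "\<exists>h\<in>X. n \<le> length h" using no unfolding X_def by (auto simp: not_less)
    qed
    then obtain q where q: "\<And>n. pre q n \<in> X" by blast
    have qS: "pre q (Suc n) \<in> S" "unfin (pre q (Suc n))" for n using q[of "Suc n"] by (auto simp: X_def)
    have play: "play ?L (InfSeq q)"
      unfolding play_InfSeq_iff using SL(1)[OF qS(1)] by (simp add: pre_def del: upt_Suc)
    have fol: "follows S (InfSeq q)" unfolding follows_def pref_InfSeq_pre using qS(1) by blast
    obtain n where n: "fin (pre q (Suc n))" using ends[OF play fol] by blast
    then show False
      using qS(2)[of "Suc n"] qS(1)[of n] unfolding unfin_def by (simp add: strict_prefix_def)
  qed
  then obtain N where N: "\<And>l. l \<in> S \<Longrightarrow> unfin l \<Longrightarrow> length l < N" by blast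
  define F where "F = {u. secures P t (ereal (g u))}"
  \<comment> \<open>There may be more words here than \<open>S\<close> produces. This is harmless:
    one may stop only at words in \<open>F\<close>, the bound \<open>N\<close> excludes infinite
    plays, and every word in \<open>T\<close> can be completed to one in \<open>F\<close>.\<close>
  define T where "T = {u. \<exists>u'\<in>F. prefix u u' \<and> length u' \<le> N}"
  have T_letters: "letters l \<in> T" if l: "l \<in> S" "unfin l" for l
  proof -
    obtain p where p: "play ?L p" "pref p (length l) = l" "follows S p"
      using tree_prefix_closed_play_exists[OF S l(1)] by blast
    obtain q where q: "p = InfSeq q" using letter_play_InfSeq[OF p(1)] by blast
    have qS: "pre q (Suc n) \<in> S" for n using p(3) unfolding q follows_def pref_InfSeq_pre by blast
    \<comment> \<open>The first time at which a play through \<open>l\<close> is finished; the word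
      read by then completes \<open>letters l\<close> within the bound.\<close>
    define n where "n = (LEAST n. fin (pre q (Suc n)))"
    have n: "fin (pre q (Suc n))" unfolding n_def using ends p(1,3) q LeastI_ex by metis
    have less: "\<not> fin (pre q (Suc m))" if "m < n" for m using that not_less_Least unfolding n_def by blast
    have "unfin (pre q (Suc n))"
      unfolding unfin_def
    proof (intro ballI impI)
      fix l' assume l': "l' \<in> S" "strict_prefix l' (pre q (Suc n))"
      then have len: "length l' < Suc n" using prefix_length_less by fastforce
      have "l' = pre q (length l')"
        using l'(2) take_pre[of "length l'" q "Suc n"] len unfolding strict_prefix_def
        by (metis append_eq_conv_conj less_imp_le_nat min.absorb1 prefixE)
      then show "\<not> fin l'" using less[of "length l' - 1"] SL(2)[OF l'(1)] len
        by (cases "length l'") auto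
    qed
    then have "Suc n < N" using N[OF qS] by simp
    moreover have "length (letters (pre q (Suc n))) \<le> Suc n"
      using letters_length[OF SL(1)[OF qS[of n]]] by simp
    moreover have "prefix (letters l) (letters (pre q (Suc n)))"
    proof (rule letters_prefix_mono[OF SL(1)[OF qS]])
      have "length l \<le> Suc n"
      proof (rule ccontr)
        assume "\<not> ?thesis"
        then have "prefix (pre q (Suc n)) (pre q (length l))" "pre q (Suc n) \<noteq> pre q (length l)"
          using prefix_pre[of "Suc n" "length l" q] by (auto dest: arg_cong[of _ _ length])
        then have "strict_prefix (pre q (Suc n)) l"
          using p(2) unfolding q pref_InfSeq_pre strict_prefix_def by simp
        then show False using l(2) n qS unfolding unfin_def by blast
      qed
      then show "prefix l (pre q (Suc n))" using p(2) prefix_pre unfolding q pref_InfSeq_pre by metis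
    qed (use SL(2)[OF l(1)] in simp)
    ultimately show ?thesis using n unfolding T_def F_def fin_def by auto
  qed
  let ?G = "word_arena ?O T F e"
  have start: "[LState (start A)] \<in> S" using tree_init[OF S(1)] by simp
  have "unfin [LState (start A)]"
    unfolding unfin_def using SL(2) by (auto simp: strict_prefix_def prefix_Cons)
  then have nil: "[] \<in> T" using T_letters[OF start] by simp
  have T_len: "length u \<le> N" if "u \<in> T" for u using that prefix_length_le unfolding T_def by fastforce
  have T_child: "u \<in> F \<or> (\<exists>a. u @ [a] \<in> T)" if u: "u \<in> T" for u
  proof -
    obtain u' where u': "u' \<in> F" "prefix u u'" "length u' \<le> N" using u unfolding T_def by blast
    then obtain z where z: "u' = u @ z" by (auto simp: prefix_def)
    show ?thesis
    proof (cases z)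
      case Nil
      then show ?thesis using z u' by simp
    next
      case (Cons a z')
      then have "prefix (u @ [a]) u'" using z by simp
      then show ?thesis using u' unfolding T_def by blast
    qed
  qed
  have G_play: "\<exists>u\<in>T \<inter> F. out_word ?G p = FinSeq u" if p: "play ?G p" for p
    using word_arena_play[OF e nil p]
  proof (elim disjE exE conjE)
    fix h b
    assume h: "labs ?G h \<in> T" "b \<longrightarrow> labs ?G h \<in> F"
      "\<not> b \<longrightarrow> labs ?G h \<notin> F \<and> (\<forall>a. labs ?G h @ [a] \<notin> T)" "out_word ?G p = FinSeq (labs ?G h)"
    then show ?thesis using T_child[OF h(1)] by blast
  next
    fix w assume "\<forall>n. pre w n \<in> T"
    then have "length (pre w (Suc N)) \<le> N" using T_len by blast
    then show ?thesis by simp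
  qed
  have game: "is_game ?G (OnFin g)"
    unfolding is_game_def using wf_word_arena[OF nil] G_play by fastforce
  obtain S' where S': "tree (product ?G A) ?O S'"
    "\<And>p. play (product ?G A) p \<Longrightarrow> follows S' p \<Longrightarrow>
      \<exists>l\<in>S. fin l \<and> unfin l \<and> out_word (product ?G A) p = FinSeq (map snd (labs ?L l))"
  proof (rule word_arena_product[OF e S, of fin T F])
    show "\<exists>q. last l = LState q" if "fin l" for l using that unfolding fin_def by blast
    show "letters l \<in> T" if "l \<in> S" "\<And>l'. l' \<in> S \<Longrightarrow> strict_prefix l' l \<Longrightarrow> \<not> fin l'" for l
      using T_letters that unfolding unfin_def by blast
    show "letters l \<in> F" if "l \<in> S" "fin l" for l using that unfolding fin_def F_def by blast
    fix S' assume S': "tree (product ?G A) ?O S'"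
      "\<And>p. play (product ?G A) p \<Longrightarrow> follows S' p \<Longrightarrow>
      (\<exists>l\<in>S. fin l \<and> (\<forall>l'\<in>S. strict_prefix l' l \<longrightarrow> \<not> fin l') \<and> out_word (product ?G A) p
          = FinSeq (map snd (labs ?L l)))
      \<or> (\<exists>q s. play ?L (InfSeq q) \<and> follows S (InfSeq q) \<and> (\<forall>n. \<not> fin (pre q (Suc n)))
          \<and> out_word ?L (InfSeq q) = InfSeq s \<and> out_word (product ?G A) p = InfSeq (snd \<circ> s))"
    show thesis
    proof (rule that[OF S'(1)])
      fix p assume "play (product ?G A) p" "follows S' p"
      from S'(2)[OF this] ends
      show "\<exists>l\<in>S. fin l \<and> unfin l \<and> out_word (product ?G A) p = FinSeq (map snd (labs ?L l))"
        unfolding unfin_def by blast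
    qed
  qed
  \<comment> \<open>Contains all payoffs that occur in the game or in the product under
    \<open>S'\<close>; being finite, it leaves a gap below \<open>t\<close>.\<close>
  define Z where "Z = g ` {u. set u \<subseteq> UNIV \<and> length u \<le> N} \<union> v ` {u. set u \<subseteq> weights A \<and> length u \<le> N}"
  have "finite Z" unfolding Z_def
    by (intro finite_UnI finite_imageI finite_lists_length_le finite_weights) simp
  then obtain a where a: "a < t" "\<And>z. z \<in> Z \<Longrightarrow> z < t \<Longrightarrow> z \<le> a"
    using finite_strict_bound[of Z t] by blast
  show False
  proof (rule not_good_for_games_if_solitary[OF gfg game _ S'(1) a(1)])
    show "positions ?G \<subseteq> owned ?G ?O" by simp
  next
    fix p assume "play ?G p"
    then obtain u where u: "u \<in> T" "u \<in> F" "out_word ?G p = FinSeq u" using G_play by blast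
    have "g u \<in> Z" using T_len[OF u(1)] unfolding Z_def by blast
    then show "if P = Eve then ereal t \<le> payoff ?G (OnFin g) p else payoff ?G (OnFin g) p \<le> ereal a"
      using u a(2) by (cases P) (auto simp: payoff_def F_def)
  next
    fix p assume "play (product ?G A) p" "follows S' p"
    then obtain l where l: "l \<in> S" "fin l" "unfin l" "out_word (product ?G A) p = FinSeq (map snd (labs ?L l))"
      using S'(2) by blast
    have "length (labs ?L l) \<le> N"
      using letters_length[OF SL(1)[OF l(1)]] N[OF l(1,3)] by (simp add: letters_eq[of l ?O A])
    then have "v (map snd (labs ?L l)) \<in> Z"
      unfolding Z_def using letter_weights_subset[OF SL(1)[OF l(1)]] by auto
    then show "if P = Eve then payoff (product ?G A) (OnFin v) p \<le> ereal a
      else ereal t \<le> payoff (product ?G A) (OnFin v) p"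
      using l a(2) unfolding fin_def by (cases P) (auto simp: payoff_def not_le not_less)
  qed
qed

section \<open>Games on infinite words\<close>

lemma word_game_simps [simp]:
  "init_pos (word_game A w) = State 0 (start A)"
  "edges (word_game A w) = {(s, s'). word_edge A w s s'}"
  "edge_label (word_game A w) = weight_label"
  "positions (word_game A w) = UNIV"
  by (simp_all add: word_game_def)

inductive_simps word_edge_State: "word_edge A w (State i q) s"
inductive_simps word_edge_Choice: "word_edge A w (Choice i \<phi>) s"

lemma word_owned [simp]:
  "State i q \<in> owned (word_game A w) P \<longleftrightarrow> P = Adam"
  "Choice i (Or \<phi> \<psi>) \<in> owned (word_game A w) P \<longleftrightarrow> P = Eve"
  "Choice i (And \<phi> \<psi>) \<in> owned (word_game A w) P \<longleftrightarrow> P = Adam"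
  "Choice i (Atom x) \<in> owned (word_game A w) P \<longleftrightarrow> P = Adam"
  by (cases P; auto simp: word_game_def)+

lemma word_edge_ex: "\<exists>s'. word_edge A (InfSeq w) s s'"
proof (cases s)
  case (State i q)
  then show ?thesis by (auto simp: word_edge_State)
next
  case (Choice i \<phi>)
  then show ?thesis by (cases \<phi>) (auto simp: word_edge_Choice)
qed

lemma finite_word_edge: "finite {s. word_edge A (InfSeq w) s0 s}"
proof (cases s0)
  case (State i q)
  then have "{s. word_edge A (InfSeq w) s0 s} \<subseteq> {Choice (Suc i) (delta A q (w i))}"
    by (auto simp: word_edge_State)
  then show ?thesis using finite_subset by blast
next
  case (Choice i \<phi>)
  have "{s. word_edge A (InfSeq w) s0 s} \<subseteq> Choice i ` {\<psi>. resolve \<phi> \<psi>} \<union> (State i \<circ> snd) ` set_pbf \<phi>"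
    using Choice by (auto simp: word_edge_Choice image_iff)
  then show ?thesis by (rule finite_subset) (simp add: finite_resolve finite_set_pbf)
qed

lemma partial_play_snoc_word:
  "h \<noteq> [] \<Longrightarrow> partial_play (word_game A w) (h @ [s])
     \<longleftrightarrow> partial_play (word_game A w) h \<and> word_edge A w (last h) s"
  using partial_play_snoc[of h "word_game A w" s] by simp

lemma word_partial_play:
  fixes A :: "('a, 'q) automaton"
  assumes "partial_play (word_game A (InfSeq w)) h"
  shows "(case last h of State i q \<Rightarrow> length (labs (word_game A (InfSeq w)) h) = i
      | Choice i \<phi> \<Rightarrow> Suc (length (labs (word_game A (InfSeq w)) h)) = i \<and> fst ` set_pbf \<phi> \<subseteq> weights A)
    \<and> set (labs (word_game A (InfSeq w)) h) \<subseteq> weights A \<and> length (labs (word_game A (InfSeq w)) h) < length h"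
  using assms
proof (induction h rule: rev_induct)
  case (snoc s h)
  let ?W = "word_game A (InfSeq w)"
  show ?case
  proof (cases "h = []")
    case True
    then show ?thesis using snoc.prems by simp
  next
    case False
    have pp: "partial_play ?W h" "word_edge A (InfSeq w) (last h) s"
      using snoc.prems partial_play_snoc_word[OF False] by blast+
    note IH = snoc.IH[OF pp(1)]
    from pp(2) show ?thesis
    proof cases
      case (1 i a q)
      then show ?thesis using IH labs_snoc[OF False, of ?W s] by (auto simp: weights_def)
    next
      case (2 \<phi> \<psi> i)
      then show ?thesis using IH labs_snoc[OF False, of ?W s] resolve_set by fastforce
    next
      case (3 i x q)
      then show ?thesis using IH labs_snoc[OF False, of ?W s] by auto
    qed
  qed
qed (simp add: partial_play_def)

lemma word_play_InfSeq:
  fixes A :: "('a, 'q) automaton"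
  assumes p: "play (word_game A (InfSeq w)) p"
  obtains q \<pi> where "p = InfSeq q" "out_word (word_game A (InfSeq w)) p = InfSeq \<pi>"
    "\<And>n. labs (word_game A (InfSeq w)) (pre q n) = pre \<pi> (length (labs (word_game A (InfSeq w)) (pre q n)))"
    "\<And>n. \<exists>m. length (labs (word_game A (InfSeq w)) (pre q m)) = n" "range \<pi> \<subseteq> weights A"
proof -
  let ?W = "word_game A (InfSeq w)"
  have no: False if "play ?W (FinSeq h)" for h using that word_edge_ex[of A w "last h"] by auto
  then obtain q where q: "p = InfSeq q" using assms by (cases p) auto
  have pp: "partial_play ?W (pre q (Suc n))" for n
    using play_pref[OF p, of n] unfolding q pref_InfSeq_pre .
  have edge: "word_edge A (InfSeq w) (q n) (q (Suc n))" for n using p q by simp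
  have reach: "\<exists>m st. q m = State n st" for n
  proof (induction n)
    case 0
    have "q 0 = State 0 (start A)" using p q by simp
    then show ?case by blast
  next
    case (Suc n)
    have down: "\<exists>m st. q m = State i st" if "q m = Choice i \<phi>" for m i \<phi>
      using that
    proof (induction \<phi> arbitrary: m rule: measure_induct_rule[of size])
      case (less \<phi>)
      from edge[of m] less.prems consider \<psi> where "q (Suc m) = Choice i \<psi>" "resolve \<phi> \<psi>"
        | st where "q (Suc m) = State i st" by (auto simp: word_edge_Choice)
      then show ?case using less.IH resolve_size by cases blast+
    qed
    obtain m st where "q m = State n st" using Suc by blast
    then have "q (Suc m) = Choice (Suc n) (delta A st (w n))"
      using edge[of m] by (auto simp: word_edge_State)
    then show ?case using down by blast
  qed
  have len: "\<exists>m. length (labs ?W (pre q m)) = n" for n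
  proof -
    obtain m st where "q m = State n st" using reach by blast
    then show ?thesis using word_partial_play[OF pp[of m]] by (intro exI[of _ "Suc m"]) simp
  qed
  have lim: "tends_to (\<lambda>n. labs ?W (pre q n)) (out_word ?W p)"
    unfolding tends_to_def
  proof
    fix k
    obtain N where N: "\<And>n. n \<ge> N \<Longrightarrow> take k (labs ?W (pre q (Suc n))) = pref (out_word ?W p) k"
      using tends_to_out_word[of ?W p] unfolding q pref_InfSeq_pre tends_to_def by blast
    have "take k (labs ?W (pre q n)) = pref (out_word ?W p) k" if "n \<ge> Suc N" for n
      using N[of "n - 1"] that by (cases n) auto
    then show "\<exists>N. \<forall>n\<ge>N. take k (labs ?W (pre q n)) = pref (out_word ?W p) k" by blast
  qed
  have chain: "prefix (labs ?W (pre q n)) (labs ?W (pre q (Suc n)))" for n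
    by (intro labs_prefix prefix_pre) simp
  obtain \<pi> where \<pi>: "out_word ?W p = InfSeq \<pi>"
  proof (cases "out_word ?W p")
    case (FinSeq u)
    then obtain N where N: "\<And>n. n \<ge> N \<Longrightarrow> labs ?W (pre q n) = u" using tends_to_FinSeq lim by metis
    obtain m where m: "length (labs ?W (pre q m)) = Suc (length u)" using len by blast
    have "prefix (labs ?W (pre q m)) (labs ?W (pre q (max m N)))"
      by (intro labs_prefix prefix_pre) simp
    then show ?thesis using prefix_length_le N[of "max m N"] m by fastforce
  qed auto
  have eq: "labs ?W (pre q n) = pre \<pi> (length (labs ?W (pre q n)))" for n
    using chain_eq_pref[OF chain lim, of n] unfolding \<pi> pref_InfSeq_pre .
  have "range \<pi> \<subseteq> weights A"
  proof
    fix x assume "x \<in> range \<pi>"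
    then obtain i where i: "x = \<pi> i" by blast
    obtain m where m: "length (labs ?W (pre q m)) = Suc i" using len by blast
    then have "labs ?W (pre q m) = pre \<pi> (Suc i)" using eq[of m] by simp
    then have "x \<in> set (labs ?W (pre q m))" using i by simp
    moreover obtain m' where "m = Suc m'" using m by (cases m) (auto simp: labs_def)
    ultimately show "x \<in> weights A" using word_partial_play[OF pp[of m']] by auto
  qed
  then show thesis using that[OF q \<pi> eq len] by blast
qed

lemma word_tree_State:
  assumes "tree (word_game A (InfSeq w)) P S" "h \<in> S" "last h = State i q"
  shows "h @ [Choice (Suc i) (delta A q (w i))] \<in> S"
proof -
  obtain s where s: "h @ [s] \<in> S"
    using tree_ext[OF assms(1,2)] word_edge_ex[of A w "last h"] by auto
  have "h \<noteq> []" using partial_play_nonempty[OF tree_partial_play[OF assms(1,2)]] .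
  then have "word_edge A (InfSeq w) (State i q) s"
    using tree_partial_play[OF assms(1) s] partial_play_snoc_word assms(3) by metis
  then show ?thesis using s by (auto simp: word_edge_State)
qed

lemma word_tree_Atom:
  assumes "tree (word_game A (InfSeq w)) P S" "h \<in> S" "last h = Choice i (Atom (x, q))"
  shows "h @ [State i q] \<in> S"
proof -
  obtain s where s: "h @ [s] \<in> S"
    using tree_ext[OF assms(1,2)] word_edge_ex[of A w "last h"] by auto
  have "h \<noteq> []" using partial_play_nonempty[OF tree_partial_play[OF assms(1,2)]] .
  then have "word_edge A (InfSeq w) (Choice i (Atom (x, q))) s"
    using tree_partial_play[OF assms(1) s] partial_play_snoc_word assms(3) by metis
  then show ?thesis using s by (auto simp: word_edge_Choice)
qed

lemma word_tree_Or:
  assumes "tree (word_game A (InfSeq w)) P S" "h \<in> S" "last h = Choice i (Or \<phi> \<psi>)"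
  shows "if P = Eve then h @ [Choice i \<phi>] \<in> S \<or> h @ [Choice i \<psi>] \<in> S
      else h @ [Choice i \<phi>] \<in> S \<and> h @ [Choice i \<psi>] \<in> S"
  by (rule tree_choice[OF assms(1,2)], simp only: assms(3) word_owned)
    (auto simp: assms(3) word_edge_Choice)

lemma word_tree_And:
  assumes "tree (word_game A (InfSeq w)) P S" "h \<in> S" "last h = Choice i (And \<phi> \<psi>)"
  shows "if P = Adam then h @ [Choice i \<phi>] \<in> S \<or> h @ [Choice i \<psi>] \<in> S
      else h @ [Choice i \<phi>] \<in> S \<and> h @ [Choice i \<psi>] \<in> S"
  by (rule tree_choice[OF assms(1,2)], simp only: assms(3) word_owned)
    (auto simp: assms(3) word_edge_Choice)

text \<open>The predicate transformer of resolving a formula. \<open>tree_forces\<close> obtains it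
  from a tree of \<open>P\<close>, and \<open>forces_tree\<close> realizes it against any tree of
  the opponent.\<close>

fun forces :: "player \<Rightarrow> 'p pbf \<Rightarrow> ('p \<Rightarrow> bool) \<Rightarrow> bool" where
  "forces P (Atom y) X = X y"
| "forces P (Or \<phi> \<psi>) X = (if P = Eve then forces P \<phi> X \<or> forces P \<psi> X else forces P \<phi> X \<and> forces P \<psi> X)"
| "forces P (And \<phi> \<psi>) X = (if P = Adam then forces P \<phi> X \<or> forces P \<psi> X else forces P \<phi> X \<and> forces P \<psi> X)"

lemma forces_mono: "forces P \<phi> X \<Longrightarrow> (\<And>y. X y \<Longrightarrow> Y y) \<Longrightarrow> forces P \<phi> Y"
  by (induction \<phi>) (auto split: if_splits)

lemma tree_forces:
  assumes S: "tree (word_game A (InfSeq w)) P S"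
  shows "h \<in> S \<Longrightarrow> last h = Choice i \<phi> \<Longrightarrow> forces P \<phi> (\<lambda>(x, q). \<exists>h'\<in>S. prefix h h' \<and> last h' = State i q
    \<and> labs (word_game A (InfSeq w)) h' = labs (word_game A (InfSeq w)) h @ [x])"
proof (induction \<phi> arbitrary: h)
  case (Atom y)
  obtain x q where y: "y = (x, q)" by (metis surj_pair)
  have ne: "h \<noteq> []" using partial_play_nonempty[OF tree_partial_play[OF S Atom(1)]] .
  have "h @ [State i q] \<in> S" using word_tree_Atom[OF S Atom(1)] Atom(2) y by blast
  then show ?case using Atom(2) y labs_snoc[OF ne, of "word_game A (InfSeq w)" "State i q"]
    by (auto intro!: bexI[of _ "h @ [State i q]"])
next
  case (Or \<phi> \<psi>)
  have ne: "h \<noteq> []" using partial_play_nonempty[OF tree_partial_play[OF S Or.prems(1)]] .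
  let ?Y = "\<lambda>h (x, q). \<exists>h'\<in>S. prefix h h' \<and> last h' = State i q
    \<and> labs (word_game A (InfSeq w)) h' = labs (word_game A (InfSeq w)) h @ [x]"
  have sub: "forces P \<theta> (?Y h)" if "forces P \<theta> (?Y (h @ [Choice i \<theta>]))" for \<theta>
    using that by (rule forces_mono)
      (use labs_snoc[OF ne, of "word_game A (InfSeq w)"] Or.prems(2) in \<open>auto dest: append_prefixD\<close>)
  show ?case
    using word_tree_Or[OF S Or.prems] sub Or.IH(1)[of "h @ [Choice i \<phi>]"] Or.IH(2)[of "h @ [Choice i \<psi>]"]
    by (auto split: if_splits)
next
  case (And \<phi> \<psi>)
  have ne: "h \<noteq> []" using partial_play_nonempty[OF tree_partial_play[OF S And.prems(1)]] .
  let ?Y = "\<lambda>h (x, q). \<exists>h'\<in>S. prefix h h' \<and> last h' = State i q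
    \<and> labs (word_game A (InfSeq w)) h' = labs (word_game A (InfSeq w)) h @ [x]"
  have sub: "forces P \<theta> (?Y h)" if "forces P \<theta> (?Y (h @ [Choice i \<theta>]))" for \<theta>
    using that by (rule forces_mono)
      (use labs_snoc[OF ne, of "word_game A (InfSeq w)"] And.prems(2) in \<open>auto dest: append_prefixD\<close>)
  show ?case
    using word_tree_And[OF S And.prems] sub And.IH(1)[of "h @ [Choice i \<phi>]"] And.IH(2)[of "h @ [Choice i \<psi>]"]
    by (auto split: if_splits)
qed

lemma forces_tree:
  assumes S: "tree (word_game A (InfSeq w)) (opponent P) S"
  shows "h \<in> S \<Longrightarrow> last h = Choice i \<phi> \<Longrightarrow> forces P \<phi> X \<Longrightarrow>
    \<exists>h'\<in>S. \<exists>x q. prefix h h' \<and> last h' = State i q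
      \<and> labs (word_game A (InfSeq w)) h' = labs (word_game A (InfSeq w)) h @ [x] \<and> X (x, q)"
proof (induction \<phi> arbitrary: h)
  case (Atom y)
  obtain x q where y: "y = (x, q)" by (metis surj_pair)
  have ne: "h \<noteq> []" using partial_play_nonempty[OF tree_partial_play[OF S Atom(1)]] .
  have "h @ [State i q] \<in> S" using word_tree_Atom[OF S Atom(1)] Atom(2) y by blast
  then show ?case using Atom(2,3) y labs_snoc[OF ne, of "word_game A (InfSeq w)" "State i q"]
    by (intro bexI[of _ "h @ [State i q]"] exI[of _ x] exI[of _ q]) auto
next
  case (Or \<phi> \<psi>)
  have ne: "h \<noteq> []" using partial_play_nonempty[OF tree_partial_play[OF S Or.prems(1)]] .
  have "\<exists>\<theta>\<in>{\<phi>, \<psi>}. h @ [Choice i \<theta>] \<in> S \<and> forces P \<theta> X"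
    using word_tree_Or[OF S Or.prems(1,2)] Or.prems(3) by (cases P) auto
  then obtain \<theta> h' x q where "\<theta> \<in> {\<phi>, \<psi>}" "h' \<in> S" "prefix (h @ [Choice i \<theta>]) h'" "last h' = State i q"
    "labs (word_game A (InfSeq w)) h' = labs (word_game A (InfSeq w)) (h @ [Choice i \<theta>]) @ [x]" "X (x, q)"
    using Or.IH(1)[of "h @ [Choice i \<phi>]"] Or.IH(2)[of "h @ [Choice i \<psi>]"] by fastforce
  then show ?case
    using labs_snoc[OF ne, of "word_game A (InfSeq w)"] Or.prems(2) by (auto dest: append_prefixD)
next
  case (And \<phi> \<psi>)
  have ne: "h \<noteq> []" using partial_play_nonempty[OF tree_partial_play[OF S And.prems(1)]] .
  have "\<exists>\<theta>\<in>{\<phi>, \<psi>}. h @ [Choice i \<theta>] \<in> S \<and> forces P \<theta> X"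
    using word_tree_And[OF S And.prems(1,2)] And.prems(3) by (cases P) auto
  then obtain \<theta> h' x q where "\<theta> \<in> {\<phi>, \<psi>}" "h' \<in> S" "prefix (h @ [Choice i \<theta>]) h'" "last h' = State i q"
    "labs (word_game A (InfSeq w)) h' = labs (word_game A (InfSeq w)) (h @ [Choice i \<theta>]) @ [x]" "X (x, q)"
    using And.IH(1)[of "h @ [Choice i \<phi>]"] And.IH(2)[of "h @ [Choice i \<psi>]"] by fastforce
  then show ?case
    using labs_snoc[OF ne, of "word_game A (InfSeq w)"] And.prems(2) by (auto dest: append_prefixD)
qed

section \<open>The transition semigroup of a monitored automaton\<close>

text \<open>The flag records only monitor states reached after a weight has been read, not the
  initial one, so that different blocks exhibit different visits.\<close>

fun track :: "(bool \<Rightarrow> rat \<Rightarrow> bool) \<Rightarrow> bool \<times> bool \<Rightarrow> rat list \<Rightarrow> bool \<times> bool" where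
  "track upd bs [] = bs"
| "track upd (b, s) (x # xs) = track upd (upd b x, s \<or> upd b x) xs"

text \<open>In a state \<open>(q, b, s)\<close>, \<open>q\<close> is the state of the automaton, \<open>b\<close> the one of the monitor, and \<open>s\<close> tells
  whether the latter has been true at some point of the current block of letters.\<close>

fun wp :: "('a, 'q) automaton \<Rightarrow> player \<Rightarrow> (bool \<Rightarrow> rat \<Rightarrow> bool) \<Rightarrow> 'a list
    \<Rightarrow> ('q \<times> bool \<times> bool \<Rightarrow> bool) \<Rightarrow> 'q \<times> bool \<times> bool \<Rightarrow> bool" where
  "wp A P upd [] X = X"
| "wp A P upd (a # u) X = (\<lambda>(q, b, s). forces P (delta A q a)
     (\<lambda>(x, q'). wp A P upd u X (q', upd b x, s \<or> upd b x)))"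

text \<open>Makes \<open>wp\<close> a morphism from words to predicate transformers. Over finitely
  many states there are finitely many of them, as Ramsey's theorem requires.\<close>

lemma wp_append: "wp A P upd (u @ u') X = wp A P upd u (wp A P upd u' X)"
  by (induction u) auto

lemma wp_mono: "wp A P upd u X r \<Longrightarrow> (\<And>r. X r \<Longrightarrow> Y r) \<Longrightarrow> wp A P upd u Y r"
proof (induction u arbitrary: r)
  case (Cons a u)
  then show ?case by (cases r) (auto elim!: forces_mono)
qed simp

lemma fst_track: "fst (track upd (b, s) xs) = foldl upd b xs"
  by (induction xs arbitrary: b s) auto

lemma snd_track: "snd (track upd (b, s) xs) \<longleftrightarrow> s \<or> (\<exists>j<length xs. foldl upd b (take (Suc j) xs))"
proof (induction xs arbitrary: b s)
  case (Cons x xs)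
  have "(\<exists>j<length (x # xs). foldl upd b (take (Suc j) (x # xs))) \<longleftrightarrow>
      upd b x \<or> (\<exists>j<length xs. foldl upd (upd b x) (take (Suc j) xs))" (is "?L \<longleftrightarrow> ?R")
  proof
    assume ?L
    then obtain j where "j < Suc (length xs)" "foldl upd (upd b x) (take j xs)" by auto
    then show ?R by (cases j) auto
  next
    assume ?R
    then show ?L by (metis Suc_less_eq foldl_Cons foldl_Nil length_Cons take0 take_Suc_Cons zero_less_Suc)
  qed
  then show ?case using Cons by simp
qed simp

abbreviation seg :: "(nat \<Rightarrow> 'a) \<Rightarrow> nat \<Rightarrow> nat \<Rightarrow> 'a list" where
  "seg w i j \<equiv> map w [i..<j]"

text \<open>The predicate collects all that the tree reaches after \<open>n\<close> letters, so no
  goal has to be fixed in the induction; \<open>wp_mono\<close> replaces it later.\<close>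

lemma tree_wp:
  assumes S: "tree (word_game A (InfSeq w)) P S"
  shows "h \<in> S \<Longrightarrow> last h = State i q \<Longrightarrow>
    wp A P upd (seg w i (i + n)) (\<lambda>(q', bs). \<exists>h'\<in>S. \<exists>xs. prefix h h' \<and> last h' = State (i + n) q'
      \<and> labs (word_game A (InfSeq w)) h' = labs (word_game A (InfSeq w)) h @ xs
      \<and> bs = track upd (b, s) xs) (q, b, s)"
proof (induction n arbitrary: h i q b s)
  case 0
  then show ?case by force
next
  case (Suc n)
  let ?W = "word_game A (InfSeq w)"
  let ?h = "h @ [Choice (Suc i) (delta A q (w i))]"
  have ne: "h \<noteq> []" using partial_play_nonempty[OF tree_partial_play[OF S Suc.prems(1)]] .
  have h: "?h \<in> S" using word_tree_State[OF S Suc.prems] .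
  have labs: "labs ?W ?h = labs ?W h" using labs_snoc[OF ne, of ?W] Suc.prems(2) by simp
  let ?Z = "\<lambda>(q', bs). \<exists>h'\<in>S. \<exists>xs. prefix h h' \<and> last h' = State (i + Suc n) q'
      \<and> labs ?W h' = labs ?W h @ xs \<and> bs = track upd (b, s) xs"
  have "forces P (delta A q (w i)) (\<lambda>(x, q'). wp A P upd (seg w (Suc i) (i + Suc n)) ?Z (q', upd b x, s \<or> upd b x))"
  proof (rule forces_mono[OF tree_forces[OF S h]])
    fix y assume "case y of (x, q') \<Rightarrow> \<exists>h'\<in>S. prefix ?h h' \<and> last h' = State (Suc i) q' \<and> labs ?W h' = labs ?W ?h @ [x]"
    then obtain x q' h' where y: "y = (x, q')" and h': "h' \<in> S" "prefix ?h h'" "last h' = State (Suc i) q'"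
      "labs ?W h' = labs ?W h @ [x]" using labs by auto
    have "wp A P upd (seg w (Suc i) (Suc i + n)) ?Z (q', upd b x, s \<or> upd b x)"
    proof (rule wp_mono[OF Suc.IH[OF h'(1,3)]])
      fix r assume "case r of (q'', bs) \<Rightarrow> \<exists>h''\<in>S. \<exists>xs. prefix h' h'' \<and> last h'' = State (Suc i + n) q''
        \<and> labs ?W h'' = labs ?W h' @ xs \<and> bs = track upd (upd b x, s \<or> upd b x) xs"
      then obtain q'' bs h'' xs where r: "r = (q'', bs)" "h'' \<in> S" "prefix h' h''" "last h'' = State (Suc i + n) q''"
        "labs ?W h'' = labs ?W h' @ xs" "bs = track upd (upd b x, s \<or> upd b x) xs" by auto
      have "prefix h h''" using h'(2) r(3) by (meson append_prefixD prefix_order.trans)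
      then show "?Z r" using r h'(4) by (auto intro!: bexI[OF _ r(2)] exI[of _ "x # xs"])
    qed
    then show "case y of (x, q') \<Rightarrow> wp A P upd (seg w (Suc i) (i + Suc n)) ?Z (q', upd b x, s \<or> upd b x)"
      using y by simp
  qed simp
  moreover have "seg w i (i + Suc n) = w i # seg w (Suc i) (i + Suc n)"
    by (subst upt_conv_Cons) auto
  ultimately show ?case by (simp del: upt_Suc add_Suc_right)
qed

text \<open>Dual to \<open>tree_wp\<close>: against a tree of the opponent, what \<open>P\<close>
  can force is met by some partial play.\<close>

lemma wp_tree:
  assumes S: "tree (word_game A (InfSeq w)) (opponent P) S"
  shows "h \<in> S \<Longrightarrow> last h = State i q \<Longrightarrow> wp A P upd (seg w i (i + n)) X (q, b, s) \<Longrightarrow>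
    \<exists>h'\<in>S. \<exists>q' xs. prefix h h' \<and> last h' = State (i + n) q'
      \<and> labs (word_game A (InfSeq w)) h' = labs (word_game A (InfSeq w)) h @ xs
      \<and> X (q', track upd (b, s) xs)"
proof (induction n arbitrary: h i q b s)
  case 0
  then show ?case by (intro bexI[OF _ 0(1)] exI[of _ q] exI[of _ "[]"]) simp
next
  case (Suc n)
  let ?W = "word_game A (InfSeq w)"
  let ?h = "h @ [Choice (Suc i) (delta A q (w i))]"
  have ne: "h \<noteq> []" using partial_play_nonempty[OF tree_partial_play[OF S Suc.prems(1)]] .
  have h: "?h \<in> S" using word_tree_State[OF S Suc.prems(1,2)] .
  have labs: "labs ?W ?h = labs ?W h" using labs_snoc[OF ne, of ?W] Suc.prems(2) by simp
  have "seg w i (i + Suc n) = w i # seg w (Suc i) (Suc i + n)"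
    by (subst upt_conv_Cons) auto
  then have "forces P (delta A q (w i)) (\<lambda>(x, q'). wp A P upd (seg w (Suc i) (Suc i + n)) X (q', upd b x, s \<or> upd b x))"
    using Suc.prems(3) by (simp del: upt_Suc add_Suc_right)
  from forces_tree[OF S h _ this, of "Suc i"] obtain h' x q' where h': "h' \<in> S" "prefix ?h h'"
    "last h' = State (Suc i) q'" "labs ?W h' = labs ?W h @ [x]"
    "wp A P upd (seg w (Suc i) (Suc i + n)) X (q', upd b x, s \<or> upd b x)"
    using labs by auto
  from Suc.IH[OF h'(1,3,5)] obtain h'' q'' xs where h'': "h'' \<in> S" "prefix h' h''"
    "last h'' = State (Suc i + n) q''" "labs ?W h'' = labs ?W h' @ xs"
    "X (q'', track upd (upd b x, s \<or> upd b x) xs)" by blast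
  have "prefix h h''" using h'(2) h''(2) by (meson append_prefixD prefix_order.trans)
  then show ?case using h'' h'(4) by (intro bexI[OF _ h''(1)] exI[of _ q''] exI[of _ "x # xs"]) simp
qed

section \<open>Acceptance in terms of blocks of letters\<close>

lemma pre_prefix_closed_play:
  assumes "\<And>n. pre q (Suc n) \<in> S" "tree (word_game A (InfSeq w)) P S"
  shows "play (word_game A (InfSeq w)) (InfSeq q)" "follows S (InfSeq q)"
proof -
  show "play (word_game A (InfSeq w)) (InfSeq q)"
    unfolding play_InfSeq_iff using tree_partial_play[OF assms(2,1)] by (simp add: pre_def del: upt_Suc)
  show "follows S (InfSeq q)" unfolding follows_def pref_InfSeq_pre using assms(1) by blast
qed

text \<open>\<open>V\<close> is a certificate that \<open>P\<close> can make the monitor true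
  infinitely often: from each pair in \<open>V k\<close> at the start of block \<open>k\<close>,
  \<open>P\<close> can reach some later \<open>V k'\<close> with the monitor true on the way. It
  refers to \<open>w\<close> only through the transformers of its blocks.\<close>

definition accepts_block ::
    "('a, 'q) automaton \<Rightarrow> player \<Rightarrow> (bool \<Rightarrow> rat \<Rightarrow> bool) \<Rightarrow> bool \<Rightarrow> (nat \<Rightarrow> 'a) \<Rightarrow> (nat \<Rightarrow> nat) \<Rightarrow> bool" where
  "accepts_block A P upd b0 w m \<longleftrightarrow> (\<exists>V. (start A, b0) \<in> V 0 \<and> (\<forall>k. \<forall>(q, b)\<in>V k. \<exists>k'>k.
     wp A P upd (seg w (m k) (m k')) (\<lambda>(q', b', s). s \<and> (q', b') \<in> V k') (q, b, False)))"

text \<open>By compactness, the time until the monitor is true again is bounded uniformly over all plays following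
  the tree, so a single \<open>k'\<close> serves all of them.\<close>

lemma accepts_block_if_tree:
  assumes m: "strict_mono m" "m 0 = 0"
    and S: "tree (word_game A (InfSeq w)) P S" "prefix_closed S"
    and acc: "\<And>p \<pi>. play (word_game A (InfSeq w)) p \<Longrightarrow> follows S p
      \<Longrightarrow> out_word (word_game A (InfSeq w)) p = InfSeq \<pi> \<Longrightarrow> \<exists>\<^sub>\<infinity>j. foldl upd b0 (pre \<pi> j)"
  shows "accepts_block A P upd b0 w m"
proof -
  let ?W = "word_game A (InfSeq w)"
  have SL: "partial_play ?W h" "h \<noteq> []" if "h \<in> S" for h
    using tree_partial_play[OF S(1) that] partial_play_nonempty by blast+
  define V where "V k = {(q, b). \<exists>h\<in>S. last h = State (m k) q \<and> b = foldl upd b0 (labs ?W h)}" for k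
  have step: "\<exists>k'>k. wp A P upd (seg w (m k) (m k')) (\<lambda>(q', b', s). s \<and> (q', b') \<in> V k') (q, b, False)"
    if qb: "(q, b) \<in> V k" for k q b
  proof -
    obtain h where h: "h \<in> S" "last h = State (m k) q" "b = foldl upd b0 (labs ?W h)"
      using qb by (auto simp: V_def)
    define unseen where "unseen g \<longleftrightarrow> (\<forall>j. length (labs ?W h) < j \<longrightarrow> j \<le> length (labs ?W g) \<longrightarrow>
      \<not> foldl upd b0 (take j (labs ?W g)))" for g
    have "\<exists>k'>k. \<forall>h'\<in>S. prefix h h' \<longrightarrow> (\<exists>q'. last h' = State (m k') q') \<longrightarrow> \<not> unseen h'"
    proof (rule ccontr)
      assume no: "\<not> ?thesis"
      \<comment> \<open>The initial segments of \<open>h\<close> are included since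
        \<open>koenig\<close> starts from the empty list.\<close>
      define X where "X = {g. prefix g h \<or> prefix h g \<and> g \<in> S \<and> unseen g}"
      have "\<exists>q. \<forall>n. pre q n \<in> X"
      proof (rule koenig)
        fix g s assume g: "g @ [s] \<in> X"
        show "g \<in> X"
        proof (cases "prefix h g")
          case True
          then have "g \<noteq> []" using SL h(1) by auto
          moreover have "prefix (labs ?W g) (labs ?W (g @ [s]))" by (intro labs_prefix) simp
          ultimately show ?thesis
            using g True S(2) unfolding X_def unseen_def prefix_closed_def
            by (fastforce simp: prefix_def)
        next
          case False
          then show ?thesis using g by (auto simp: X_def dest: append_prefixD)
        qed
      next
        fix g assume g: "g \<in> X"
        have "{s. g @ [s] \<in> X} \<subseteq> {s. prefix (g @ [s]) h} \<union> {s. g \<noteq> [] \<and> g @ [s] \<in> S} \<union> {s. h = [s]}"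
          using SL(2)[OF h(1)] by (auto simp: X_def prefix_Cons)
        moreover have "finite {s. prefix (g @ [s]) h}"
        proof -
          have "{s. prefix (g @ [s]) h} \<subseteq> {h ! length g}" by (auto simp: prefix_def)
          then show ?thesis using finite_subset by blast
        qed
        moreover have "finite {s. g \<noteq> [] \<and> g @ [s] \<in> S}"
        proof -
          have "{s. g \<noteq> [] \<and> g @ [s] \<in> S} \<subseteq> {s. word_edge A (InfSeq w) (last g) s}"
          proof
            fix s assume "s \<in> {s. g \<noteq> [] \<and> g @ [s] \<in> S}"
            then show "s \<in> {s. word_edge A (InfSeq w) (last g) s}"
              using SL(1)[of "g @ [s]"] by (simp add: partial_play_snoc_word)
          qed
          then show ?thesis using finite_word_edge finite_subset by blast
        qed
        moreover have "finite {s. h = [s]}" by (rule finite_subset[of _ "{hd h}"]) auto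
        ultimately show "finite {s. g @ [s] \<in> X}" using finite_subset by blast
      next
        fix n
        obtain h' q' where h': "h' \<in> S" "prefix h h'" "last h' = State (m (Suc (max n k))) q'" "unseen h'"
          using no by (meson less_Suc_eq_le max.cobounded2)
        have "Suc (max n k) \<le> m (Suc (max n k))" using strict_mono_imp_increasing[OF m(1)] .
        also have "\<dots> = length (labs ?W h')" using word_partial_play[OF SL(1)[OF h'(1)]] h'(3) by simp
        also have "\<dots> < length h'" using word_partial_play[OF SL(1)[OF h'(1)]] by blast
        finally have "n \<le> length h'" by simp
        then show "\<exists>h\<in>X. n \<le> length h" using h' unfolding X_def by blast
      qed
      then obtain p where p: "\<And>n. pre p n \<in> X" by blast
      have long: "prefix h (pre p n)" "pre p n \<in> S" "unseen (pre p n)" if "n > length h" for n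
        using p[of n] that by (auto simp: X_def dest: prefix_length_le)
      have pS: "pre p (Suc n) \<in> S" for n
      proof (rule prefix_closed_prefix[OF S(2)])
        show "pre p (max (Suc n) (Suc (length h))) \<in> S" by (rule long(2)) simp
        show "prefix (pre p (Suc n)) (pre p (max (Suc n) (Suc (length h))))" by (rule prefix_pre) simp
      qed simp
      note play = pre_prefix_closed_play[OF pS S(1)]
      obtain p' \<pi> where p': "InfSeq p = InfSeq p'" and \<pi>: "out_word ?W (InfSeq p) = InfSeq \<pi>"
        "\<And>n. labs ?W (pre p' n) = pre \<pi> (length (labs ?W (pre p' n)))"
        "\<And>n. \<exists>m. length (labs ?W (pre p' m)) = n"
        by (rule word_play_InfSeq[OF play(1)]) (rule that)
      have eq: "p' = p" using p' by simp
      obtain j where j: "j > length (labs ?W h)" "foldl upd b0 (pre \<pi> j)"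
        using acc[OF play \<pi>(1)] unfolding INFM_nat by blast
      obtain i where i: "length (labs ?W (pre p i)) = j" using \<pi>(3)[of j] eq by blast
      let ?g = "pre p (max i (Suc (length h)))"
      have "prefix (labs ?W (pre p i)) (labs ?W ?g)" by (intro labs_prefix prefix_pre) simp
      then have len: "j \<le> length (labs ?W ?g)" using i prefix_length_le by fastforce
      have "unseen ?g" by (rule long(3)) simp
      then have "\<not> foldl upd b0 (take j (labs ?W ?g))" using j(1) len unfolding unseen_def by blast
      moreover have "take j (labs ?W ?g) = pre \<pi> j"
        using \<pi>(2)[of "max i (Suc (length h))"] len eq take_pre[of j \<pi>] by (metis min.absorb1)
      ultimately show False using j(2) by (simp only: not_True_eq_False)
    qed
    then obtain k' where k': "k' > k"
      "\<And>h' q'. h' \<in> S \<Longrightarrow> prefix h h' \<Longrightarrow> last h' = State (m k') q' \<Longrightarrow> \<not> unseen h'" by blast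
    have mk: "m k + (m k' - m k) = m k'" using strict_monoD[OF m(1) k'(1)] by simp
    have "wp A P upd (seg w (m k) (m k')) (\<lambda>(q', b', s). s \<and> (q', b') \<in> V k') (q, b, False)"
    proof (rule wp_mono[OF tree_wp[OF S(1) h(1,2), where n = "m k' - m k", unfolded mk]])
      fix r assume "case r of (q', bs) \<Rightarrow> \<exists>h'\<in>S. \<exists>xs. prefix h h' \<and> last h' = State (m k') q'
        \<and> labs ?W h' = labs ?W h @ xs \<and> bs = track upd (b, False) xs"
      then obtain q' b' s h' xs where r: "r = (q', b', s)" "h' \<in> S" "prefix h h'" "last h' = State (m k') q'"
        "labs ?W h' = labs ?W h @ xs" "(b', s) = track upd (b, False) xs" by (cases r) auto
      have b': "b' = foldl upd b0 (labs ?W h')"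
        using arg_cong[OF r(6), of fst] r(5) h(3) by (simp add: fst_track)
      obtain j where j: "length (labs ?W h) < j" "j \<le> length (labs ?W h')" "foldl upd b0 (take j (labs ?W h'))"
        using k'(2)[OF r(2,3,4)] unfolding unseen_def by blast
      then obtain i where i: "j = length (labs ?W h) + Suc i"
        using less_imp_Suc_add[OF j(1)] by auto
      then have "foldl upd b (take (Suc i) xs)" "i < length xs" using j r(5) h(3) by auto
      then have "s" using arg_cong[OF r(6), of snd] by (auto simp: snd_track)
      then show "case r of (q', b', s) \<Rightarrow> s \<and> (q', b') \<in> V k'" using r b' by (auto simp: V_def)
    qed
    then show ?thesis using k'(1) by blast
  qed
  have "[State 0 (start A)] \<in> S" using tree_init[OF S(1)] by simp
  then have V0: "(start A, b0) \<in> V 0"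
    unfolding V_def mem_Collect_eq prod.case by (intro bexI[of _ "[State 0 (start A)]"]) (simp_all add: m(2))
  have "\<forall>(q, b)\<in>V k. \<exists>k'>k. wp A P upd (seg w (m k) (m k'))
      (\<lambda>(q', b', s). s \<and> (q', b') \<in> V k') (q, b, False)" for k
  proof (rule ballI)
    fix y assume "y \<in> V k"
    then show "case y of (q, b) \<Rightarrow> \<exists>k'>k. wp A P upd (seg w (m k) (m k'))
      (\<lambda>(q', b', s). s \<and> (q', b') \<in> V k') (q, b, False)" using step by (cases y) simp
  qed
  from conjI[OF V0 allI[OF this]] show ?thesis unfolding accepts_block_def by (rule exI[of _ V])
qed

text \<open>With a certificate \<open>V\<close>, \<open>wp_tree\<close> could extend a partial play
  in the opponent's tree again and again, each time by a new visit to a true monitor state. The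
  limit would contradict \<open>rej\<close>.\<close>

lemma not_accepts_block_if_opponent_tree:
  fixes A :: "('a, 'q) automaton"
  assumes m: "strict_mono m" "m 0 = 0"
    and S: "tree (word_game A (InfSeq w)) (opponent P) S" "prefix_closed S"
    and rej: "\<And>p \<pi>. play (word_game A (InfSeq w)) p \<Longrightarrow> follows S p
      \<Longrightarrow> out_word (word_game A (InfSeq w)) p = InfSeq \<pi> \<Longrightarrow> \<not> (\<exists>\<^sub>\<infinity>j. foldl upd b0 (pre \<pi> j))"
  shows "\<not> accepts_block A P upd b0 w m"
proof
  let ?W = "word_game A (InfSeq w)"
  assume "accepts_block A P upd b0 w m"
  then obtain V where V: "(start A, b0) \<in> V 0 \<and> (\<forall>k. \<forall>(q, b)\<in>V k. \<exists>k'>k.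
     wp A P upd (seg w (m k) (m k')) (\<lambda>(q', b', s). s \<and> (q', b') \<in> V k') (q, b, False))"
    unfolding accepts_block_def ..
  have V_step: "\<exists>k'>k. wp A P upd (seg w (m k) (m k')) (\<lambda>(q', b', s). s \<and> (q', b') \<in> V k') (q, b, False)"
    if "(q, b) \<in> V k" for k q b using bspec[OF spec[OF conjunct2[OF V], of k] that] by simp
  have SL: "partial_play ?W h" "h \<noteq> []" if "h \<in> S" for h
    using tree_partial_play[OF S(1) that] partial_play_nonempty by blast+
  define ok where "ok n x \<longleftrightarrow> (case x of (h, k) \<Rightarrow>
    h \<in> S \<and> (\<exists>q. last h = State (m k) q \<and> (q, foldl upd b0 (labs ?W h)) \<in> V k))" for n :: nat and x
  define next_ok where "next_ok n x y \<longleftrightarrow> (case x of (h, k) \<Rightarrow> case y of (h', k') \<Rightarrow> prefix h h' \<and> length h < length h'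
    \<and> (\<exists>j. length (labs ?W h) < j \<and> j \<le> length (labs ?W h') \<and> foldl upd b0 (take j (labs ?W h'))))"
    for n :: nat and x y :: "(nat, 'q) pos list \<times> nat"
  have "\<exists>c. \<forall>n. ok n (c n) \<and> next_ok n (c n) (c (Suc n))"
  proof (rule dependent_nat_choice)
    show "\<exists>x. ok 0 x"
      using conjunct1[OF V] tree_init[OF S(1)] m(2) by (intro exI[of _ "([State 0 (start A)], 0)"]) (simp add: ok_def)
  next
    fix x n assume x: "ok n x"
    obtain h k where hk: "x = (h, k)" by (metis surj_pair)
    then obtain q where h: "h \<in> S" "last h = State (m k) q" "(q, foldl upd b0 (labs ?W h)) \<in> V k"
      using x unfolding ok_def by auto
    obtain k' where k': "k' > k"
      "wp A P upd (seg w (m k) (m k')) (\<lambda>(q', b', s). s \<and> (q', b') \<in> V k') (q, foldl upd b0 (labs ?W h), False)"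
      using V_step[OF h(3)] by blast
    have mk: "m k + (m k' - m k) = m k'" using strict_monoD[OF m(1) k'(1)] by simp
    have "\<exists>h'\<in>S. \<exists>q' xs. prefix h h' \<and> last h' = State (m k') q' \<and> labs ?W h' = labs ?W h @ xs
      \<and> (\<lambda>(q', b', s). s \<and> (q', b') \<in> V k') (q', track upd (foldl upd b0 (labs ?W h), False) xs)"
      using wp_tree[OF S(1) h(1,2), where n = "m k' - m k", unfolded mk, OF k'(2)] .
    then obtain h' q' xs where h': "h' \<in> S" "prefix h h'" "last h' = State (m k') q'" "labs ?W h' = labs ?W h @ xs"
      "snd (track upd (foldl upd b0 (labs ?W h), False) xs)"
      "(q', fst (track upd (foldl upd b0 (labs ?W h), False) xs)) \<in> V k'" by (auto simp: case_prod_beta)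
    obtain j where j: "j < length xs" "foldl upd (foldl upd b0 (labs ?W h)) (take (Suc j) xs)"
      using h'(5) unfolding snd_track by blast
    have "foldl upd b0 (take (length (labs ?W h) + Suc j) (labs ?W h'))" using h'(4) j(2) by simp
    then have "\<exists>j. length (labs ?W h) < j \<and> j \<le> length (labs ?W h') \<and> foldl upd b0 (take j (labs ?W h'))"
      using h'(4) j(1) by (intro exI[of _ "length (labs ?W h) + Suc j"]) auto
    moreover have "length h < length h'"
    proof -
      have "h \<noteq> h'" using h'(4) j(1) by auto
      then show ?thesis using h'(2) by (auto simp: prefix_def)
    qed
    moreover have "ok (Suc n) (h', k')" using h' unfolding ok_def fst_track by simp
    ultimately show "\<exists>y. ok (Suc n) y \<and> next_ok n x y"
      using hk h'(2) unfolding next_ok_def by (intro exI[of _ "(h', k')"]) simp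
  qed
  then obtain c where c: "\<And>n. ok n (c n)" "\<And>n. next_ok n (c n) (c (Suc n))" by blast
  define g where "g n = fst (c n)" for n
  have gS: "g n \<in> S" for n using c(1)[of n] unfolding ok_def g_def by (auto split: prod.splits)
  have g: "prefix (g n) (g (Suc n))" "length (g n) < length (g (Suc n))"
    "\<exists>j. length (labs ?W (g n)) < j \<and> j \<le> length (labs ?W (g (Suc n))) \<and> foldl upd b0 (take j (labs ?W (g (Suc n))))"
    for n using c(2)[of n] unfolding next_ok_def g_def by (auto split: prod.splits)
  obtain p where p: "tends_to g p" using chain_limit[of g, OF g(1)] by blast
  have glen: "n \<le> length (g n)" for n
    by (induction n) (use g(2) in \<open>auto intro: Suc_leI le_less_trans\<close>)
  obtain q where q: "p = InfSeq q"
  proof (cases p)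
    case (FinSeq u)
    then obtain N where N: "\<And>n. n \<ge> N \<Longrightarrow> g n = u" using tends_to_FinSeq p by metis
    then show ?thesis using g(2)[of N] N[of N] N[of "Suc N"] by simp
  qed auto
  have g_eq: "g n = pre q (length (g n))" for n
    using chain_eq_pref[of g, OF g(1) p, of n] unfolding q pref_InfSeq_pre .
  have qS: "pre q (Suc n) \<in> S" for n
  proof (rule prefix_closed_prefix[OF S(2) gS[of "Suc n"]])
    show "prefix (pre q (Suc n)) (g (Suc n))" using g_eq[of "Suc n"] prefix_pre glen by metis
  qed simp
  note play = pre_prefix_closed_play[OF qS S(1)]
  obtain q' \<pi> where q': "InfSeq q = InfSeq q'" and \<pi>: "out_word ?W (InfSeq q) = InfSeq \<pi>"
    "\<And>n. labs ?W (pre q' n) = pre \<pi> (length (labs ?W (pre q' n)))"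
    by (rule word_play_InfSeq[OF play(1)]) (rule that)
  have labs_g: "labs ?W (g n) = pre \<pi> (length (labs ?W (g n)))" for n
    using \<pi>(2)[of "length (g n)"] q' g_eq[of n] by simp
  have "\<exists>j\<ge>n. foldl upd b0 (pre \<pi> j)" for n
  proof -
    have "n \<le> length (labs ?W (g n))" for n
    proof (induction n)
      case (Suc n)
      then show ?case using g(3)[of n] by auto
    qed simp
    moreover obtain j where j: "length (labs ?W (g n)) < j" "j \<le> length (labs ?W (g (Suc n)))"
      "foldl upd b0 (take j (labs ?W (g (Suc n))))" using g(3)[of n] by blast
    moreover have "take j (labs ?W (g (Suc n))) = pre \<pi> j"
      using labs_g[of "Suc n"] j(2) take_pre[of j \<pi>] by (metis min.absorb1)
    ultimately show ?thesis by (metis le_trans less_imp_le)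
  qed
  then show False using rej[OF play \<pi>(1)] unfolding INFM_nat_le by blast
qed

lemma seg_append: "i \<le> j \<Longrightarrow> j \<le> l \<Longrightarrow> seg u i l = seg u i j @ seg u j l"
  by (metis le_Suc_ex map_append upt_add_eq_append)

text \<open>By \<open>wp_append\<close>, equal transformers on single blocks give equal ones on all
  concatenations of consecutive blocks, and the certificate mentions nothing else.\<close>

lemma accepts_block_cong:
  assumes m: "strict_mono m" "strict_mono m'"
    and eq: "\<And>k. wp A P upd (seg w (m k) (m (Suc k))) = wp A P upd (seg w' (m' k) (m' (Suc k)))"
    and acc: "accepts_block A P upd b0 w m"
  shows "accepts_block A P upd b0 w' m'"
proof -
  have mono: "n k \<le> n l" if "strict_mono n" "k \<le> l" for n :: "nat \<Rightarrow> nat" and k l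
    using that by (simp add: strict_mono_less_eq)
  have "wp A P upd (seg w (m k) (m (k + i))) = wp A P upd (seg w' (m' k) (m' (k + i)))" for k i
  proof (induction i)
    case (Suc i)
    have "wp A P upd (seg w (m k) (m (k + Suc i))) X = wp A P upd (seg w' (m' k) (m' (k + Suc i))) X" for X
      using seg_append[of "m k" "m (k + i)" "m (Suc (k + i))" w]
        seg_append[of "m' k" "m' (k + i)" "m' (Suc (k + i))" w'] mono[OF m(1)] mono[OF m(2)] Suc eq[of "k + i"]
      by (simp add: wp_append)
    then show ?case by blast
  qed (simp add: fun_eq_iff)
  note eq_add = this
  have eq': "wp A P upd (seg w (m k) (m k')) = wp A P upd (seg w' (m' k) (m' k'))" if "k < k'" for k k'
    using eq_add[of k "k' - k"] that by simp
  have "(\<exists>k'>k. wp A P upd (seg w (m k) (m k')) (X k') r) \<longleftrightarrow>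
      (\<exists>k'>k. wp A P upd (seg w' (m' k) (m' k')) (X k') r)" for k X r
    by (rule ex_cong1) (auto simp: eq')
  then show ?thesis using acc unfolding accepts_block_def by simp
qed

section \<open>Recognizable languages of infinite words\<close>

lemma gdeltaI:
  fixes U :: "nat \<Rightarrow> 'l list set"
  shows "X = {s. \<forall>m. \<exists>k. pre s k \<in> U m} \<Longrightarrow> gdelta X"
  unfolding gdelta_def by (rule exI)

lemma gdeltaE:
  assumes "gdelta X"
  obtains U :: "nat \<Rightarrow> 'l list set" where "X = {s. \<forall>m. \<exists>k. pre s k \<in> U m}"
  using assms unfolding gdelta_def by (rule exE)

lemma sigma3I:
  fixes B :: "nat \<Rightarrow> (nat \<Rightarrow> 'l) set"
  shows "(\<And>n. gdelta (B n)) \<Longrightarrow> X = (\<Union>n. B n) \<Longrightarrow> sigma3 X"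
  unfolding sigma3_def by (intro exI[of _ B]) simp

lemma sigma3E:
  assumes "sigma3 X"
  obtains B :: "nat \<Rightarrow> (nat \<Rightarrow> 'l) set" where "\<And>n. gdelta (B n)" "X = (\<Union>n. B n)"
proof -
  obtain B :: "nat \<Rightarrow> (nat \<Rightarrow> 'l) set" where "(\<forall>n. gdelta (B n)) \<and> X = (\<Union>n. B n)"
    using assms unfolding sigma3_def ..
  then have "gdelta (B n)" "X = (\<Union>n. B n)" for n by simp_all
  then show thesis by (rule that)
qed

lemma gdelta_open: "gdelta {s. \<exists>k. pre s k \<in> C}"
  unfolding gdelta_def by (intro exI[of _ "\<lambda>_. C"]) simp

text \<open>The open set with index \<open>m\<close> tests only the prefix of length
  \<open>m\<close>.\<close>

lemma gdelta_closed: "gdelta {s. \<forall>k. pre s k \<in> C}"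
proof -
  have "{s. \<forall>k. pre s k \<in> C} = {s. \<forall>m. \<exists>k. pre s k \<in> {h \<in> C. length h = m}}" by auto
  then show ?thesis by (rule gdeltaI)
qed

lemma gdelta_limit: "gdelta {s. \<exists>\<^sub>\<infinity>k. pre s k \<in> C}"
proof -
  have "{s. \<exists>\<^sub>\<infinity>k. pre s k \<in> C} = {s. \<forall>m. \<exists>k. pre s k \<in> {h \<in> C. m \<le> length h}}"
    by (auto simp: INFM_nat_le)
  then show ?thesis by (rule gdeltaI)
qed

lemma gdelta_Int:
  assumes "gdelta X" "gdelta Y"
  shows "gdelta (X \<inter> Y)"
proof -
  obtain U :: "nat \<Rightarrow> 'a list set" where U: "X = {s. \<forall>m. \<exists>k. pre s k \<in> U m}"
    by (rule gdeltaE[OF assms(1)])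
  obtain V :: "nat \<Rightarrow> 'a list set" where V: "Y = {s. \<forall>m. \<exists>k. pre s k \<in> V m}"
    by (rule gdeltaE[OF assms(2)])
  \<comment> \<open>Interleaves the two sequences of open sets.\<close>
  define Z where "Z m = (if even m then U (m div 2) else V (m div 2))" for m
  have "(\<forall>m. P (Z m)) \<longleftrightarrow> (\<forall>m. P (U m)) \<and> (\<forall>m. P (V m))" for P
  proof
    assume P: "\<forall>m. P (Z m)"
    have "P (U m) \<and> P (V m)" for m using P[rule_format, of "2 * m"] P[rule_format, of "2 * m + 1"] by (simp add: Z_def)
    then show "(\<forall>m. P (U m)) \<and> (\<forall>m. P (V m))" by blast
  qed (simp add: Z_def)
  from this[of "\<lambda>C. \<exists>k. pre s k \<in> C" for s] have "X \<inter> Y = {s. \<forall>m. \<exists>k. pre s k \<in> Z m}" unfolding U V by auto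
  then show ?thesis by (rule gdeltaI)
qed

lemma gdelta_empty: "gdelta {}"
  using gdelta_open[of "{}"] by simp

lemma gdelta_sigma3: "gdelta X \<Longrightarrow> sigma3 X"
  unfolding sigma3_def by (intro exI[of _ "\<lambda>_. X"]) simp

lemma sigma3_UN:
  fixes B :: "'i::countable \<Rightarrow> (nat \<Rightarrow> 'l) set"
  assumes "\<And>i. gdelta (B i)"
  shows "sigma3 (\<Union>i. B i)"
proof -
  have "(\<Union>i. B i) = (\<Union>n. B (from_nat n))" by (auto, metis from_nat_to_nat)
  from sigma3I[OF assms this] show ?thesis .
qed

lemma sigma3_Int:
  assumes "sigma3 X" "sigma3 Y"
  shows "sigma3 (X \<inter> Y)"
proof -
  obtain B :: "nat \<Rightarrow> (nat \<Rightarrow> 'a) set" where B: "\<And>n. gdelta (B n)" "X = (\<Union>n. B n)"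
    by (rule sigma3E[OF assms(1)]) (rule that)
  obtain C :: "nat \<Rightarrow> (nat \<Rightarrow> 'a) set" where C: "\<And>n. gdelta (C n)" "Y = (\<Union>n. C n)"
    by (rule sigma3E[OF assms(2)]) (rule that)
  have eq: "X \<inter> Y = (\<Union>i. B (fst i) \<inter> C (snd i))" unfolding B(2) C(2) by auto
  show ?thesis unfolding eq by (rule sigma3_UN) (rule gdelta_Int[OF B(1) C(1)])
qed

lemma sigma3_vimage:
  assumes "sigma3 X"
  shows "sigma3 {s. f \<circ> s \<in> X}"
proof -
  have pre: "pre (f \<circ> s) k = map f (pre s k)" for s k by (simp add: pre_def)
  have gd: "gdelta {s. f \<circ> s \<in> B}" if B: "gdelta B" for B
  proof -
    obtain U :: "nat \<Rightarrow> _" where "B = {s. \<forall>m. \<exists>k. pre s k \<in> U m}" by (rule gdeltaE[OF B])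
    then have "{s. f \<circ> s \<in> B} = {s. \<forall>m. \<exists>k. pre s k \<in> {h. map f h \<in> U m}}" by (simp add: pre)
    then show ?thesis by (rule gdeltaI)
  qed
  obtain B :: "nat \<Rightarrow> _" where B: "\<And>n. gdelta (B n)" "X = (\<Union>n. B n)" by (rule sigma3E[OF assms]) (rule that)
  have "{s. f \<circ> s \<in> X} = (\<Union>n. {s. f \<circ> s \<in> B n})" unfolding B(2) by auto
  then show ?thesis using sigma3_UN[of "\<lambda>n. {s. f \<circ> s \<in> B n}"] gd B(1) by simp
qed

text \<open>The set is the union over \<open>n\<close> of the closed sets of sequences with no
  prefix in \<open>C\<close> from length \<open>n\<close> on.\<close>

lemma sigma3_not_limit: "sigma3 {s. \<not> (\<exists>\<^sub>\<infinity>k. pre s k \<in> C)}"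
proof -
  have "{s. \<not> (\<exists>\<^sub>\<infinity>k. pre s k \<in> C)} = (\<Union>n. {s. \<forall>k. pre s k \<in> {h. n \<le> length h \<longrightarrow> h \<notin> C}})"
    by (auto simp: INFM_nat_le)
  moreover have "sigma3 (\<Union>n. {s. \<forall>k. pre s k \<in> {h. n \<le> length h \<longrightarrow> h \<notin> C}})"
    by (rule sigma3_UN) (rule gdelta_closed)
  ultimately show ?thesis by (simp only:)
qed

section \<open>Ramsey factorizations and a Sigma3 description of recognizable languages\<close>

lemma ramsey_factorization:
  fixes c :: "'a list \<Rightarrow> 'c::finite"
  obtains m :: "nat \<Rightarrow> nat" and e where "strict_mono m" "0 < m 0" "\<And>i j. i < j \<Longrightarrow> c (seg w (m i) (m j)) = e"
proof -
  define N where "N = Suc (Max (range (to_nat :: 'c \<Rightarrow> nat)))"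
  have N: "to_nat x < N" for x :: 'c unfolding N_def by (simp add: le_imp_less_Suc)
  define f where "f X = to_nat (c (seg w (Min X) (Max X)))" for X
  \<comment> \<open>Only positive positions are coloured, which leaves a nonempty block before
    \<open>m 0\<close>.\<close>
  have "\<forall>x\<in>{0<..}. \<forall>y\<in>{0<..}. x \<noteq> y \<longrightarrow> f {x, y} < N" unfolding f_def using N by blast
  from Ramsey2[OF infinite_Ioi this] obtain Y t where Y: "Y \<subseteq> {0<..}" "infinite Y"
    "\<forall>x\<in>Y. \<forall>y\<in>Y. x \<noteq> y \<longrightarrow> f {x, y} = t" by blast
  define m where "m = enumerate Y"
  have m: "strict_mono m" unfolding m_def using Y(2) by (simp add: strict_mono_def)
  have mY: "m i \<in> Y" for i unfolding m_def using enumerate_in_set[OF Y(2)] .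
  have eq: "c (seg w (m i) (m j)) = from_nat t" if "i < j" for i j
  proof -
    have "m i < m j" using m that by (simp add: strict_mono_less)
    moreover from this have "f {m i, m j} = t" using Y(3)[rule_format, OF mY mY, of i j] by simp
    ultimately have "to_nat (c (seg w (m i) (m j))) = t" by (simp add: f_def min_def max_def)
    then show ?thesis by (metis from_nat_to_nat)
  qed
  have "0 < m 0" using mY[of 0] Y(1) by auto
  then show thesis by (rule that[OF m _ eq])
qed

text \<open>The merging condition in this proof goes back to the Ramsey-based proof of McNaughton's theorem: once
  the blocks from \<open>n\<close> and from \<open>m\<close> to \<open>k\<close> have the same class, those to all later positions do, so that
  suitable positions can be chosen greedily.\<close>

lemma sigma3_recognizable:
  fixes c :: "'a list \<Rightarrow> 'c::finite"
  assumes cong: "\<And>u u' v. c u = c u' \<Longrightarrow> c (u @ v) = c (u' @ v)"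
    and transfer: "\<And>w w' m m'. strict_mono m \<Longrightarrow> m 0 = 0 \<Longrightarrow> strict_mono m' \<Longrightarrow> m' 0 = 0 \<Longrightarrow>
      (\<And>k. c (seg w (m k) (m (Suc k))) = c (seg w' (m' k) (m' (Suc k)))) \<Longrightarrow> w \<in> L \<Longrightarrow> w' \<in> L"
  shows "sigma3 L"
proof -
  \<comment> \<open>By \<open>transfer\<close>, a word is in \<open>L\<close> as soon as it has one
    factorization with classes \<open>s, e, e, ...\<close> for a pair in this set.\<close>
  define Acc where "Acc = {(s, e). \<exists>w\<in>L. \<exists>m. strict_mono m \<and> m 0 = (0 :: nat)
      \<and> c (seg w 0 (m 1)) = s \<and> (\<forall>k\<ge>1. c (seg w (m k) (m (Suc k))) = e)}"
  \<comment> \<open>\<open>h\<close> shows that some position \<open>m\<close> beyond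
    \<open>N\<close> has class \<open>e\<close> when counted from \<open>n\<close> and has merged
    with \<open>n\<close> by position \<open>k\<close>. As this concerns finite prefixes, demanding
    it for every \<open>N\<close> is a G-delta condition.\<close>
  define hit where "hit n e N h \<longleftrightarrow> (\<exists>m k. N < m \<and> n < m \<and> m < k \<and> k \<le> length h
      \<and> c (drop n (take m h)) = e \<and> c (drop n (take k h)) = c (drop m (take k h)))" for n e N h
  define B where "B i = (case i of (s, e, n) \<Rightarrow> if (s, e) \<in> Acc \<and> 0 < n then
      {w. \<exists>k. pre w k \<in> {h. n \<le> length h \<and> c (take n h) = s}} \<inter> {w. \<forall>N. \<exists>k. pre w k \<in> {h. hit n e N h}}
      else {})" for i :: "'c \<times> 'c \<times> nat"
  have B: "gdelta (B i)" for i
  proof (cases i)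
    case (fields s e n)
    have "gdelta {w :: nat \<Rightarrow> 'a. \<forall>N. \<exists>k. pre w k \<in> {h. hit n e N h}}"
      by (rule gdeltaI) (rule refl)
    note gd = gdelta_Int[OF gdelta_open this]
    show ?thesis
    proof (cases "(s, e) \<in> Acc \<and> 0 < n")
      case True
      show ?thesis unfolding B_def fields prod.case if_P[OF True] by (rule gd)
    next
      case False
      show ?thesis unfolding B_def fields prod.case if_not_P[OF False] by (rule gdelta_empty)
    qed
  qed
  have drop_pre: "drop i (pre w j) = seg w i j" for w :: "nat \<Rightarrow> 'a" and i j
    by (simp add: pre_def drop_map)
  have seg_drop: "drop i (take j (pre w k)) = seg w i j" if "j \<le> k" for w :: "nat \<Rightarrow> 'a" and i j k
    using that by (simp add: take_pre min_def drop_pre)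
  have "L = (\<Union>i. B i)"
  proof (intro equalityI subsetI)
    fix w assume w: "w \<in> L"
    obtain m :: "nat \<Rightarrow> nat" and e
      where m: "strict_mono m" "0 < m 0" "\<And>i j. i < j \<Longrightarrow> c (seg w (m i) (m j)) = e"
      by (rule ramsey_factorization[of c w]) (rule that)
    define m' where "m' k = (case k of 0 \<Rightarrow> 0 | Suc i \<Rightarrow> m i)" for k
    have "strict_mono m'" unfolding strict_mono_Suc_iff m'_def
      using m(1,2) by (auto split: nat.split simp: strict_mono_Suc_iff)
    moreover have "c (seg w (m' k) (m' (Suc k))) = e" if "k \<ge> 1" for k
      using that m(3) unfolding m'_def by (cases k) auto
    ultimately have acc: "(c (seg w 0 (m 0)), e) \<in> Acc"
      unfolding Acc_def using w by (auto intro!: bexI[OF _ w] exI[of _ m'] simp: m'_def)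
    have "\<exists>k. pre w k \<in> {h. hit (m 0) e N h}" for N
    proof -
      have lt: "m 0 < m (Suc N)" "m (Suc N) < m (Suc (Suc N))" using m(1) by (simp_all add: strict_mono_less)
      moreover have "Suc N \<le> m (Suc N)" using strict_mono_imp_increasing[OF m(1)] .
      ultimately have "hit (m 0) e N (pre w (m (Suc (Suc N))))"
        unfolding hit_def using m(3)[of 0 "Suc N"] m(3)[of 0 "Suc (Suc N)"] m(3)[of "Suc N" "Suc (Suc N)"]
        by - (rule exI[of _ "m (Suc N)"], rule exI[of _ "m (Suc (Suc N))"], simp add: seg_drop drop_pre)
      then show ?thesis by blast
    qed
    moreover have "\<exists>k. pre w k \<in> {h. m 0 \<le> length h \<and> c (take (m 0) h) = c (seg w 0 (m 0))}"
      by (intro exI[of _ "m 0"]) (simp add: pre_def)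
    ultimately have "w \<in> B (c (seg w 0 (m 0)), e, m 0)" unfolding B_def using acc m(2) by simp
    then show "w \<in> (\<Union>i. B i)" by blast
  next
    fix w assume "w \<in> (\<Union>i. B i)"
    then obtain s e n where "w \<in> B (s, e, n)" by auto
    then have acc: "(s, e) \<in> Acc" and n: "0 < n" and "\<exists>k. n \<le> k \<and> c (take n (pre w k)) = s"
      and hits: "\<And>N. \<exists>k. hit n e N (pre w k)" unfolding B_def by (auto split: if_splits)
    then have s: "c (seg w 0 n) = s" using seg_drop[of n _ 0 w] by fastforce
    define good where "good m \<longleftrightarrow> n < m \<and> c (seg w n m) = e \<and> (\<exists>k>m. c (seg w n k) = c (seg w m k))" for m
    have inf: "\<exists>m>N. good m" for N
    proof -
      obtain k where "hit n e N (pre w k)" using hits by blast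
      then show ?thesis unfolding hit_def good_def by (auto simp: seg_drop) metis
    qed
    \<comment> \<open>After the merging at \<open>k\<close>, \<open>cong\<close> identifies the
      class from \<open>m\<close> to \<open>m'\<close> with the one from \<open>n\<close> to
      \<open>m'\<close>, which is \<open>e\<close>.\<close>
    have step: "\<exists>m'>m. good m' \<and> c (seg w m m') = e" if m: "good m" for m
    proof -
      obtain k where k: "k > m" "c (seg w n k) = c (seg w m k)" using m unfolding good_def by blast
      obtain m' where m': "m' > k" "good m'" using inf by blast
      have "c (seg w m m') = c (seg w m k @ seg w k m')" using seg_append[of m k m' w] k m' by simp
      also have "\<dots> = c (seg w n k @ seg w k m')" using cong[OF k(2)] by simp
      also have "\<dots> = c (seg w n m')" using seg_append[of n k m' w] k m' m by (simp add: good_def)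
      finally show ?thesis using m' k unfolding good_def by (intro exI[of _ m']) auto
    qed
    have "\<exists>g. \<forall>i. good (g i) \<and> (g i < g (Suc i) \<and> c (seg w (g i) (g (Suc i))) = e)"
      by (rule dependent_nat_choice) (use inf step in blast)+
    then obtain g where g: "\<And>i. good (g i)" "\<And>i. g i < g (Suc i)" "\<And>i. c (seg w (g i) (g (Suc i))) = e"
      by blast
    \<comment> \<open>The blocks end at \<open>n\<close>, \<open>g 0\<close>, \<open>g 1\<close> and
      so on; the first has class \<open>s\<close> and all others have class
      \<open>e\<close>.\<close>
    define m' where "m' k = (case k of 0 \<Rightarrow> 0 | Suc 0 \<Rightarrow> n | Suc (Suc i) \<Rightarrow> g i)" for k
    have m': "strict_mono m'" unfolding strict_mono_Suc_iff m'_def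
      using n g(1)[of 0] g(2) by (auto split: nat.split simp: good_def)
    obtain w0 m0 where w0: "w0 \<in> L" "strict_mono m0" "m0 0 = 0" "c (seg w0 0 (m0 1)) = s"
      "\<And>k. k \<ge> 1 \<Longrightarrow> c (seg w0 (m0 k) (m0 (Suc k))) = e" using acc unfolding Acc_def by auto
    have eq: "c (seg w0 (m0 k) (m0 (Suc k))) = c (seg w (m' k) (m' (Suc k)))" for k
    proof -
      consider "k = 0" | "k = 1" | i where "k = Suc (Suc i)" by (metis One_nat_def not0_implies_Suc)
      then show ?thesis
        using w0(3,4) w0(5)[of k] s g(1)[of 0] g(3) by cases (auto simp: m'_def good_def)
    qed
    show "w \<in> L" by (rule transfer[OF w0(2,3) m' _ eq w0(1)]) (simp add: m'_def)
  qed
  from this[symmetric] show ?thesis by (rule subst[where P = sigma3]) (rule sigma3_UN[OF B])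
qed

section \<open>Winning the letter games\<close>

definition outcomes :: "('v, 'l) arena \<Rightarrow> 'v list set \<Rightarrow> (nat \<Rightarrow> 'l) set" where
  "outcomes G S = {s. \<exists>q. play G (InfSeq q) \<and> follows S (InfSeq q) \<and> out_word G (InfSeq q) = InfSeq s}"

lemma outcomes_weights:
  fixes A :: "('a, 'q) automaton"
  assumes "s \<in> outcomes (letter_game P A) S"
  shows "range (snd \<circ> s) \<subseteq> weights A"
proof -
  obtain q where "play (letter_game P A) (InfSeq q)" "out_word (letter_game P A) (InfSeq q) = InfSeq s"
    using assms unfolding outcomes_def by blast
  then have "snd (s i) \<in> weights A" for i by (rule letter_play_weights)
  then show ?thesis by auto
qed

text \<open>\<open>L\<close> and \<open>V\<close> make the opponent's winning set Sigma3, and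
  \<open>bound\<close> widens the strict inequality on the outcomes of a tree to a gap.
  \<open>V\<close> is restricted to sequences over the weights of \<open>A\<close>, on which the
  value functions are well behaved.\<close>

lemma wins_letter_game_infinite:
  fixes A :: "('a::finite, 'q::finite) automaton"
  assumes inf: "infinite (UNIV :: 'v set)"
    and gfg: "good_for_games TYPE('v) A (OnInf v) (OnInf g)"
    and A: "realizes A (OnInf v) (OnInf g)"
    and L: "\<And>Q. sigma3 {w. secures Q t (ereal (g w))}"
    and V: "\<And>Q. \<exists>X. sigma3 X \<and> (\<forall>\<pi>. range \<pi> \<subseteq> weights A \<longrightarrow> (\<pi> \<in> X \<longleftrightarrow> secures Q t (ereal (v \<pi>))))"
    and bound: "\<And>Q S F. tree (letter_game Q A) Q S \<Longrightarrow> prefix_closed S \<Longrightarrow>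
      F = (\<lambda>s. v (snd \<circ> s)) \<or> F = (\<lambda>s. g (fst \<circ> s)) \<Longrightarrow>
      (\<And>s. s \<in> outcomes (letter_game Q A) S \<Longrightarrow> F s < t) \<Longrightarrow>
      \<exists>a<t. \<forall>s\<in>outcomes (letter_game Q A) S. F s \<le> a"
  shows "wins (letter_game (opponent P) A) P (letter_condition P A (OnInf v) t)"
proof (rule ccontr)
  assume nw: "\<not> ?thesis"
  let ?L = "letter_game (opponent P) A"
  obtain X where X: "sigma3 X"
    "\<forall>\<pi>. range \<pi> \<subseteq> weights A \<longrightarrow> (\<pi> \<in> X \<longleftrightarrow> secures (opponent P) t (ereal (v \<pi>)))"
    using V[of "opponent P"] by blast
  define Y where "Y = {s. fst \<circ> s \<in> {w. secures P t (ereal (g w))}} \<inter> {s :: nat \<Rightarrow> 'a \<times> rat. snd \<circ> s \<in> X}"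
  have Y: "sigma3 Y" unfolding Y_def by (intro sigma3_Int sigma3_vimage L X(1))
  have Y_iff: "s \<in> Y \<longleftrightarrow> secures P t (ereal (g (fst \<circ> s))) \<and> \<not> secures P t (ereal (v (snd \<circ> s)))"
    if "range (snd \<circ> s) \<subseteq> weights A" for s
    using X(2)[rule_format, OF that] by (simp add: Y_def secures_opponent)
  have weights: "range (snd \<circ> s) \<subseteq> weights A"
    if "play ?L (InfSeq q)" "out_word ?L (InfSeq q) = InfSeq s" for q s
    using letter_play_weights[OF that] by auto
  have W: "letter_condition P A (OnInf v) t (InfSeq s) \<longleftrightarrow> s \<notin> Y"
    if "play ?L (InfSeq q)" "out_word ?L (InfSeq q) = InfSeq s" for q s
    unfolding letter_condition_OnInf realizes_aut_value(1)[OF A] Y_iff[OF weights[OF that]] by blast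
  obtain S where S: "tree ?L (opponent P) S" "prefix_closed S"
    "\<And>q s. play ?L (InfSeq q) \<Longrightarrow> follows S (InfSeq q) \<Longrightarrow> out_word ?L (InfSeq q) = InfSeq s \<Longrightarrow> s \<in> Y"
  proof (rule letter_game_determined[OF Y _ nw])
    fix q s assume "play ?L (InfSeq q)" "out_word ?L (InfSeq q) = InfSeq s"
    then show "letter_condition P A (OnInf v) t (InfSeq s) \<longleftrightarrow> s \<notin> Y" by (rule W)
  qed (rule that)
  have out: "secures P t (ereal (g (fst \<circ> s)))" "\<not> secures P t (ereal (v (snd \<circ> s)))"
    if s: "s \<in> outcomes ?L S" for s
  proof -
    have "s \<in> Y" using s S(3) unfolding outcomes_def by blast
    then show "secures P t (ereal (g (fst \<circ> s)))" "\<not> secures P t (ereal (v (snd \<circ> s)))"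
      unfolding Y_iff[OF outcomes_weights[OF s]] by simp_all
  qed
  \<comment> \<open>The side with the strict inequality: the weights if \<open>P\<close> is Eve, and
    the word if \<open>P\<close> is Adam. On the other side \<open>t\<close> itself is the
    bound.\<close>
  let ?F = "if P = Eve then (\<lambda>s. v (snd \<circ> s)) else (\<lambda>s. g (fst \<circ> s))"
  have "\<exists>a<t. \<forall>s\<in>outcomes ?L S. ?F s \<le> a"
  proof (rule bound[OF S(1,2)])
    show "?F = (\<lambda>s. v (snd \<circ> s)) \<or> ?F = (\<lambda>s. g (fst \<circ> s))" by simp
    show "?F s < t" if "s \<in> outcomes ?L S" for s using out[OF that] by (cases P) auto
  qed
  then obtain a where a: "a < t" "\<And>s. s \<in> outcomes ?L S \<Longrightarrow> ?F s \<le> a" by blast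
  show False
  proof (rule not_good_for_games_infinite[OF inf gfg S(1,2) a(1)])
    fix q s assume "play ?L (InfSeq q)" "follows S (InfSeq q)" "out_word ?L (InfSeq q) = InfSeq s"
    then have s: "s \<in> outcomes ?L S" unfolding outcomes_def by blast
    show "if P = Eve then t \<le> g (fst \<circ> s) \<and> v (snd \<circ> s) \<le> a else g (fst \<circ> s) \<le> a \<and> t \<le> v (snd \<circ> s)"
      using out[OF s] a(2)[OF s] by (cases P) auto
  qed
qed

text \<open>The opponent wins as soon as one nonempty prefix violates the condition, so their
  winning set is open.\<close>

lemma wins_letter_game_finite:
  fixes A :: "('a::finite, 'q::finite) automaton"
  assumes inf: "infinite (UNIV :: 'v set)"
    and gfg: "good_for_games TYPE('v) A (OnFin v) (OnFin g)"
    and A: "realizes A (OnFin v) (OnFin g)"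
  shows "wins (letter_game (opponent P) A) P (letter_condition P A (OnFin v) t)"
proof (rule ccontr)
  assume nw: "\<not> ?thesis"
  let ?L = "letter_game (opponent P) A"
  define C where "C = {h :: ('a \<times> rat) list. h \<noteq> [] \<and> secures P t (ereal (g (map fst h)))
    \<and> \<not> secures P t (ereal (v (map snd h)))}"
  define X where "X = {s. \<exists>k. pre s k \<in> C}"
  have X: "sigma3 X" unfolding X_def by (intro gdelta_sigma3 gdelta_open)
  have X_iff: "s \<in> X \<longleftrightarrow> (\<exists>i. secures P t (ereal (g (map fst (pre s (Suc i)))))
    \<and> \<not> secures P t (ereal (v (map snd (pre s (Suc i))))))" for s
  proof
    assume "s \<in> X"
    then obtain k where k: "pre s k \<in> C" unfolding X_def by blast
    then obtain i where "k = Suc i" by (cases k) (auto simp: C_def)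
    then show "\<exists>i. secures P t (ereal (g (map fst (pre s (Suc i)))))
      \<and> \<not> secures P t (ereal (v (map snd (pre s (Suc i)))))" using k unfolding C_def by blast
  next
    assume "\<exists>i. secures P t (ereal (g (map fst (pre s (Suc i)))))
      \<and> \<not> secures P t (ereal (v (map snd (pre s (Suc i)))))"
    then obtain i where "secures P t (ereal (g (map fst (pre s (Suc i)))))"
      "\<not> secures P t (ereal (v (map snd (pre s (Suc i)))))" by blast
    then have "pre s (Suc i) \<in> C" unfolding C_def by simp
    then show "s \<in> X" unfolding X_def by blast
  qed
  have W: "letter_condition P A (OnFin v) t (InfSeq s) \<longleftrightarrow> s \<notin> X" for s
    unfolding letter_condition_OnFin realizes_aut_value(2)[OF A] X_iff by blast
  obtain S where S: "tree ?L (opponent P) S" "prefix_closed S"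
    "\<And>q s. play ?L (InfSeq q) \<Longrightarrow> follows S (InfSeq q) \<Longrightarrow> out_word ?L (InfSeq q) = InfSeq s \<Longrightarrow> s \<in> X"
  proof (rule letter_game_determined[OF X _ nw])
    show "letter_condition P A (OnFin v) t (InfSeq s) \<longleftrightarrow> s \<notin> X" for s by (rule W)
  qed (rule that)
  show False
    by (rule not_good_for_games_finite[OF inf gfg S(1,2)]) (use S(3) X_iff in blast)
qed

section \<open>Value functions with finitely many values\<close>

lemma word_values:
  assumes "realizes A (OnInf v) (OnInf g)"
  shows "eve_value (word_game A (InfSeq w)) (OnInf v) = ereal (g w)"
    "adam_value (word_game A (InfSeq w)) (OnInf v) = ereal (g w)"
proof -
  show 1: "eve_value (word_game A (InfSeq w)) (OnInf v) = ereal (g w)"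
    using assms by (simp add: aut_value_def)
  have "determined (word_game A (InfSeq w)) (OnInf v)" using assms by simp
  then show "adam_value (word_game A (InfSeq w)) (OnInf v) = ereal (g w)"
    using 1 unfolding determined_def by (simp only:)
qed

lemma word_payoff:
  fixes A :: "('a, 'q) automaton"
  assumes "play (word_game A (InfSeq w)) p"
  obtains \<pi> where "out_word (word_game A (InfSeq w)) p = InfSeq \<pi>" "range \<pi> \<subseteq> weights A"
    "payoff (word_game A (InfSeq w)) (OnInf v) p = ereal (v \<pi>)"
proof -
  obtain \<pi> where "out_word (word_game A (InfSeq w)) p = InfSeq \<pi>" "range \<pi> \<subseteq> weights A"
    by (rule word_play_InfSeq[OF assms]) (rule that)
  then show thesis by (intro that[of \<pi>]) (simp_all add: payoff_def)
qed

text \<open>Eve can ensure every bound strictly below the value. One that exceeds all elements of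
  \<open>Z\<close> below \<open>t\<close> already forces payoffs of at least \<open>t\<close>. For
  Adam the given inequality is strict anyway.\<close>

lemma word_value_attained:
  fixes A :: "('a, 'q) automaton"
  assumes A: "realizes A (OnInf v) (OnInf g)"
    and Z: "finite Z" "\<And>\<pi>. range \<pi> \<subseteq> weights A \<Longrightarrow> v \<pi> \<in> Z"
    and sec: "secures Q t (ereal (g w))"
  shows "ensures (word_game A (InfSeq w)) Q (OnInf v) t"
proof (cases Q)
  case Eve
  obtain a where a: "a < t" "\<And>z. z \<in> Z \<Longrightarrow> z < t \<Longrightarrow> z \<le> a" using finite_strict_bound[OF Z(1)] by blast
  define c where "c = (a + t) / 2"
  have c: "a < c" "c < t" using a(1) by (simp_all add: c_def)
  have "ereal c < ereal t" using c by simp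
  also have "ereal t \<le> eve_value (word_game A (InfSeq w)) (OnInf v)" using sec Eve by (simp add: word_values[OF A])
  finally obtain S where S: "tree (word_game A (InfSeq w)) Eve S" "prefix_closed S"
    "\<And>p. play (word_game A (InfSeq w)) p \<Longrightarrow> follows S p \<Longrightarrow> secures Eve c (payoff (word_game A (InfSeq w)) (OnInf v) p)"
    using eve_value_ensures unfolding ensures_def by blast
  have "secures Eve t (payoff (word_game A (InfSeq w)) (OnInf v) p)"
    if p: "play (word_game A (InfSeq w)) p" "follows S p" for p
  proof -
    obtain \<pi> where \<pi>: "range \<pi> \<subseteq> weights A" "payoff (word_game A (InfSeq w)) (OnInf v) p = ereal (v \<pi>)"
      by (rule word_payoff[OF p(1)]) (rule that)
    have "\<not> v \<pi> < t" using S(3)[OF p] \<pi> a(2) Z(2)[OF \<pi>(1)] c(1) by fastforce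
    then show ?thesis using \<pi>(2) by simp
  qed
  then show ?thesis unfolding ensures_def Eve using S(1,2) by blast
next
  case Adam
  then show ?thesis using sec by (auto intro!: adam_value_ensures simp: word_values[OF A])
qed

text \<open>\<open>R\<close> is the player who wants the monitor to be true infinitely often. As
  either player can attain the threshold, \<open>accepts_block\<close> characterizes the words on
  which \<open>R\<close> succeeds, whichever factorization is used. Hence both that set and its
  complement satisfy the assumptions of \<open>sigma3_recognizable\<close>.\<close>

lemma wins_letter_game_monitor:
  fixes A :: "('a::finite, 'q::finite) automaton"
  assumes inf: "infinite (UNIV :: 'v set)"
    and gfg: "good_for_games TYPE('v) A (OnInf v) (OnInf g)"
    and A: "realizes A (OnInf v) (OnInf g)"
    and Z: "finite Z" "\<And>\<pi>. range \<pi> \<subseteq> weights A \<Longrightarrow> v \<pi> \<in> Z"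
    and mon: "\<And>\<pi>. range \<pi> \<subseteq> weights A \<Longrightarrow> secures R t (ereal (v \<pi>)) \<longleftrightarrow> (\<exists>\<^sub>\<infinity>j. foldl upd b0 (pre \<pi> j))"
  shows "wins (letter_game (opponent P) A) P (letter_condition P A (OnInf v) t)"
proof (rule wins_letter_game_infinite[OF inf gfg A])
  have accepts: "secures R t (ereal (g w)) \<longleftrightarrow> accepts_block A R upd b0 w m"
    if m: "strict_mono m" "m 0 = 0" for w m
  proof
    assume "secures R t (ereal (g w))"
    then obtain S where S: "tree (word_game A (InfSeq w)) R S" "prefix_closed S"
      "\<And>p. play (word_game A (InfSeq w)) p \<Longrightarrow> follows S p \<Longrightarrow> secures R t (payoff (word_game A (InfSeq w)) (OnInf v) p)"
      using word_value_attained[OF A Z] unfolding ensures_def by blast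
    show "accepts_block A R upd b0 w m"
    proof (rule accepts_block_if_tree[OF m S(1,2)])
      fix p \<pi> assume p: "play (word_game A (InfSeq w)) p" "follows S p" "out_word (word_game A (InfSeq w)) p = InfSeq \<pi>"
      obtain \<pi>' where \<pi>': "out_word (word_game A (InfSeq w)) p = InfSeq \<pi>'" "range \<pi>' \<subseteq> weights A"
        "payoff (word_game A (InfSeq w)) (OnInf v) p = ereal (v \<pi>')"
        by (rule word_payoff[OF p(1)]) (rule that)
      then show "\<exists>\<^sub>\<infinity>j. foldl upd b0 (pre \<pi> j)" using S(3)[OF p(1,2)] mon[OF \<pi>'(2)] p(3) by simp
    qed
  next
    assume acc: "accepts_block A R upd b0 w m"
    show "secures R t (ereal (g w))"
    proof (rule ccontr)
      assume "\<not> ?thesis"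
      then have "secures (opponent R) t (ereal (g w))" by (simp add: secures_opponent)
      then obtain S where S: "tree (word_game A (InfSeq w)) (opponent R) S" "prefix_closed S"
        "\<And>p. play (word_game A (InfSeq w)) p \<Longrightarrow> follows S p \<Longrightarrow>
          secures (opponent R) t (payoff (word_game A (InfSeq w)) (OnInf v) p)"
        using word_value_attained[OF A Z] unfolding ensures_def by blast
      have "\<not> accepts_block A R upd b0 w m"
      proof (rule not_accepts_block_if_opponent_tree[OF m S(1,2)])
        fix p \<pi> assume p: "play (word_game A (InfSeq w)) p" "follows S p" "out_word (word_game A (InfSeq w)) p = InfSeq \<pi>"
        obtain \<pi>' where \<pi>': "out_word (word_game A (InfSeq w)) p = InfSeq \<pi>'" "range \<pi>' \<subseteq> weights A"
          "payoff (word_game A (InfSeq w)) (OnInf v) p = ereal (v \<pi>')"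
          by (rule word_payoff[OF p(1)]) (rule that)
        then show "\<not> (\<exists>\<^sub>\<infinity>j. foldl upd b0 (pre \<pi> j))"
          using S(3)[OF p(1,2)] mon[OF \<pi>'(2)] p(3) by (simp add: secures_opponent)
      qed
      then show False using acc by blast
    qed
  qed
  have cong: "wp A R upd (u @ v) = wp A R upd (u' @ v)" if "wp A R upd u = wp A R upd u'" for u u' v
    using that by (simp add: fun_eq_iff wp_append)
  have transfer: "secures R t (ereal (g w)) \<longleftrightarrow> secures R t (ereal (g w'))"
    if m: "strict_mono m" "m 0 = 0" "strict_mono m'" "m' 0 = 0"
      and eq: "\<And>k. wp A R upd (seg w (m k) (m (Suc k))) = wp A R upd (seg w' (m' k) (m' (Suc k)))"
    for w w' m m'
  proof -
    have "accepts_block A R upd b0 w m \<Longrightarrow> accepts_block A R upd b0 w' m'"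
      by (rule accepts_block_cong[of m m' A R upd w w' b0]) (simp_all only: m eq)
    moreover have "accepts_block A R upd b0 w' m' \<Longrightarrow> accepts_block A R upd b0 w m"
      by (rule accepts_block_cong[of m' m A R upd w' w b0]) (simp_all only: m eq)
    ultimately show ?thesis using accepts[OF m(1,2), of w] accepts[OF m(3,4), of w'] by blast
  qed
  have "sigma3 {w. secures R t (ereal (g w))}"
  proof (rule sigma3_recognizable[where c = "wp A R upd"])
    fix w w' and m m' :: "nat \<Rightarrow> nat"
    assume m: "strict_mono m" "m 0 = 0" "strict_mono m'" "m' 0 = 0"
      and eq: "\<And>k. wp A R upd (seg w (m k) (m (Suc k))) = wp A R upd (seg w' (m' k) (m' (Suc k)))"
      and w: "w \<in> {w. secures R t (ereal (g w))}"
    have "secures R t (ereal (g w)) \<longleftrightarrow> secures R t (ereal (g w'))"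
      by (rule transfer[of m m' w w']) (simp_all only: m eq)
    then show "w' \<in> {w. secures R t (ereal (g w))}" using w by simp
  qed (rule cong)
  moreover have "sigma3 {w. secures (opponent R) t (ereal (g w))}"
  proof (rule sigma3_recognizable[where c = "wp A R upd"])
    fix w w' and m m' :: "nat \<Rightarrow> nat"
    assume m: "strict_mono m" "m 0 = 0" "strict_mono m'" "m' 0 = 0"
      and eq: "\<And>k. wp A R upd (seg w (m k) (m (Suc k))) = wp A R upd (seg w' (m' k) (m' (Suc k)))"
      and w: "w \<in> {w. secures (opponent R) t (ereal (g w))}"
    have "secures R t (ereal (g w)) \<longleftrightarrow> secures R t (ereal (g w'))"
      by (rule transfer[of m m' w w']) (simp_all only: m eq)
    then show "w' \<in> {w. secures (opponent R) t (ereal (g w))}" using w by (simp add: secures_opponent)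
  qed (rule cong)
  ultimately show "sigma3 {w. secures Q t (ereal (g w))}" for Q
    by (cases Q; cases R) auto
  have "\<exists>X. sigma3 X \<and> (\<forall>\<pi>. range \<pi> \<subseteq> weights A \<longrightarrow> (\<pi> \<in> X \<longleftrightarrow> secures R t (ereal (v \<pi>))))"
    by (rule exI[of _ "{\<pi>. \<exists>\<^sub>\<infinity>j. pre \<pi> j \<in> {h. foldl upd b0 h}}"])
      (use mon gdelta_sigma3[OF gdelta_limit[of "{h. foldl upd b0 h}"]] in auto)
  moreover have "\<exists>X. sigma3 X \<and> (\<forall>\<pi>. range \<pi> \<subseteq> weights A \<longrightarrow> (\<pi> \<in> X \<longleftrightarrow> secures (opponent R) t (ereal (v \<pi>))))"
    by (rule exI[of _ "{\<pi>. \<not> (\<exists>\<^sub>\<infinity>j. pre \<pi> j \<in> {h. foldl upd b0 h})}"])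
      (use mon sigma3_not_limit[of "{h. foldl upd b0 h}"] in \<open>auto simp: secures_opponent\<close>)
  ultimately show "\<exists>X. sigma3 X \<and> (\<forall>\<pi>. range \<pi> \<subseteq> weights A \<longrightarrow> (\<pi> \<in> X \<longleftrightarrow> secures Q t (ereal (v \<pi>))))" for Q
    by (cases Q; cases R) auto
next
  fix Q S and F :: "(nat \<Rightarrow> 'a \<times> rat) \<Rightarrow> real"
  assume F: "F = (\<lambda>s. v (snd \<circ> s)) \<or> F = (\<lambda>s. g (fst \<circ> s))"
    and less: "\<And>s. s \<in> outcomes (letter_game Q A) S \<Longrightarrow> F s < t"
  obtain a where a: "a < t" "\<And>z. z \<in> Z \<Longrightarrow> z < t \<Longrightarrow> z \<le> a" using finite_strict_bound[OF Z(1)] by blast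
  \<comment> \<open>The values of words inherit the gap: a tree of Adam for \<open>t\<close> keeps
    all payoffs, which lie in \<open>Z\<close>, at or below \<open>a\<close>.\<close>
  have "g w \<le> a" if w: "g w < t" for w
  proof -
    have "secures Adam t (ereal (g w))" using w by simp
    from word_value_attained[OF A Z this] obtain S where S: "tree (word_game A (InfSeq w)) Adam S"
      "\<And>p. play (word_game A (InfSeq w)) p \<Longrightarrow> follows S p \<Longrightarrow> payoff (word_game A (InfSeq w)) (OnInf v) p < ereal t"
      unfolding ensures_def by auto
    have "adam_value (word_game A (InfSeq w)) (OnInf v) \<le> ereal a"
    proof (rule ensures_Adam_value[OF S(1)])
      fix p assume p: "play (word_game A (InfSeq w)) p" "follows S p"
      obtain \<pi> where \<pi>: "range \<pi> \<subseteq> weights A" "payoff (word_game A (InfSeq w)) (OnInf v) p = ereal (v \<pi>)"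
        by (rule word_payoff[OF p(1)]) (rule that)
      then show "payoff (word_game A (InfSeq w)) (OnInf v) p \<le> ereal a" using S(2)[OF p] a(2) Z(2)[OF \<pi>(1)] by simp
    qed
    then show ?thesis by (simp add: word_values[OF A])
  qed
  moreover have "v (snd \<circ> s) \<le> a" if "s \<in> outcomes (letter_game Q A) S" "v (snd \<circ> s) < t" for s
    using a(2) Z(2)[OF outcomes_weights[OF that(1)]] that(2) by blast
  ultimately show "\<exists>a<t. \<forall>s\<in>outcomes (letter_game Q A) S. F s \<le> a"
    using F less a(1) by (intro exI[of _ a]) auto
qed

section \<open>Inf, Sup, LimInf and LimSup of sequences with finitely many values\<close>

lemma finite_range_weights:
  fixes A :: "('a::finite, 'q::finite) automaton"
  assumes "range \<pi> \<subseteq> weights A"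
  shows "finite (range (\<lambda>i. real_of_rat (\<pi> i)))" "range (\<lambda>i. real_of_rat (\<pi> i)) \<subseteq> real_of_rat ` weights A"
proof -
  show sub: "range (\<lambda>i. real_of_rat (\<pi> i)) \<subseteq> real_of_rat ` weights A" using assms by auto
  show "finite (range (\<lambda>i. real_of_rat (\<pi> i)))"
    using finite_subset[OF sub] finite_weights[of A] by blast
qed

lemma inf_val_finite:
  assumes f: "finite (range (\<lambda>i. real_of_rat (\<pi> i)))"
  shows "inf_val \<pi> \<in> range (\<lambda>i. real_of_rat (\<pi> i))" "t \<le> inf_val \<pi> \<longleftrightarrow> (\<forall>n. t \<le> real_of_rat (\<pi> n))"
proof -
  have "inf_val \<pi> = Min (range (\<lambda>i. real_of_rat (\<pi> i)))"
    unfolding inf_val_def by (rule cInf_eq_Min[OF f]) simp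
  then show "inf_val \<pi> \<in> range (\<lambda>i. real_of_rat (\<pi> i))" "t \<le> inf_val \<pi> \<longleftrightarrow> (\<forall>n. t \<le> real_of_rat (\<pi> n))"
    using Min_in[OF f] Min_ge_iff[OF f] by auto
qed

lemma sup_val_finite:
  assumes f: "finite (range (\<lambda>i. real_of_rat (\<pi> i)))"
  shows "sup_val \<pi> \<in> range (\<lambda>i. real_of_rat (\<pi> i))" "t \<le> sup_val \<pi> \<longleftrightarrow> (\<exists>n. t \<le> real_of_rat (\<pi> n))"
proof -
  have "sup_val \<pi> = Max (range (\<lambda>i. real_of_rat (\<pi> i)))"
    unfolding sup_val_def by (rule cSup_eq_Max[OF f]) simp
  then show "sup_val \<pi> \<in> range (\<lambda>i. real_of_rat (\<pi> i))" "t \<le> sup_val \<pi> \<longleftrightarrow> (\<exists>n. t \<le> real_of_rat (\<pi> n))"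
    using Max_in[OF f] Max_ge_iff[OF f] by auto
qed

text \<open>From some point on, only values that are taken infinitely often occur. The maximum and
  minimum of \<open>I\<close> are therefore the limit superior and limit inferior.\<close>

lemma recurrent_values:
  fixes f :: "nat \<Rightarrow> real"
  assumes f: "finite (range f)"
  defines "I \<equiv> {x \<in> range f. \<exists>\<^sub>\<infinity>n. f n = x}"
  shows "finite I" "I \<noteq> {}" "\<exists>N. \<forall>n\<ge>N. f n \<in> I" "(\<exists>\<^sub>\<infinity>n. X (f n)) \<longleftrightarrow> (\<exists>x\<in>I. X x)"
proof -
  show fI: "finite I" unfolding I_def using f by simp
  have inf: "(\<exists>\<^sub>\<infinity>n. X (f n)) \<longleftrightarrow> (\<exists>x\<in>I. X x)" for X
  proof
    assume "\<exists>\<^sub>\<infinity>n. X (f n)"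
    then have "\<exists>\<^sub>\<infinity>n. \<exists>x\<in>range f. X x \<and> f n = x" by (rule INFM_mono) auto
    then obtain x where "x \<in> range f" "\<exists>\<^sub>\<infinity>n. X x \<and> f n = x" unfolding INFM_finite_Bex_distrib[OF f] by blast
    then show "\<exists>x\<in>I. X x" unfolding I_def by (auto elim: INFM_mono dest: INFM_EX)
  next
    assume "\<exists>x\<in>I. X x"
    then show "\<exists>\<^sub>\<infinity>n. X (f n)" unfolding I_def by (auto elim: INFM_mono)
  qed
  then show "(\<exists>\<^sub>\<infinity>n. X (f n)) \<longleftrightarrow> (\<exists>x\<in>I. X x)" .
  show "I \<noteq> {}" using inf[of "\<lambda>_. True"] by auto
  have "\<not> (\<exists>\<^sub>\<infinity>n. f n \<notin> I)" using inf[of "\<lambda>x. x \<notin> I"] by blast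
  then show "\<exists>N. \<forall>n\<ge>N. f n \<in> I" by (simp add: MOST_nat_le)
qed

lemma limsup_val_finite:
  assumes f: "finite (range (\<lambda>i. real_of_rat (\<pi> i)))"
  shows "limsup_val \<pi> \<in> range (\<lambda>i. real_of_rat (\<pi> i))"
    "t \<le> limsup_val \<pi> \<longleftrightarrow> (\<exists>\<^sub>\<infinity>n. t \<le> real_of_rat (\<pi> n))"
proof -
  let ?f = "\<lambda>i. real_of_rat (\<pi> i)"
  define I where "I = {x \<in> range ?f. \<exists>\<^sub>\<infinity>n. ?f n = x}"
  note I = recurrent_values[OF f, folded I_def]
  obtain N where N: "\<And>n. n \<ge> N \<Longrightarrow> ?f n \<in> I" using I(3) by blast
  have "(SUP i\<in>{n..}. ?f i) = Max I" if "n \<ge> N" for n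
  proof (rule cSup_eq_maximum)
    have "\<exists>\<^sub>\<infinity>i. ?f i = Max I" using Max_in[OF I(1,2)] unfolding I_def by blast
    then obtain i where "i \<ge> n" "?f i = Max I" unfolding INFM_nat_le by blast
    then show "Max I \<in> ?f ` {n..}" by force
    show "x \<le> Max I" if "x \<in> ?f ` {n..}" for x using that N \<open>n \<ge> N\<close> Max_ge[OF I(1)] by fastforce
  qed
  then have "limsup_val \<pi> = Max I"
    unfolding limsup_val_def by (intro limI tendsto_eventually) (auto simp: eventually_sequentially)
  then show "limsup_val \<pi> \<in> range ?f" "t \<le> limsup_val \<pi> \<longleftrightarrow> (\<exists>\<^sub>\<infinity>n. t \<le> ?f n)"
    using Max_in[OF I(1,2)] Max_ge_iff[OF I(1,2)] I(4)[of "\<lambda>x. t \<le> x"] by (auto simp: I_def)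
qed

lemma liminf_val_finite:
  assumes f: "finite (range (\<lambda>i. real_of_rat (\<pi> i)))"
  shows "liminf_val \<pi> \<in> range (\<lambda>i. real_of_rat (\<pi> i))"
    "liminf_val \<pi> < t \<longleftrightarrow> (\<exists>\<^sub>\<infinity>n. real_of_rat (\<pi> n) < t)"
proof -
  let ?f = "\<lambda>i. real_of_rat (\<pi> i)"
  define I where "I = {x \<in> range ?f. \<exists>\<^sub>\<infinity>n. ?f n = x}"
  note I = recurrent_values[OF f, folded I_def]
  obtain N where N: "\<And>n. n \<ge> N \<Longrightarrow> ?f n \<in> I" using I(3) by blast
  have "(INF i\<in>{n..}. ?f i) = Min I" if "n \<ge> N" for n
  proof (rule cInf_eq_minimum)
    have "\<exists>\<^sub>\<infinity>i. ?f i = Min I" using Min_in[OF I(1,2)] unfolding I_def by blast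
    then obtain i where "i \<ge> n" "?f i = Min I" unfolding INFM_nat_le by blast
    then show "Min I \<in> ?f ` {n..}" by force
    show "Min I \<le> x" if "x \<in> ?f ` {n..}" for x using that N \<open>n \<ge> N\<close> Min_le[OF I(1)] by fastforce
  qed
  then have "liminf_val \<pi> = Min I"
    unfolding liminf_val_def by (intro limI tendsto_eventually) (auto simp: eventually_sequentially)
  then show "liminf_val \<pi> \<in> range ?f" "liminf_val \<pi> < t \<longleftrightarrow> (\<exists>\<^sub>\<infinity>n. ?f n < t)"
    using Min_in[OF I(1,2)] Min_less_iff[OF I(1,2)] I(4)[of "\<lambda>x. x < t"] by (auto simp: I_def)
qed

section \<open>One-bit monitors of weight sequences\<close>

lemma foldl_and: "foldl (\<lambda>b x. b \<and> X x) True h \<longleftrightarrow> (\<forall>x\<in>set h. X x)"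
  by (induction h rule: rev_induct) auto

lemma foldl_or: "foldl (\<lambda>b x. b \<or> X x) False h \<longleftrightarrow> (\<exists>x\<in>set h. X x)"
  by (induction h rule: rev_induct) auto

lemma foldl_last: "foldl (\<lambda>b x. X x) False (pre \<pi> j) \<longleftrightarrow> 0 < j \<and> X (\<pi> (j - 1))"
  by (cases j) auto

lemma set_pre: "set (pre \<pi> j) = \<pi> ` {..<j}"
  by (auto simp: pre_def)

text \<open>Once false, the conjunction stays false, so being true infinitely often amounts to being
  true always.\<close>

lemma INFM_foldl_and: "(\<exists>\<^sub>\<infinity>j. foldl (\<lambda>b x. b \<and> X x) True (pre \<pi> j)) \<longleftrightarrow> (\<forall>n. X (\<pi> n))"
proof
  assume L: "\<exists>\<^sub>\<infinity>j. foldl (\<lambda>b x. b \<and> X x) True (pre \<pi> j)"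
  show "\<forall>n. X (\<pi> n)"
  proof
    fix n
    obtain j where "j > n" "\<forall>x\<in>\<pi> ` {..<j}. X x" using L unfolding foldl_and set_pre INFM_nat by blast
    then show "X (\<pi> n)" by blast
  qed
qed (auto simp: foldl_and set_pre INFM_nat)

lemma INFM_foldl_or: "(\<exists>\<^sub>\<infinity>j. foldl (\<lambda>b x. b \<or> X x) False (pre \<pi> j)) \<longleftrightarrow> (\<exists>n. X (\<pi> n))"
proof
  assume "\<exists>n. X (\<pi> n)"
  then obtain n where "X (\<pi> n)" by blast
  then show "\<exists>\<^sub>\<infinity>j. foldl (\<lambda>b x. b \<or> X x) False (pre \<pi> j)"
    unfolding foldl_or set_pre INFM_nat
  proof (intro allI)
    fix m show "\<exists>j>m. \<exists>x\<in>\<pi> ` {..<j}. X x"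
      using \<open>X (\<pi> n)\<close> by (intro exI[of _ "Suc (max m n)"]) auto
  qed
qed (auto simp: foldl_or set_pre INFM_nat)

lemma INFM_foldl_last: "(\<exists>\<^sub>\<infinity>j. foldl (\<lambda>b x. X x) False (pre \<pi> j)) \<longleftrightarrow> (\<exists>\<^sub>\<infinity>n. X (\<pi> n))"
proof
  assume L: "\<exists>\<^sub>\<infinity>j. foldl (\<lambda>b x. X x) False (pre \<pi> j)"
  show "\<exists>\<^sub>\<infinity>n. X (\<pi> n)"
    unfolding INFM_nat_le
  proof
    fix m
    obtain j where "j \<ge> Suc m" "X (\<pi> (j - 1))" using L unfolding foldl_last INFM_nat_le by blast
    then show "\<exists>n\<ge>m. X (\<pi> n)" by (intro exI[of _ "j - 1"]) auto
  qed
next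
  assume R: "\<exists>\<^sub>\<infinity>n. X (\<pi> n)"
  show "\<exists>\<^sub>\<infinity>j. foldl (\<lambda>b x. X x) False (pre \<pi> j)"
    unfolding foldl_last INFM_nat_le
  proof
    fix m
    obtain n where "n \<ge> m" "X (\<pi> n)" using R unfolding INFM_nat_le by blast
    then show "\<exists>j\<ge>m. 0 < j \<and> X (\<pi> (j - 1))" by (intro exI[of _ "Suc n"]) auto
  qed
qed

lemma wins_letter_game_finite_values:
  fixes A :: "('a::finite, 'q::finite) automaton"
  assumes inf: "infinite (UNIV :: 'v set)"
    and v: "v \<in> {inf_val, sup_val, liminf_val, limsup_val}"
    and gfg: "good_for_games TYPE('v) A (OnInf v) (OnInf g)"
    and A: "realizes A (OnInf v) (OnInf g)"
  shows "wins (letter_game (opponent P) A) P (letter_condition P A (OnInf v) t)"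
proof -
  let ?Z = "real_of_rat ` weights A"
  note wins = wins_letter_game_monitor[OF inf gfg A, of ?Z]
  have Z: "finite ?Z" using finite_weights[of A] by blast
  have vZ: "v \<pi> \<in> ?Z" if "range \<pi> \<subseteq> weights A" for \<pi>
  proof -
    note f = finite_range_weights[OF that]
    show ?thesis
      using v f(2) inf_val_finite(1)[OF f(1)] sup_val_finite(1)[OF f(1)] liminf_val_finite(1)[OF f(1)]
        limsup_val_finite(1)[OF f(1)] by blast
  qed
  have fin: "finite (range (\<lambda>i. real_of_rat (\<pi> i)))" if "range \<pi> \<subseteq> weights A" for \<pi>
    using finite_range_weights(1)[OF that] .
  from v consider "v = inf_val" | "v = sup_val" | "v = liminf_val" | "v = limsup_val" by blast
  then show ?thesis
  proof cases
    case 1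
    show ?thesis
      by (rule wins[OF Z vZ, where R = Eve and ?b0.0 = True and upd = "\<lambda>b x. b \<and> t \<le> real_of_rat x"])
        (auto simp: 1 INFM_foldl_and inf_val_finite(2)[OF fin])
  next
    case 2
    show ?thesis
      by (rule wins[OF Z vZ, where R = Eve and ?b0.0 = False and upd = "\<lambda>b x. b \<or> t \<le> real_of_rat x"])
        (auto simp: 2 INFM_foldl_or sup_val_finite(2)[OF fin])
  next
    \<comment> \<open>Here \<open>t \<le> liminf_val \<pi>\<close> is a condition on all but
      finitely many weights. Its negation has the form required of a monitor, so Adam takes the role
      of \<open>R\<close>.\<close>
    case 3
    show ?thesis
      by (rule wins[OF Z vZ, where R = Adam and ?b0.0 = False and upd = "\<lambda>b x. real_of_rat x < t"])
        (auto simp: 3 INFM_foldl_last liminf_val_finite(2)[OF fin])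
  next
    case 4
    show ?thesis
      by (rule wins[OF Z vZ, where R = Eve and ?b0.0 = False and upd = "\<lambda>b x. t \<le> real_of_rat x"])
        (auto simp: 4 INFM_foldl_last limsup_val_finite(2)[OF fin])
  qed
qed

section \<open>Uniformly continuous value functions\<close>

text \<open>Uniform continuity on \<open>D\<close>, where closeness is measured by the length of a
  common prefix.\<close>

definition uniform_on :: "(nat \<Rightarrow> 'l) set \<Rightarrow> ((nat \<Rightarrow> 'l) \<Rightarrow> real) \<Rightarrow> bool" where
  "uniform_on D F \<longleftrightarrow>
     (\<forall>\<epsilon>>0. \<exists>n. \<forall>s\<in>D. \<forall>s'\<in>D. pre s n = pre s' n \<longrightarrow> \<bar>F s - F s'\<bar> \<le> \<epsilon>)"

lemma uniform_onD:
  assumes "uniform_on D F" "0 < \<epsilon>"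
  obtains n where "\<And>s s'. s \<in> D \<Longrightarrow> s' \<in> D \<Longrightarrow> pre s n = pre s' n \<Longrightarrow> \<bar>F s - F s'\<bar> \<le> \<epsilon>"
  using assms unfolding uniform_on_def by blast

text \<open>By continuity, \<open>t \<le> F s\<close> is closed relative to \<open>D\<close>: it
  holds once every prefix of \<open>s\<close> is one of some \<open>s'\<close> in \<open>D\<close>
  with \<open>t \<le> F s'\<close>.\<close>

lemma uniform_on_sigma3:
  assumes F: "uniform_on D F"
  shows "\<exists>X. sigma3 X \<and> (\<forall>s. s \<in> D \<longrightarrow> (s \<in> X \<longleftrightarrow> secures Q t (ereal (F s))))"
proof -
  define C where "C = {h. \<exists>s\<in>D. t \<le> F s \<and> h = pre s (length h)}"
  have *: "(\<forall>k. pre s k \<in> C) \<longleftrightarrow> t \<le> F s" if s: "s \<in> D" for s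
  proof
    assume C: "\<forall>k. pre s k \<in> C"
    show "t \<le> F s"
    proof (rule field_le_epsilon)
      fix \<epsilon> :: real assume "0 < \<epsilon>"
      then obtain n where n: "\<And>s s'. s \<in> D \<Longrightarrow> s' \<in> D \<Longrightarrow> pre s n = pre s' n \<Longrightarrow> \<bar>F s - F s'\<bar> \<le> \<epsilon>"
        using uniform_onD[OF F] by metis
      obtain s' where "s' \<in> D" "t \<le> F s'" "pre s n = pre s' n" using C[rule_format, of n] unfolding C_def by auto
      then show "t \<le> F s + \<epsilon>" using n[OF s, of s'] by simp
    qed
  next
    assume "t \<le> F s"
    then show "\<forall>k. pre s k \<in> C" using s unfolding C_def by auto
  qed
  show ?thesis
  proof (cases Q)
    case Eve
    show ?thesis
      by (rule exI[of _ "{s. \<forall>k. pre s k \<in> C}"]) (use Eve * gdelta_sigma3[OF gdelta_closed, of C] in auto)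
  next
    case Adam
    show ?thesis
      by (rule exI[of _ "{s. \<exists>k. pre s k \<in> - C}"])
        (use Adam * gdelta_sigma3[OF gdelta_open, of "- C"] in \<open>force simp: not_le\<close>)
  qed
qed

text \<open>The plays following \<open>S\<close> form a closed and finitely branching set, and
  \<open>F\<close> of the output depends continuously on the play, so \<open>compact_bound\<close>
  applies.\<close>

lemma outcomes_bound:
  fixes A :: "('a::finite, 'q) automaton"
  assumes S: "tree (letter_game P A) Q S" "prefix_closed S"
    and F: "uniform_on {s. range (snd \<circ> s) \<subseteq> weights A} F"
    and less: "\<And>s. s \<in> outcomes (letter_game P A) S \<Longrightarrow> F s < t"
  shows "\<exists>a<t. \<forall>s\<in>outcomes (letter_game P A) S. F s \<le> a"
proof -
  let ?L = "letter_game P A"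
  define C where "C = {q. play ?L (InfSeq q) \<and> follows S (InfSeq q)}"
  define out where "out q = (THE s. out_word ?L (InfSeq q) = InfSeq s)" for q
  have out: "out_word ?L (InfSeq q) = InfSeq (out q)" "out q \<in> outcomes ?L S" if q: "q \<in> C" for q
  proof -
    obtain s where s: "out_word ?L (InfSeq q) = InfSeq s"
      using letter_play_InfSeq[of P A "InfSeq q"] q unfolding C_def by blast
    then show "out_word ?L (InfSeq q) = InfSeq (out q)" unfolding out_def by simp
    then show "out q \<in> outcomes ?L S" using q unfolding outcomes_def C_def by blast
  qed
  have labs: "labs ?L (pre q (Suc n)) = pre (out q) (length (labs ?L (pre q (Suc n))))" if q: "q \<in> C" for q n
  proof -
    have "play ?L (InfSeq q)" using q by (simp add: C_def)
    from letter_play_InfSeq[OF this] obtain q' s where "InfSeq q = InfSeq q'" "out_word ?L (InfSeq q) = InfSeq s"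
      "\<And>n. labs ?L (pre q' (Suc n)) = pre s (length (labs ?L (pre q' (Suc n))))" by blast
    then show ?thesis using out(1)[OF q] by simp
  qed
  have "\<exists>a<t. \<forall>q\<in>C. F (out q) \<le> a"
  proof (rule compact_bound)
    fix h
    show "finite {p (length h) | p. p \<in> C \<and> pre p (length h) = h}"
    proof (cases "h = []")
      case True
      have "{p (length h) | p. p \<in> C \<and> pre p (length h) = h} \<subseteq> {LState (start A)}"
        using True by (auto simp: C_def)
      then show ?thesis using finite_subset by blast
    next
      case False
      have "{p (length h) | p. p \<in> C \<and> pre p (length h) = h} \<subseteq> {s. letter_edge A (last h) s}"
      proof
        fix x assume "x \<in> {p (length h) | p. p \<in> C \<and> pre p (length h) = h}"
        then obtain p where p: "x = p (length h)" "p \<in> C" "pre p (length h) = h" by blast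
        obtain n where n: "length h = Suc n" using False by (cases h) auto
        have "last h = p n" using p(3) unfolding n by (metis last_snoc pre_Suc)
        moreover have "letter_edge A (p n) (p (Suc n))" using p(2) by (simp add: C_def)
        ultimately show "x \<in> {s. letter_edge A (last h) s}" using p(1) n by simp
      qed
      then show ?thesis using finite_letter_edge finite_subset by blast
    qed
  next
    fix p assume p: "\<And>n. \<exists>p'\<in>C. pre p' n = pre p n"
    have *: "partial_play ?L (pre p (Suc n))" "pre p (Suc n) \<in> S" for n
    proof -
      obtain p' where p': "p' \<in> C" "pre p' (Suc n) = pre p (Suc n)" using p by blast
      have "follows S (InfSeq p')" using p'(1) by (simp add: C_def)
      then have "pre p' (Suc n) \<in> S" unfolding follows_def pref_InfSeq_pre by blast
      then show "pre p (Suc n) \<in> S" using p'(2) by (simp only:)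
      then show "partial_play ?L (pre p (Suc n))" by (rule tree_partial_play[OF S(1)])
    qed
    have "play ?L (InfSeq p)"
      unfolding play_InfSeq_iff using *(1) by (simp add: pre_def del: upt_Suc)
    moreover have "follows S (InfSeq p)" unfolding follows_def pref_InfSeq_pre using *(2) by blast
    ultimately show "p \<in> C" by (simp add: C_def)
  next
    fix p assume p: "p \<in> C"
    define \<epsilon> where "\<epsilon> = (t - F (out p)) / 2"
    have \<epsilon>: "0 < \<epsilon>" "F (out p) + \<epsilon> < t" using less[OF out(2)[OF p]] by (simp_all add: \<epsilon>_def field_simps)
    obtain N where N: "\<And>s s'. s \<in> {s. range (snd \<circ> s) \<subseteq> weights A} \<Longrightarrow> s' \<in> {s. range (snd \<circ> s) \<subseteq> weights A}
      \<Longrightarrow> pre s N = pre s' N \<Longrightarrow> \<bar>F s - F s'\<bar> \<le> \<epsilon>" by (rule uniform_onD[OF F \<epsilon>(1)]) (rule that)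
    obtain n where n: "N \<le> length (labs ?L (pre p (Suc n)))"
      using length_letter_labs[of P A "InfSeq p" N] p unfolding C_def pref_InfSeq_pre by blast
    have "F (out p') \<le> F (out p) + \<epsilon>" if p': "p' \<in> C" "pre p' (Suc n) = pre p (Suc n)" for p'
    proof -
      have N_pre: "pre (out x) N = take N (labs ?L (pre p (Suc n)))"
        if "x \<in> C" "pre x (Suc n) = pre p (Suc n)" for x
        using labs[OF that(1), of n] n take_pre[of N "out x"] unfolding that(2) by (metis min.absorb1)
      have "pre (out p) N = pre (out p') N" using N_pre[OF p refl] N_pre[OF p'] by simp
      then have "\<bar>F (out p) - F (out p')\<bar> \<le> \<epsilon>"
        using N[of "out p" "out p'"] outcomes_weights[OF out(2)[OF p]] outcomes_weights[OF out(2)[OF p'(1)]] by simp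
      then show ?thesis by simp
    qed
    then show "\<exists>c<t. \<exists>n. \<forall>p'\<in>C. pre p' n = pre p n \<longrightarrow> F (out p') \<le> c" using \<epsilon>(2) by blast
  qed
  then obtain a where a: "a < t" "\<And>q. q \<in> C \<Longrightarrow> F (out q) \<le> a" by blast
  have "F s \<le> a" if s: "s \<in> outcomes ?L S" for s
  proof -
    obtain q where q: "q \<in> C" "out_word ?L (InfSeq q) = InfSeq s" using s unfolding outcomes_def C_def by blast
    then show ?thesis using a(2)[OF q(1)] out(1)[OF q(1)] by simp
  qed
  then show ?thesis using a(1) by blast
qed

text \<open>A play on one word following Eve's tree and a play on the other word following Adam's tree can share
  their first \<open>n\<close> rounds, as the two games agree on these.\<close>

lemma common_history:
  fixes A :: "('a, 'q) automaton"
  assumes S: "tree (word_game A (InfSeq w)) Eve S" and S': "tree (word_game A (InfSeq w')) Adam S'"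
    and w: "pre w n = pre w' n"
  shows "i \<le> n \<Longrightarrow> \<exists>h\<in>S \<inter> S'. \<exists>q. last h = State i q"
proof (induction i)
  case 0
  have "[State 0 (start A)] \<in> S \<inter> S'" using tree_init[OF S] tree_init[OF S'] by simp
  then show ?case by (intro bexI[of _ "[State 0 (start A)]"]) auto
next
  case (Suc i)
  \<comment> \<open>Where one tree chooses between the two subformulas, the other contains both
    continuations, so a common history can be prolonged.\<close>
  have descend: "h \<in> S \<inter> S' \<Longrightarrow> last h = Choice j \<phi> \<Longrightarrow> \<exists>h\<in>S \<inter> S'. \<exists>q. last h = State j q" for h j \<phi>
  proof (induction \<phi> arbitrary: h)
    case (Atom y)
    obtain x q where y: "y = (x, q)" by (metis surj_pair)
    have "h @ [State j q] \<in> S \<inter> S'"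
      using word_tree_Atom[OF S, of h j x q] word_tree_Atom[OF S', of h j x q] Atom y by simp
    then show ?case by (intro bexI[of _ "h @ [State j q]"]) auto
  next
    case (Or \<phi> \<psi>)
    then have "h @ [Choice j \<phi>] \<in> S \<inter> S' \<or> h @ [Choice j \<psi>] \<in> S \<inter> S'"
      using word_tree_Or[OF S, of h j \<phi> \<psi>] word_tree_Or[OF S', of h j \<phi> \<psi>] by auto
    then show ?case using Or.IH(1)[of "h @ [Choice j \<phi>]"] Or.IH(2)[of "h @ [Choice j \<psi>]"] by auto
  next
    case (And \<phi> \<psi>)
    then have "h @ [Choice j \<phi>] \<in> S \<inter> S' \<or> h @ [Choice j \<psi>] \<in> S \<inter> S'"
      using word_tree_And[OF S, of h j \<phi> \<psi>] word_tree_And[OF S', of h j \<phi> \<psi>] by auto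
    then show ?case using And.IH(1)[of "h @ [Choice j \<phi>]"] And.IH(2)[of "h @ [Choice j \<psi>]"] by auto
  qed
  obtain h q where h: "h \<in> S" "h \<in> S'" "last h = State i q" using Suc by auto
  have "w i = w' i" using arg_cong[OF w, of "\<lambda>u. u ! i"] Suc.prems by simp
  then have "h @ [Choice (Suc i) (delta A q (w i))] \<in> S \<inter> S'"
    using word_tree_State[OF S h(1,3)] word_tree_State[OF S' h(2,3)] by simp
  then show ?case using descend[of "h @ [Choice (Suc i) (delta A q (w i))]"] by simp
qed

lemma word_tree_extend:
  fixes A :: "('a, 'q) automaton"
  assumes S: "tree (word_game A (InfSeq w)) P S" "prefix_closed S" and h: "h \<in> S"
  obtains p \<pi> where "play (word_game A (InfSeq w)) p" "follows S p"
    "payoff (word_game A (InfSeq w)) (OnInf v) p = ereal (v \<pi>)" "range \<pi> \<subseteq> weights A"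
    "labs (word_game A (InfSeq w)) h = pre \<pi> (length (labs (word_game A (InfSeq w)) h))"
proof -
  let ?W = "word_game A (InfSeq w)"
  obtain p where p: "play ?W p" "pref p (length h) = h" "follows S p"
    using tree_prefix_closed_play_exists[OF S h] by blast
  obtain q \<pi> where q: "p = InfSeq q" "out_word ?W p = InfSeq \<pi>"
    "\<And>n. labs ?W (pre q n) = pre \<pi> (length (labs ?W (pre q n)))" "range \<pi> \<subseteq> weights A"
    by (rule word_play_InfSeq[OF p(1)]) (rule that)
  have "labs ?W h = pre \<pi> (length (labs ?W h))" using q(3)[of "length h"] p(2) unfolding q(1) pref_InfSeq_pre by simp
  then show thesis using that[OF p(1,3) _ q(4)] q(2) by (simp add: payoff_def)
qed

text \<open>The plays obtained from \<open>common_history\<close> output the same first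
  \<open>n\<close> weights, so their values are close, although one follows a nearly optimal tree of
  Eve on \<open>w\<close> and the other one of Adam on \<open>w'\<close>.\<close>

lemma uniform_on_automaton:
  fixes A :: "('a, 'q) automaton"
  assumes A: "realizes A (OnInf v) (OnInf g)"
    and v: "uniform_on {\<pi>. range \<pi> \<subseteq> weights A} v"
  shows "uniform_on UNIV g"
  unfolding uniform_on_def
proof (intro allI impI)
  fix \<epsilon> :: real assume \<epsilon>: "0 < \<epsilon>"
  then have "0 < \<epsilon> / 2" by simp
  obtain n where n: "\<And>\<pi> \<pi>'. \<pi> \<in> {\<pi>. range \<pi> \<subseteq> weights A} \<Longrightarrow> \<pi>' \<in> {\<pi>. range \<pi> \<subseteq> weights A} \<Longrightarrow>
    pre \<pi> n = pre \<pi>' n \<Longrightarrow> \<bar>v \<pi> - v \<pi>'\<bar> \<le> \<epsilon> / 2"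
    by (rule uniform_onD[OF v \<open>0 < \<epsilon> / 2\<close>]) (rule that)
  have le: "g w \<le> g w' + \<epsilon>" if w: "pre w n = pre w' n" for w w'
  proof (rule ccontr)
    assume "\<not> ?thesis"
    then have gap: "g w' + \<epsilon> < g w" by simp
    \<comment> \<open>Each of the two trees may miss the optimum by \<open>\<epsilon> / 4\<close>,
      and the values of the plays differ by at most \<open>\<epsilon> / 2\<close>, which adds up to
      \<epsilon>.\<close>
    define t where "t = g w - \<epsilon> / 4"
    define t' where "t' = g w' + \<epsilon> / 4"
    let ?W = "word_game A (InfSeq w)" and ?W' = "word_game A (InfSeq w')"
    have "ereal t < eve_value ?W (OnInf v)" using \<epsilon> by (simp add: word_values[OF A] t_def)
    then obtain S where S: "tree ?W Eve S" "prefix_closed S"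
      "\<And>p. play ?W p \<Longrightarrow> follows S p \<Longrightarrow> secures Eve t (payoff ?W (OnInf v) p)"
      using eve_value_ensures unfolding ensures_def by blast
    have "adam_value ?W' (OnInf v) < ereal t'" using \<epsilon> by (simp add: word_values[OF A] t'_def)
    then obtain S' where S': "tree ?W' Adam S'" "prefix_closed S'"
      "\<And>p. play ?W' p \<Longrightarrow> follows S' p \<Longrightarrow> secures Adam t' (payoff ?W' (OnInf v) p)"
      using adam_value_ensures unfolding ensures_def by blast
    obtain h q where h: "h \<in> S" "h \<in> S'" "last h = State n q"
      using common_history[OF S(1) S'(1) w, of n] by auto
    obtain p \<pi> where p: "play ?W p" "follows S p" "payoff ?W (OnInf v) p = ereal (v \<pi>)"
      "range \<pi> \<subseteq> weights A" "labs ?W h = pre \<pi> (length (labs ?W h))"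
      by (rule word_tree_extend[OF S(1,2) h(1)]) (rule that)
    obtain p' \<pi>' where p': "play ?W' p'" "follows S' p'" "payoff ?W' (OnInf v) p' = ereal (v \<pi>')"
      "range \<pi>' \<subseteq> weights A" "labs ?W' h = pre \<pi>' (length (labs ?W' h))"
      by (rule word_tree_extend[OF S'(1,2) h(2)]) (rule that)
    have "length (labs ?W h) = n" using word_partial_play[OF tree_partial_play[OF S(1) h(1)]] h(3) by simp
    moreover have "labs ?W' h = labs ?W h" by (simp add: labs_def)
    ultimately have "pre \<pi> n = pre \<pi>' n" using p(5) p'(5) by simp
    then have "\<bar>v \<pi> - v \<pi>'\<bar> \<le> \<epsilon> / 2" using n[of \<pi> \<pi>'] p(4) p'(4) by simp
    then have "v \<pi> - v \<pi>' \<le> \<epsilon> / 2" by (rule abs_le_D1)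
    moreover have "t \<le> v \<pi>" using S(3)[OF p(1,2)] p(3) by simp
    moreover have "v \<pi>' < t'" using S'(3)[OF p'(1,2)] p'(3) by simp
    ultimately show False using gap unfolding t_def t'_def by linarith
  qed
  have "\<bar>g w - g w'\<bar> \<le> \<epsilon>" if "pre w n = pre w' n" for w w'
    using le[OF that] le[OF that[symmetric]] by (simp add: abs_le_iff)
  then show "\<exists>n. \<forall>s\<in>UNIV. \<forall>s'\<in>UNIV. pre s n = pre s' n \<longrightarrow> \<bar>g s - g s'\<bar> \<le> \<epsilon>" by blast
qed

lemma uniform_on_comp:
  assumes "uniform_on D F"
  shows "uniform_on {s. f \<circ> s \<in> D} (\<lambda>s. F (f \<circ> s))"
proof -
  have "pre (f \<circ> s) n = pre (f \<circ> s') n" if "pre s n = pre s' n" for s s' n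
    using arg_cong[OF that, of "map f"] by (simp add: pre_def)
  then show ?thesis using assms unfolding uniform_on_def by (metis mem_Collect_eq)
qed

lemma uniform_on_subset: "uniform_on D F \<Longrightarrow> D' \<subseteq> D \<Longrightarrow> uniform_on D' F"
  unfolding uniform_on_def by (meson subsetD)

lemma wins_letter_game_uniform:
  fixes A :: "('a::finite, 'q::finite) automaton"
  assumes inf: "infinite (UNIV :: 'v set)"
    and gfg: "good_for_games TYPE('v) A (OnInf v) (OnInf g)"
    and A: "realizes A (OnInf v) (OnInf g)"
    and v: "uniform_on {\<pi>. range \<pi> \<subseteq> weights A} v"
  shows "wins (letter_game (opponent P) A) P (letter_condition P A (OnInf v) t)"
proof (rule wins_letter_game_infinite[OF inf gfg A])
  have g: "uniform_on UNIV g" by (rule uniform_on_automaton[OF A v])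
  show "sigma3 {w. secures Q t (ereal (g w))}" for Q
  proof -
    obtain X where X: "sigma3 X" "\<And>w. w \<in> X \<longleftrightarrow> secures Q t (ereal (g w))"
      using uniform_on_sigma3[OF g, of Q t] by blast
    then have "X = {w. secures Q t (ereal (g w))}" by blast
    then show ?thesis using X(1) by simp
  qed
  show "\<exists>X. sigma3 X \<and> (\<forall>\<pi>. range \<pi> \<subseteq> weights A \<longrightarrow> (\<pi> \<in> X \<longleftrightarrow> secures Q t (ereal (v \<pi>))))" for Q
    using uniform_on_sigma3[OF v, of Q t] by simp
  fix Q S and F :: "(nat \<Rightarrow> 'a \<times> rat) \<Rightarrow> real"
  assume S: "tree (letter_game Q A) Q S" "prefix_closed S"
    and F: "F = (\<lambda>s. v (snd \<circ> s)) \<or> F = (\<lambda>s. g (fst \<circ> s))"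
    and less: "\<And>s. s \<in> outcomes (letter_game Q A) S \<Longrightarrow> F s < t"
  have "uniform_on {s :: nat \<Rightarrow> 'a \<times> rat. range (snd \<circ> s) \<subseteq> weights A} F"
    using F
  proof
    assume F: "F = (\<lambda>s. v (snd \<circ> s))"
    show ?thesis unfolding F using uniform_on_comp[OF v, of snd] by simp
  next
    assume F: "F = (\<lambda>s. g (fst \<circ> s))"
    show ?thesis unfolding F by (rule uniform_on_subset[OF uniform_on_comp[OF g, of fst]]) simp
  qed
  from outcomes_bound[OF S this less] show "\<exists>a<t. \<forall>s\<in>outcomes (letter_game Q A) S. F s \<le> a" .
qed

section \<open>Discounted sums\<close>

lemma dsum_val_close:
  assumes d: "0 < d" "d < 1" and B: "\<And>i. \<bar>real_of_rat (\<pi> i)\<bar> \<le> B" "\<And>i. \<bar>real_of_rat (\<pi>' i)\<bar> \<le> B"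
    and eq: "pre \<pi> n = pre \<pi>' n"
  shows "\<bar>dsum_val d \<pi> - dsum_val d \<pi>'\<bar> \<le> 2 * B / (1 - real_of_rat d) * real_of_rat d ^ n"
proof -
  define r where "r = real_of_rat d"
  have r: "0 < r" "r < 1" using d by (simp_all add: r_def)
  have summ: "summable (\<lambda>i. r ^ i * real_of_rat (\<rho> i))" if "\<And>i. \<bar>real_of_rat (\<rho> i)\<bar> \<le> B" for \<rho>
  proof (rule summable_comparison_test')
    show "summable (\<lambda>i. B * r ^ i)" using r by (intro summable_mult summable_geometric) simp
    show "norm (r ^ i * real_of_rat (\<rho> i)) \<le> B * r ^ i" if "i \<ge> 0" for i
      using mult_right_mono[OF \<open>\<And>i. \<bar>real_of_rat (\<rho> i)\<bar> \<le> B\<close>[of i], of "r ^ i"] r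
      by (simp add: abs_mult mult.commute)
  qed
  define c where "c i = r ^ i * (real_of_rat (\<pi> i) - real_of_rat (\<pi>' i))" for i
  have c_eq: "c = (\<lambda>i. r ^ i * real_of_rat (\<pi> i) - r ^ i * real_of_rat (\<pi>' i))"
    unfolding c_def by (simp add: right_diff_distrib)
  have s: "summable (\<lambda>i. r ^ i * real_of_rat (\<pi> i))" "summable (\<lambda>i. r ^ i * real_of_rat (\<pi>' i))"
    by (rule summ, rule B)+
  have c: "summable c" "dsum_val d \<pi> - dsum_val d \<pi>' = suminf c"
    unfolding c_eq dsum_val_def r_def[symmetric] using summable_diff[OF s] suminf_diff[OF s] by simp_all
  have "c i = 0" if "i < n" for i
    using arg_cong[OF eq, of "\<lambda>u. u ! i"] that by (simp add: c_def)
  \<comment> \<open>Equal prefixes cancel the first \<open>n\<close> terms; the tail is dominated by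
    a geometric series, as two weights differ by at most \<open>2 * B\<close>.\<close>
  then have "suminf c = (\<Sum>i. c (i + n))" using suminf_split_initial_segment[OF c(1), of n] by simp
  moreover have "norm (\<Sum>i. c (i + n)) \<le> (\<Sum>i. 2 * B * r ^ n * r ^ i)"
  proof (rule norm_suminf_le)
    fix i
    have "\<bar>real_of_rat (\<pi> (i + n)) - real_of_rat (\<pi>' (i + n))\<bar> \<le> 2 * B"
      using B(1)[of "i + n"] B(2)[of "i + n"] by linarith
    then have "r ^ (i + n) * \<bar>real_of_rat (\<pi> (i + n)) - real_of_rat (\<pi>' (i + n))\<bar> \<le> r ^ (i + n) * (2 * B)"
      using r by (intro mult_left_mono) simp_all
    moreover have "norm (c (i + n)) = r ^ (i + n) * \<bar>real_of_rat (\<pi> (i + n)) - real_of_rat (\<pi>' (i + n))\<bar>"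
      using r by (simp add: c_def abs_mult)
    moreover have "r ^ (i + n) * (2 * B) = 2 * B * r ^ n * r ^ i" by (simp add: power_add)
    ultimately show "norm (c (i + n)) \<le> 2 * B * r ^ n * r ^ i" by simp
    show "summable (\<lambda>i. 2 * B * r ^ n * r ^ i)" using r by (intro summable_mult summable_geometric) simp
  qed
  moreover have "(\<Sum>i. 2 * B * r ^ n * r ^ i) = 2 * B / (1 - r) * r ^ n"
    using r suminf_mult[OF summable_geometric, of r "2 * B * r ^ n"] suminf_geometric[of r] by simp
  ultimately show ?thesis using c(2) unfolding r_def by simp
qed

lemma uniform_on_dsum_val:
  fixes A :: "('a::finite, 'q::finite) automaton"
  assumes d: "0 < d" "d < 1"
  shows "uniform_on {\<pi>. range \<pi> \<subseteq> weights A} (dsum_val d)"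
  unfolding uniform_on_def
proof (intro allI impI)
  fix \<epsilon> :: real assume \<epsilon>: "0 < \<epsilon>"
  let ?r = "real_of_rat d"
  \<comment> \<open>A crude bound on the absolute values of the finitely many weights.\<close>
  define B where "B = (\<Sum>x\<in>weights A. \<bar>real_of_rat x\<bar>)"
  have B: "\<bar>real_of_rat (\<pi> i)\<bar> \<le> B" if "range \<pi> \<subseteq> weights A" for \<pi> i
    unfolding B_def using that finite_weights[of A] by (intro member_le_sum) auto
  have "(\<lambda>n. 2 * B / (1 - ?r) * ?r ^ n) \<longlonglongrightarrow> 2 * B / (1 - ?r) * 0"
    using d by (intro tendsto_intros LIMSEQ_power_zero) simp
  then have "\<forall>\<^sub>F n in sequentially. 2 * B / (1 - ?r) * ?r ^ n < \<epsilon>" using \<epsilon> by (intro order_tendstoD) simp_all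
  then obtain n where "2 * B / (1 - ?r) * ?r ^ n < \<epsilon>" by (auto simp: eventually_sequentially)
  then have "\<bar>dsum_val d \<pi> - dsum_val d \<pi>'\<bar> \<le> \<epsilon>"
    if "range \<pi> \<subseteq> weights A" "range \<pi>' \<subseteq> weights A" "pre \<pi> n = pre \<pi>' n" for \<pi> \<pi>'
    using dsum_val_close[OF d B[OF that(1)] B[OF that(2)] that(3)] by linarith
  then show "\<exists>n. \<forall>s\<in>{\<pi>. range \<pi> \<subseteq> weights A}. \<forall>s'\<in>{\<pi>. range \<pi> \<subseteq> weights A}.
      pre s n = pre s' n \<longrightarrow> \<bar>dsum_val d s - dsum_val d s'\<bar> \<le> \<epsilon>" by blast
qed

theorem theorem9:
  fixes A :: "('a::finite, 'q::finite) automaton"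
    and Val :: "rat seqfun"
    and f :: "'a seqfun"
  assumes "(\<exists>v. Val = OnFin v)
      \<or> Val \<in> {OnInf inf_val, OnInf sup_val, OnInf liminf_val, OnInf limsup_val}
      \<or> (\<exists>d. 0 < d \<and> d < 1 \<and> Val = OnInf (dsum_val d))"
    and "realizes A Val f"
    and "infinite (UNIV :: 'v set)"
  shows "good_for_games TYPE('v) A Val f \<longleftrightarrow> threshold_history_deterministic A Val"
proof
  assume "threshold_history_deterministic A Val"
  then show "good_for_games TYPE('v) A Val f"
    by (rule threshold_history_deterministic_good_for_games[OF assms(2)])
next
  assume gfg: "good_for_games TYPE('v) A Val f"
  have "wins (letter_game (opponent P) A) P (letter_condition P A Val t)" for P t
    using assms(2)
  proof (cases rule: realizes_cases)
    case (1 v g)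
    show ?thesis using wins_letter_game_finite[OF assms(3), of A v g P t] gfg assms(2) 1 by simp
  next
    case (2 v g)
    from assms(1) 2(1) consider "v \<in> {inf_val, sup_val, liminf_val, limsup_val}"
      | d where "0 < d" "d < 1" "v = dsum_val d" by auto
    then show ?thesis
    proof cases
      case 1
      show ?thesis using wins_letter_game_finite_values[OF assms(3) 1, of A g P t] gfg assms(2) 2 by simp
    next
      case 2
      note v = uniform_on_dsum_val[OF 2(1,2), of A]
      show ?thesis
        using wins_letter_game_uniform[OF assms(3), of A v g P t] v 2(3) gfg assms(2)
          \<open>Val = OnInf v\<close> \<open>f = OnInf g\<close> by simp
    qed
  qed
  then show "threshold_history_deterministic A Val" unfolding threshold_history_deterministic_iff by blast
qed

end
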